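(* Let $(N_i)_{i\ge0}$ and $(u_i)_{i\ge0}$ be the integer sequences defined in the context. (i) If there exists $j\ge 0$ such that $N_j<k<N_{j+1}$, then there exists a constant $h_k$ such that $$[z^n]H_{\le k}(z)\sim h_k\, n^{-3/2}\,(\sigma_{j,k})^{-n},\qquad n\to\infty.$$ (ii) If there exists $j$ such that $k=N_j$, then $$[z^n]H_{\le N_j}(z)\sim h_k\,n^{-5/4}\,(\sigma_{j,k})^{-n}=h_{N_j}\,n^{-5/4}\,(2u_j)^n,\qquad n\to\infty,$$ where $$h_{N_j}=\frac{\gamma_j^{1/4}(2u_j)^{1/4}}{2^{N_j-j+2}\sqrt2\;\Gamma(3/4)\sqrt{\prod_{i=1}^{N_j-j}\lambda_i}}.$$
   Context: The integer sequences are $u_0=0$, $u_{i+1}=u_i^2+i+1$ for $i\ge0$, and $N_i=u_i^2-u_i+i$ for $i\ge 0$. A closed lambda-term (up to $\alpha$-equivalence) is a Motzkin tree (finite plane rooted tree, each node having 0, 1 or 2 children) together with a map assigning to every leaf one unary node on the path from the root to that leaf. Its size is the number of nodes; its unary height is the maximum over vertices $v$ of the number of unary nodes on the path from the root to $v$. $H_{\le k}(z)$ is the generating function by size of closed lambda-terms of unary height at most $k$. One has $H_{\le k}(z)=\frac{1-\sqrt{R_{k+1,k}(z)}}{2z}$, where $R_{1,k}(z)=1-4kz^2$ and $R_{i,k}(z)=1-4(k-i+1)z^2-2z+2z\sqrt{R_{i-1,k}(z)}$ for $2\le i\le k+1$. For $j\ge1$, $k\in[N_j,N_{j+1})$ and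 $1\le i\le j+1$, $\sigma_{i,k}$ denotes the smallest positive root of $R_{i,k}(z)$. The sequence $(\lambda_\ell)$ is defined by $\lambda_0=0$, $\lambda_{\ell+1}=\ell+1+\sqrt{\lambda_\ell}$ for $\ell\ge 0$, and $\gamma_j=-\frac{d}{dz}R_{j,N_j}(z)\big|_{z=\sigma_{j,N_j}}$. The notation $a_n\sim b_n$ means $a_n/b_n\to1$. Empty products equal $1$.
   Formalization: In (i) the printed σ_{j,k} is replaced by σ_{j+1,k}: as printed (i) is false, e.g. for j=1, k=2 the growth rate is 1/σ_{2,2}≈2.909, not 1/σ_{1,2}≈2.828. Part (ii) is stated for j≥1, since σ_{j,k} and γ_j are undefined for j=0. *)

theory Defs
  imports "HOL-Analysis.Analysis" "HOL-Library.Sublist"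
begin

primrec u_seq :: "nat \<Rightarrow> nat" where
  "u_seq 0 = 0"
| "u_seq (Suc i) = (u_seq i)\<^sup>2 + i + 1"

text \<open>The natural-number subtraction never truncates, as \<open>m \<le> m\<^sup>2\<close>.\<close>

definition N_seq :: "nat \<Rightarrow> nat" where
  "N_seq i = (u_seq i)\<^sup>2 - u_seq i + i"

datatype motzkin = Leaf | Unary motzkin | Binary motzkin motzkin

text \<open>
  A node is addressed by the list of child indices leading to it from the root, so the nodes on
  the path from the root to \<open>v\<close> (both ends included) are the nodes whose address is a prefix of \<open>v\<close>.
\<close>

primrec nodes :: "motzkin \<Rightarrow> nat list set" where
  "nodes Leaf = {[]}"
| "nodes (Unary t) = insert [] ((#) 0 ` nodes t)"
| "nodes (Binary l r) = insert [] ((#) 0 ` nodes l \<union> (#) 1 ` nodes r)"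

primrec leaf_nodes :: "motzkin \<Rightarrow> nat list set" where
  "leaf_nodes Leaf = {[]}"
| "leaf_nodes (Unary t) = (#) 0 ` leaf_nodes t"
| "leaf_nodes (Binary l r) = (#) 0 ` leaf_nodes l \<union> (#) 1 ` leaf_nodes r"

primrec unary_nodes :: "motzkin \<Rightarrow> nat list set" where
  "unary_nodes Leaf = {}"
| "unary_nodes (Unary t) = insert [] ((#) 0 ` unary_nodes t)"
| "unary_nodes (Binary l r) = (#) 0 ` unary_nodes l \<union> (#) 1 ` unary_nodes r"

definition unary_on_path :: "motzkin \<Rightarrow> nat list \<Rightarrow> nat list set" where
  "unary_on_path t v = {w \<in> unary_nodes t. prefix w v}"

definition tree_size :: "motzkin \<Rightarrow> nat" where
  "tree_size t = card (nodes t)"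

definition unary_height :: "motzkin \<Rightarrow> nat" where
  "unary_height t = Max ((\<lambda>v. card (unary_on_path t v)) ` nodes t)"

text \<open>
  The extensional function space makes the binding map a function on the leaves only, so that
  distinct pairs are distinct terms up to \<open>\<alpha>\<close>-equivalence.
\<close>

definition closed_terms :: "(motzkin \<times> (nat list \<Rightarrow> nat list)) set" where
  "closed_terms = (SIGMA t:UNIV. \<Pi>\<^sub>E v\<in>leaf_nodes t. unary_on_path t v)"

definition H_le :: "nat \<Rightarrow> real fps" where
  "H_le k = Abs_fps (\<lambda>n.
     of_nat (card {(t, b) \<in> closed_terms. tree_size t = n \<and> unary_height t \<le> k}))"

text \<open>
  The radicand \<open>R\<^bsub>i,k\<^esub>(z)\<close> is meaningful for \<open>1 \<le> i \<le> k + 1\<close>; the value at index 0 is arbitrary.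
  The coefficient \<open>k - i + 1\<close> is formed in the reals.
\<close>

fun R :: "nat \<Rightarrow> nat \<Rightarrow> real \<Rightarrow> real" where
  "R 0 k z = 1"
| "R (Suc 0) k z = 1 - 4 * real k * z\<^sup>2"
| "R (Suc (Suc i)) k z =
     1 - 4 * (real k - real (Suc (Suc i)) + 1) * z\<^sup>2 - 2 * z + 2 * z * sqrt (R (Suc i) k z)"

text \<open>
  Since \<^const>\<open>sqrt\<close> is totalised by \<open>sqrt (- x) = - sqrt x\<close>, a root only counts where all the nested
  square roots are taken of nonnegative numbers.
\<close>

definition sigma_root :: "nat \<Rightarrow> nat \<Rightarrow> real" where
  "sigma_root i k = (LEAST z. z > 0 \<and> (\<forall>l\<in>{1..<i}. R l k z \<ge> 0) \<and> R i k z = 0)"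

primrec lambda_seq :: "nat \<Rightarrow> real" where
  "lambda_seq 0 = 0"
| "lambda_seq (Suc l) = real l + 1 + sqrt (lambda_seq l)"

definition gamma_const :: "nat \<Rightarrow> real" where
  "gamma_const j = - deriv (R j (N_seq j)) (sigma_root j (N_seq j))"

definition h_const :: "nat \<Rightarrow> real" where
  "h_const j =
     gamma_const j powr (1/4) * (2 * real (u_seq j)) powr (1/4) /
     (2 ^ (N_seq j - j + 2) * sqrt 2 * Gamma (3/4) * sqrt (\<Prod>i=1..N_seq j - j. lambda_seq i))"

definition asymptotic_to :: "(nat \<Rightarrow> real) \<Rightarrow> (nat \<Rightarrow> real) \<Rightarrow> bool" where
  "asymptotic_to a b \<longleftrightarrow> (\<lambda>n. a n / b n) \<longlonglongrightarrow> 1"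

end

theory Submission
  imports Defs "HOL-Complex_Analysis.Cauchy_Integral_Formula"
begin

text \<open>
  After rescaling so that the dominant singularity is at 1, all series involved converge absolutely
  on the closed unit disc, and singularity analysis is replaced by arithmetic with coefficient
  sequences. Series with coefficients \<open>O(n\<^bsup>-s\<^esup>)\<close>, \<open>s > 1\<close>, form an algebra in which a variant of
  Wiener's lemma allows taking square roots of series without zeros on the closed disc, and in which
  an asymptotic \<open>a\<^sub>n \<sim> c n\<^bsup>-p\<^esup>\<close> survives multiplication by a series with faster decay.

  A radicand that does not vanish at the singularity hence transfers the exponent from one nested
  square root to the next, multiplying the constant by an explicit factor. A vanishing radicand is
  \<open>(1 - z) q(z)\<close> with \<open>q\<close> free of zeros (for \<open>k > 1\<close>), which produces \<open>(1 - z)\<^bsup>1/2\<^esup>\<close> and the exponent \<open>-3/2\<close>. If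
  \<open>k = N\<^sub>j\<close>, the next radicand vanishes as well; it is dominated by \<open>(1 - z)\<^bsup>1/2\<^esup>\<close>, so its root
  behaves like \<open>(1 - z)\<^bsup>1/4\<^esup>\<close>. Which radicands vanish is decided in the variable \<open>x = 1 / (2 z)\<close>:
  for \<open>x\<^sup>2 - x = k - i\<close> the roots of the rescaled radicands satisfy the recursion of
  \<^const>\<open>u_seq\<close> in reverse.
\<close>

section \<open>Power series with polynomially decaying coefficients\<close>

text \<open>The classical transfer theorems need analytic continuation beyond the disc, where zeros
  of the nested radicands would have to be excluded. Coefficient decay needs information on the
  closed disc only, and there positivity suffices: 1 minus a radicand has nonnegative coefficients,
  so the radicand vanishes only in the equality case of the triangle inequality. The price is a
  small loss of exponent at each application of Wiener's lemma. It is harmless for auxiliary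
  factors, whose decay is strictly faster than the exponent sought; for a nonvanishing radicand the
  exact exponent is recovered by differentiation. The constant for \<open>k = N_seq j\<close> has
  these sources: the value Q of R / (1 - z) at 1 is \<open>\<rho>\<close> times
  \<open>gamma_const j\<close>; the second vanishing root starts with a fourth root of 4
  \<open>\<rho>\<close>^2 Q; each later radicand contributes 1 / (2 sqrt
  \<open>lambda_seq l\<close>). The signs of the roots need not be followed, since the final limit
  is nonnegative and so determined by its fourth power.\<close>

definition abs_conv :: "complex fps \<Rightarrow> bool" where
  "abs_conv f \<longleftrightarrow> summable (\<lambda>n. norm (fps_nth f n))"

definition coeff_decay :: "real \<Rightarrow> complex fps \<Rightarrow> bool" where
  "coeff_decay s f \<longleftrightarrow> (\<exists>C. \<forall>n. norm (fps_nth f n) \<le> C * real (Suc n) powr (-s))"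

lemma coeff_decayI:
  "(\<And>n. norm (fps_nth f n) \<le> C * real (Suc n) powr (-s)) \<Longrightarrow> coeff_decay s f"
  by (auto simp: coeff_decay_def)

lemma coeff_decayE:
  assumes "coeff_decay s f"
  obtains C where "C > 0" "\<And>n. norm (fps_nth f n) \<le> C * real (Suc n) powr (-s)"
proof -
  from assms obtain C where C: "norm (fps_nth f n) \<le> C * real (Suc n) powr (-s)" for n
    by (auto simp: coeff_decay_def)
  have "norm (fps_nth f n) \<le> (\<bar>C\<bar> + 1) * real (Suc n) powr (-s)" for n
    by (rule order_trans[OF C]) (intro mult_right_mono, auto)
  thus ?thesis by (intro that[of "\<bar>C\<bar> + 1"]) auto
qed

lemma coeff_decay_mono:
  assumes "coeff_decay s f" "t \<le> s"
  shows "coeff_decay t f"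
proof -
  obtain C where C: "C > 0" "\<And>n. norm (fps_nth f n) \<le> C * real (Suc n) powr (-s)"
    using coeff_decayE[OF assms(1)] by blast
  show ?thesis
    by (rule coeff_decayI[of _ C], rule order_trans[OF C(2)])
       (use C(1) assms(2) in \<open>intro mult_left_mono powr_mono, auto\<close>)
qed

lemma summable_powr_Suc: "s > 1 \<Longrightarrow> summable (\<lambda>n. real (Suc n) powr (-s))"
  using summable_real_powr_iff[of "-s"] summable_iff_shift[of "\<lambda>n. real n powr (-s)" 1]
  by simp

lemma coeff_decay_imp_abs_conv: "coeff_decay s f \<Longrightarrow> s > 1 \<Longrightarrow> abs_conv f"
  unfolding abs_conv_def coeff_decay_def
  by (auto intro!: summable_comparison_test'[OF summable_mult[OF summable_powr_Suc], of s 0])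

text \<open>One of \<open>k + 1\<close> and \<open>n - k + 1\<close> is at least
  \<open>(n + 1) / 2\<close>, so one factor is at most \<open>2 powr s\<close> times the target, and
  the other one is summable.\<close>

lemma powr_convolution_bound:
  fixes s :: real
  assumes s: "s > 1"
  obtains K where "K \<ge> 1"
    "\<And>n. (\<Sum>k\<le>n. real (Suc k) powr (-s) * real (Suc (n - k)) powr (-s)) \<le> K * real (Suc n) powr (-s)"
proof -
  define Z where "Z = (\<Sum>n. real (Suc n) powr (-s))"
  have sm: "summable (\<lambda>n. real (Suc n) powr (-s))" by (rule summable_powr_Suc[OF s])
  have part: "(\<Sum>k\<le>n. real (Suc k) powr (-s)) \<le> Z" for n
    unfolding Z_def by (rule sum_le_suminf[OF sm]) auto
  have Z1: "Z \<ge> 1" using part[of 0] by simp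
  have tm: "real (Suc k) powr (-s) * real (Suc (n - k)) powr (-s)
      \<le> 2 powr s * real (Suc n) powr (-s) * (real (Suc k) powr (-s) + real (Suc (n - k)) powr (-s))"
    if "k \<le> n" for k n
  proof -
    have *: "a powr (-s) \<le> 2 powr s * real (Suc n) powr (-s)" if "a \<ge> real (Suc n) / 2" for a
    proof -
      have "a powr (-s) \<le> (real (Suc n) / 2) powr (-s)"
        using that s by (intro powr_mono2') auto
      also have "\<dots> = 2 powr s * real (Suc n) powr (-s)"
        by (simp add: powr_divide powr_minus field_simps)
      finally show ?thesis .
    qed
    have "real (Suc k) \<ge> real (Suc n) / 2 \<or> real (Suc (n - k)) \<ge> real (Suc n) / 2"
      using that by (auto simp: of_nat_diff field_simps)
    thus ?thesis
    proof
      assume "real (Suc k) \<ge> real (Suc n) / 2"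
      from *[OF this] have "real (Suc k) powr (-s) * real (Suc (n - k)) powr (-s)
        \<le> 2 powr s * real (Suc n) powr (-s) * real (Suc (n - k)) powr (-s)"
        by (intro mult_right_mono) auto
      also have "\<dots> \<le> 2 powr s * real (Suc n) powr (-s) * (real (Suc k) powr (-s) + real (Suc (n - k)) powr (-s))"
        by (intro mult_left_mono) auto
      finally show ?thesis .
    next
      assume "real (Suc (n - k)) \<ge> real (Suc n) / 2"
      from *[OF this] have "real (Suc k) powr (-s) * real (Suc (n - k)) powr (-s)
        \<le> real (Suc k) powr (-s) * (2 powr s * real (Suc n) powr (-s))"
        by (intro mult_left_mono) auto
      also have "\<dots> = 2 powr s * real (Suc n) powr (-s) * real (Suc k) powr (-s)" by simp
      also have "\<dots> \<le> 2 powr s * real (Suc n) powr (-s) * (real (Suc k) powr (-s) + real (Suc (n - k)) powr (-s))"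
        by (intro mult_left_mono) auto
      finally show ?thesis .
    qed
  qed
  show ?thesis
  proof (rule that[of "2 powr s * (2 * Z)"])
    have "2 powr s \<ge> (1::real)" using s by (simp add: ge_one_powr_ge_zero)
    thus "2 powr s * (2 * Z) \<ge> 1" using Z1 mult_mono[of 1 "2 powr s" 1 "2 * Z"] by simp
  next
    fix n
    have "(\<Sum>k\<le>n. real (Suc k) powr (-s) * real (Suc (n - k)) powr (-s)) \<le>
      (\<Sum>k\<le>n. 2 powr s * real (Suc n) powr (-s) * (real (Suc k) powr (-s) + real (Suc (n - k)) powr (-s)))"
      by (intro sum_mono tm) auto
    also have "\<dots> = 2 powr s * real (Suc n) powr (-s) *
        ((\<Sum>k\<le>n. real (Suc k) powr (-s)) + (\<Sum>k\<le>n. real (Suc (n - k)) powr (-s)))"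
      by (simp only: sum_distrib_left[symmetric] sum.distrib)
    also have "(\<Sum>k\<le>n. real (Suc (n - k)) powr (-s)) = (\<Sum>k\<le>n. real (Suc k) powr (-s))"
      by (rule sum.reindex_bij_witness[of _ "\<lambda>k. n - k" "\<lambda>k. n - k"]) auto
    also have "2 powr s * real (Suc n) powr (-s) *
        ((\<Sum>k\<le>n. real (Suc k) powr (-s)) + (\<Sum>k\<le>n. real (Suc k) powr (-s)))
        \<le> 2 powr s * real (Suc n) powr (-s) * (Z + Z)"
      by (intro mult_left_mono add_mono part) auto
    finally show "(\<Sum>k\<le>n. real (Suc k) powr (-s) * real (Suc (n - k)) powr (-s))
        \<le> 2 powr s * (2 * Z) * real (Suc n) powr (-s)"
      by (simp add: algebra_simps)
  qed
qed

text \<open>The constants are explicit because powers of a series are bounded by iterating this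
  estimate, and the base of the resulting geometric growth has to be controlled.\<close>

lemma fps_mult_decay_bound:
  fixes f g :: "complex fps"
  assumes K: "\<And>n. (\<Sum>k\<le>n. real (Suc k) powr (-s) * real (Suc (n - k)) powr (-s)) \<le> K * real (Suc n) powr (-s)"
  assumes f: "\<And>n. norm (fps_nth f n) \<le> A * real (Suc n) powr (-s)"
  assumes g: "\<And>n. norm (fps_nth g n) \<le> B * real (Suc n) powr (-s)"
  shows "norm (fps_nth (f * g) n) \<le> K * A * B * real (Suc (n::nat)) powr (-s)"
proof -
  have AB: "A \<ge> 0" "B \<ge> 0"
    using order_trans[OF norm_ge_zero f[of 0]] order_trans[OF norm_ge_zero g[of 0]] by simp_all
  have "norm (fps_nth (f * g) n) \<le> (\<Sum>k\<le>n. norm (fps_nth f k * fps_nth g (n - k)))"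
    by (simp add: fps_mult_nth atLeast0AtMost norm_sum)
  also have "\<dots> \<le> (\<Sum>k\<le>n. (A * real (Suc k) powr (-s)) * (B * real (Suc (n - k)) powr (-s)))"
    by (intro sum_mono, subst norm_mult, intro mult_mono f g) (use AB in auto)
  also have "\<dots> = A * B * (\<Sum>k\<le>n. real (Suc k) powr (-s) * real (Suc (n - k)) powr (-s))"
    by (simp add: sum_distrib_left mult_ac)
  also have "\<dots> \<le> A * B * (K * real (Suc n) powr (-s))"
    by (intro mult_left_mono K) (use AB in auto)
  finally show ?thesis by (simp add: mult_ac)
qed

lemma coeff_decay_mult:
  assumes "coeff_decay s f" "coeff_decay s g" "s > 1"
  shows "coeff_decay s (f * g)"
proof -
  obtain K where K: "K \<ge> 1"
    "\<And>n. (\<Sum>k\<le>n. real (Suc k) powr (-s) * real (Suc (n - k)) powr (-s)) \<le> K * real (Suc n) powr (-s)"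
    using powr_convolution_bound[OF assms(3)] by blast
  obtain A where "A > 0" and A: "\<And>n. norm (fps_nth f n) \<le> A * real (Suc n) powr (-s)"
    using coeff_decayE[OF assms(1)] by blast
  obtain B where "B > 0" and B: "\<And>n. norm (fps_nth g n) \<le> B * real (Suc n) powr (-s)"
    using coeff_decayE[OF assms(2)] by blast
  show ?thesis
    by (rule coeff_decayI, rule fps_mult_decay_bound[OF K(2) A B])
qed

lemma coeff_decay_add:
  assumes "coeff_decay s f" "coeff_decay s g"
  shows "coeff_decay s (f + g)"
proof -
  obtain A where "A > 0" and A: "\<And>n. norm (fps_nth f n) \<le> A * real (Suc n) powr (-s)"
    using coeff_decayE[OF assms(1)] by blast
  obtain B where "B > 0" and B: "\<And>n. norm (fps_nth g n) \<le> B * real (Suc n) powr (-s)"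
    using coeff_decayE[OF assms(2)] by blast
  show ?thesis
    by (rule coeff_decayI[of _ "A + B"])
       (use norm_triangle_le[OF add_mono[OF A B]] in \<open>simp add: algebra_simps\<close>)
qed

lemma coeff_decay_finite:
  assumes "\<And>n. n \<ge> N \<Longrightarrow> fps_nth f n = 0"
  shows "coeff_decay s f"
proof -
  define C where "C = (\<Sum>n<N. norm (fps_nth f n) * real (Suc n) powr s)"
  have "norm (fps_nth f n) \<le> C * real (Suc n) powr (-s)" for n
  proof (cases "n < N")
    case True
    hence "norm (fps_nth f n) * real (Suc n) powr s \<le> C"
      unfolding C_def by (intro member_le_sum) auto
    thus ?thesis by (simp add: powr_minus field_simps)
  next
    case False
    have "C \<ge> 0" unfolding C_def by (intro sum_nonneg) auto
    thus ?thesis using False assms[of n] by simp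
  qed
  thus ?thesis by (rule coeff_decayI)
qed

lemma geometric_powr_bounded:
  fixes r s :: real
  assumes "0 < r" "r < 1"
  obtains C where "C > 0" "\<And>n. r ^ n \<le> C * real (Suc n) powr (-s)"
proof -
  have "(\<lambda>n. r ^ n * real (Suc n) powr s) \<longlonglongrightarrow> 0"
    using assms by real_asymp
  hence "Bseq (\<lambda>n. r ^ n * real (Suc n) powr s)" by (intro convergent_imp_Bseq convergentI)
  then obtain B where B: "\<And>n. norm (r ^ n * real (Suc n) powr s) \<le> B"
    unfolding Bseq_def by blast
  have "r ^ n \<le> (\<bar>B\<bar> + 1) * real (Suc n) powr (-s)" for n
    using B[of n] assms by (simp add: powr_minus field_simps abs_mult)
  thus ?thesis by (intro that[of "\<bar>B\<bar> + 1"]) auto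
qed

lemma coeff_decay_geometric:
  assumes "0 < r" "r < 1" "\<And>n. norm (fps_nth f n) \<le> C * r ^ n"
  shows "coeff_decay s f"
proof -
  obtain D where D: "D > 0" "\<And>n. r ^ n \<le> D * real (Suc n) powr (-s)"
    using geometric_powr_bounded[OF assms(1,2)] by blast
  have "C \<ge> 0" using order_trans[OF norm_ge_zero assms(3)[of 0]] by simp
  show ?thesis
    by (rule coeff_decayI[of _ "C * D"], rule order_trans[OF assms(3)], subst mult.assoc)
       (intro mult_left_mono D \<open>C \<ge> 0\<close>)
qed

section \<open>Evaluation on the closed unit disc\<close>

lemma abs_conv_summable:
  assumes "abs_conv f" "norm z \<le> 1"
  shows "summable (\<lambda>n. norm (fps_nth f n * z ^ n))" "summable (\<lambda>n. fps_nth f n * z ^ n)"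
proof -
  show "summable (\<lambda>n. norm (fps_nth f n * z ^ n))"
    by (rule summable_comparison_test'[OF assms(1)[unfolded abs_conv_def], of 0])
       (use assms(2) in \<open>auto simp: norm_mult norm_power intro!: mult_left_le power_le_one\<close>)
  thus "summable (\<lambda>n. fps_nth f n * z ^ n)" by (rule summable_norm_cancel)
qed

lemma eval_fps_add_disc:
  assumes "abs_conv f" "abs_conv g" "norm z \<le> 1"
  shows "eval_fps (f + g) z = eval_fps f z + eval_fps g z"
  unfolding eval_fps_def
  by (subst suminf_add) (use abs_conv_summable[OF assms(1,3)] abs_conv_summable[OF assms(2,3)]
      in \<open>auto simp: ring_distribs\<close>)

lemma eval_fps_mult_disc:
  assumes "abs_conv f" "abs_conv g" "norm z \<le> 1"
  shows "eval_fps (f * g) z = eval_fps f z * eval_fps g z"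
proof -
  have "eval_fps f z * eval_fps g z =
      (\<Sum>n. \<Sum>k\<le>n. (fps_nth f k * z ^ k) * (fps_nth g (n - k) * z ^ (n - k)))"
    unfolding eval_fps_def
    by (rule Cauchy_product) (use abs_conv_summable assms in auto)
  also have "\<dots> = eval_fps (f * g) z"
    unfolding eval_fps_def
    by (intro suminf_cong)
       (auto simp: fps_mult_nth atLeast0AtMost sum_distrib_right intro!: sum.cong simp flip: power_add)
  finally show ?thesis ..
qed

lemma abs_conv_mult:
  assumes "abs_conv f" "abs_conv g"
  shows "abs_conv (f * g)"
proof -
  have "summable (\<lambda>n. \<Sum>k\<le>n. norm (fps_nth f k) * norm (fps_nth g (n - k)))"
    using summable_Cauchy_product[of "\<lambda>n. norm (fps_nth f n)" "\<lambda>n. norm (fps_nth g n)"] assms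
    by (simp add: abs_conv_def)
  thus ?thesis unfolding abs_conv_def
    by (rule summable_comparison_test'[where N = 0])
       (auto simp: fps_mult_nth atLeast0AtMost norm_mult[symmetric] intro!: norm_sum)
qed

lemma continuous_on_eval_fps_disc:
  assumes "abs_conv f"
  shows "continuous_on (cball 0 1) (eval_fps f)"
proof -
  have "uniform_limit (cball 0 1) (\<lambda>N z. \<Sum>n<N. fps_nth f n * z ^ n)
          (\<lambda>z. \<Sum>n. fps_nth f n * z ^ n) sequentially"
    by (rule Weierstrass_m_test[where M = "\<lambda>n. norm (fps_nth f n)"])
       (use assms in \<open>auto simp: abs_conv_def norm_mult norm_power intro!: mult_left_le power_le_one\<close>)
  thus ?thesis unfolding eval_fps_def
    by (rule uniform_limit_theorem[rotated]) (auto intro!: always_eventually continuous_intros)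
qed

text \<open>Serves quotients by a power of 1 - z, whose coefficients are at first only known to be
  bounded.\<close>

lemma bounded_coeffs_conv_radius:
  assumes "\<And>n. norm (fps_nth f n) \<le> B"
  shows "fps_conv_radius (f :: complex fps) \<ge> 1"
proof (rule ccontr)
  assume "\<not> ?thesis"
  then obtain r where r: "fps_conv_radius f < ereal r" "ereal r < 1"
    using ereal_dense2[of "fps_conv_radius f" 1] by force
  have r0: "r > 0" using r(1) le_less_trans[OF conv_radius_nonneg] unfolding fps_conv_radius_def
    by (metis ereal_less(2))
  have "summable (\<lambda>n. fps_nth f n * of_real r ^ n)"
  proof (rule summable_comparison_test'[where N = 0])
    show "summable (\<lambda>n. B * r ^ n)" using r r0 by (intro summable_mult summable_geometric) auto
    show "norm (fps_nth f n * of_real r ^ n) \<le> B * r ^ n" for n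
      using assms[of n] r0 by (auto simp: norm_mult norm_power intro!: mult_right_mono)
  qed
  hence "fps_conv_radius f \<ge> norm (complex_of_real r)"
    unfolding fps_conv_radius_def by (rule conv_radius_geI)
  thus False using r r0 by simp
qed

lemma abs_conv_conv_radius: 
  assumes "abs_conv f" shows "fps_conv_radius f \<ge> 1"
proof -
  have "summable (\<lambda>n. fps_nth f n * 1 ^ n)"
    using assms by (auto simp: abs_conv_def intro: summable_norm_cancel)
  from conv_radius_geI[OF this] show ?thesis by (simp add: fps_conv_radius_def one_ereal_def)
qed

section \<open>Inverse square roots of non-vanishing series\<close>

lemma cauchy_coeff_bound:
  fixes F :: "complex fps"
  assumes "fps_conv_radius F > ereal \<rho>" "\<rho> > 0"
  assumes "\<And>z. norm z = \<rho> \<Longrightarrow> norm (eval_fps F z) \<le> B"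
  shows "norm (fps_nth F n) \<le> B / \<rho> ^ n"
proof -
  have "norm ((deriv ^^ n) (eval_fps F) 0) \<le> fact n * B / \<rho> ^ n"
  proof (rule Cauchy_inequality)
    have sub: "cball 0 \<rho> \<subseteq> eball 0 (fps_conv_radius F)"
      by (auto intro!: le_less_trans[OF _ assms(1)])
    show "eval_fps F holomorphic_on ball 0 \<rho>"
      by (rule holomorphic_on_eval_fps) (use sub in auto)
    show "continuous_on (cball 0 \<rho>) (eval_fps F)"
      using continuous_on_eval_fps continuous_on_subset sub by blast
  qed (use assms in auto)
  hence "norm ((deriv ^^ n) (eval_fps F) 0) / fact n \<le> (fact n * B / \<rho> ^ n) / fact n"
    by (rule divide_right_mono) simp
  moreover have "fps_nth F n = (deriv ^^ n) (eval_fps F) 0 / fact n"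
    by (rule fps_nth_conv_deriv)
       (use assms in \<open>auto simp: zero_ereal_def intro: less_trans[of _ "ereal \<rho>"]\<close>)
  ultimately show ?thesis by (simp add: norm_divide)
qed

text \<open>The series f(c z). Besides c = r < 1 in Wiener's lemma, c = \<open>\<rho>\<close> moves
  a singularity to 1 and c = -1 turns powers of 1 + z into powers of 1 - z.\<close>

definition fps_dilate :: "complex \<Rightarrow> complex fps \<Rightarrow> complex fps" where
  "fps_dilate c f = Abs_fps (\<lambda>n. c ^ n * fps_nth f n)"

lemma fps_nth_dilate [simp]: "fps_nth (fps_dilate c f) n = c ^ n * fps_nth f n"
  by (simp add: fps_dilate_def)

lemma fps_dilate_mult: "fps_dilate c (f * g) = fps_dilate c f * fps_dilate c g"
proof (rule fps_ext)
  fix n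
  have "(\<Sum>i=0..n. (c ^ i * fps_nth f i) * (c ^ (n - i) * fps_nth g (n - i)))
      = (\<Sum>i=0..n. c ^ n * (fps_nth f i * fps_nth g (n - i)))"
  proof (rule sum.cong)
    fix i assume "i \<in> {0..n}"
    hence "c ^ n = c ^ i * c ^ (n - i)" by (simp flip: power_add)
    thus "(c ^ i * fps_nth f i) * (c ^ (n - i) * fps_nth g (n - i)) = c ^ n * (fps_nth f i * fps_nth g (n - i))"
      by simp
  qed simp
  thus "fps_nth (fps_dilate c (f * g)) n = fps_nth (fps_dilate c f * fps_dilate c g) n"
    by (simp add: fps_mult_nth sum_distrib_left)
qed

lemma fps_dilate_1 [simp]: "fps_dilate c 1 = 1"
  by (rule fps_ext) simp

lemma fps_dilate_add: "fps_dilate c (f + g) = fps_dilate c f + fps_dilate c g"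
  by (rule fps_ext) (simp add: ring_distribs)

lemma fps_dilate_power: "fps_dilate c (f ^ n) = fps_dilate c f ^ n"
  by (induction n) (simp_all add: fps_dilate_mult)

lemma fps_dilate_inverse:
  assumes "fps_nth f 0 \<noteq> 0"
  shows "fps_dilate c (inverse f) = inverse (fps_dilate c f)"
proof -
  have "fps_dilate c f * fps_dilate c (inverse f) = 1"
    using assms by (simp add: inverse_mult_eq_1' flip: fps_dilate_mult)
  thus ?thesis by (metis fps_inverse_unique)
qed

text \<open>Composition is formal: coefficient l involves only the powers n \<le> l. The geometric
  factor bounds these finite sums uniformly in l.\<close>

lemma fps_compose_decay:
  fixes F u :: "complex fps"
  assumes F: "\<And>n. norm (fps_nth F n) \<le> 1"
  assumes u: "\<And>n l. norm (fps_nth (u ^ n) l) \<le> C * \<theta> ^ n * w l"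
  assumes "0 \<le> \<theta>" "\<theta> < 1" "C \<ge> 0" "w l \<ge> 0"
  shows "norm (fps_nth (F oo u) l) \<le> C / (1 - \<theta>) * w l"
proof -
  have "norm (fps_nth (F oo u) l) \<le> (\<Sum>n\<le>l. norm (fps_nth F n * fps_nth (u ^ n) l))"
    by (simp add: fps_compose_nth atLeast0AtMost norm_sum)
  also have "\<dots> \<le> (\<Sum>n\<le>l. 1 * (C * \<theta> ^ n * w l))"
    by (intro sum_mono, subst norm_mult, intro mult_mono F u) auto
  also have "\<dots> = C * w l * (\<Sum>n\<le>l. \<theta> ^ n)"
    by (simp add: sum_distrib_left mult_ac)
  also have "(\<Sum>n\<le>l. \<theta> ^ n) \<le> (\<Sum>n. \<theta> ^ n)"
    using assms by (intro sum_le_suminf) (auto intro: summable_geometric)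
  also have "\<dots> = 1 / (1 - \<theta>)" using assms by (intro suminf_geometric) auto
  finally show ?thesis using assms by (simp add: mult_left_mono)
qed

text \<open>Passing from n to n + 1 multiplies by (a - n) / (n + 1), which has modulus at most 1 for
  real a between -1 and 1.\<close>

lemma norm_gbinomial_le_1:
  fixes a :: complex
  assumes "a = of_real x" "-1 \<le> x" "x \<le> 1"
  shows "norm (a gchoose n) \<le> 1"
proof (induction n)
  case (Suc n)
  have "a gchoose Suc n = (a gchoose n) * ((a - of_nat n) / of_nat (Suc n))"
    by (simp add: gbinomial_prod_rev field_simps)
  moreover have "norm ((a - of_nat n) / of_nat (Suc n)) \<le> 1"
  proof -
    have "a - of_nat n = of_real (x - real n)" using assms by simp
    hence "norm (a - of_nat n) = \<bar>x - real n\<bar>" by (metis norm_of_real real_norm_def)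
    also have "\<dots> \<le> real (Suc n)" using assms by auto
    finally show ?thesis by (simp add: norm_divide del: of_nat_Suc)
  qed
  ultimately show ?case using Suc by (simp only: norm_mult) (rule mult_le_one, auto)
qed simp

lemma fps_binomial_minus_half_square:
  fixes u :: "complex fps"
  assumes "fps_nth u 0 = 0"
  shows "(fps_binomial (-1/2) oo u)\<^sup>2 = inverse (1 + u)"
proof -
  have "(fps_binomial (-1/2) oo u)\<^sup>2 = (fps_binomial (-1/2) ^ 2) oo u"
    using assms by (rule fps_compose_power)
  also have "fps_binomial (-1/2) ^ 2 = (inverse (1 + fps_X) :: complex fps)"
    by (simp add: fps_binomial_power fps_binomial_minus_one)
  also have "inverse (1 + fps_X) oo u = inverse ((1 + fps_X) oo u)"
    using assms by (intro fps_inverse_compose) auto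
  also have "(1 + fps_X) oo u = 1 + u"
    using assms by (simp add: fps_compose_add_distrib)
  finally show ?thesis .
qed

lemma fps_sqrt_unique:
  fixes a b :: "complex fps"
  assumes "a\<^sup>2 = b\<^sup>2" "fps_nth a 0 = fps_nth b 0" "fps_nth a 0 \<noteq> 0"
  shows "a = b"
proof -
  have "a = b \<or> a = - b" using assms(1) by (simp add: power2_eq_iff)
  moreover have "a \<noteq> - b"
  proof
    assume "a = - b"
    hence "fps_nth a 0 = - fps_nth b 0" by simp
    thus False using assms by simp
  qed
  ultimately show ?thesis by blast
qed

text \<open>With exponent s itself this fails in general, since 1 - r^n tends to 1 for fixed r. With
  t < s the coefficients beyond some N are small for every r, and the finitely many others become
  small as r tends to 1.\<close>

lemma dilate_approx:
  assumes f: "\<And>n. norm (fps_nth f n) \<le> C * real (Suc n) powr (-s)" and st: "t < s"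
    and e: "\<epsilon> > 0" and C: "C > 0"
  obtains r :: real where "0 < r" "r < 1"
    "\<And>n. norm (fps_nth (f - fps_dilate (of_real r) f) n) \<le> \<epsilon> * real (Suc n) powr (-t)"
proof -
  have "(\<lambda>n. C * real (Suc n) powr (t - s)) \<longlonglongrightarrow> 0"
    using st by real_asymp
  hence "eventually (\<lambda>n. C * real (Suc n) powr (t - s) < \<epsilon>) sequentially"
    using e by (rule order_tendstoD)
  then obtain N where N: "\<And>n. n \<ge> N \<Longrightarrow> C * real (Suc n) powr (t - s) < \<epsilon>"
    by (auto simp: eventually_at_top_linorder)
  define \<delta> where "\<delta> = \<epsilon> / (C * (real (Suc N) powr \<bar>t - s\<bar>))"
  have \<delta>: "\<delta> > 0" unfolding \<delta>_def using e C by auto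
  have "((\<lambda>r::real. 1 - r ^ N) \<longlongrightarrow> 1 - 1 ^ N) (at_left 1)"
    by (intro tendsto_intros)
  hence "eventually (\<lambda>r::real. 1 - r ^ N < \<delta>) (at_left 1)"
    using \<delta> by (auto dest: order_tendstoD)
  moreover have "eventually (\<lambda>r::real. 0 < r \<and> r < 1) (at_left 1)"
    using eventually_at_left_real[of 0 "1::real"] by (auto elim: eventually_mono)
  ultimately have "eventually (\<lambda>r::real. 1 - r ^ N < \<delta> \<and> 0 < r \<and> r < 1) (at_left 1)"
    by (rule eventually_conj)
  then obtain r :: real where r: "1 - r ^ N < \<delta>" "0 < r" "r < 1"
    using eventually_happens'[OF trivial_limit_at_left_real] by blast
  have "norm (fps_nth (f - fps_dilate (of_real r) f) n) \<le> \<epsilon> * real (Suc n) powr (-t)" for n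
  proof -
    have "fps_nth (f - fps_dilate (of_real r) f) n = of_real (1 - r ^ n) * fps_nth f n"
      by (simp add: algebra_simps)
    hence "norm (fps_nth (f - fps_dilate (of_real r) f) n) = (1 - r ^ n) * norm (fps_nth f n)"
      using r by (simp only: norm_mult norm_of_real) (simp add: power_le_one)
    also have "\<dots> \<le> (1 - r ^ n) * (C * real (Suc n) powr (-s))"
      using r by (intro mult_left_mono f) (auto simp: power_le_one)
    also have "real (Suc n) powr (-s) = real (Suc n) powr (t - s) * real (Suc n) powr (-t)"
      by (simp flip: powr_add)
    also have "(1 - r ^ n) * (C * (real (Suc n) powr (t - s) * real (Suc n) powr (-t)))
        = ((1 - r ^ n) * (C * real (Suc n) powr (t - s))) * real (Suc n) powr (-t)" by simp
    also have "(1 - r ^ n) * (C * real (Suc n) powr (t - s)) \<le> \<epsilon>"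
    proof (cases "n \<ge> N")
      case True
      have "(1 - r ^ n) * (C * real (Suc n) powr (t - s)) \<le> 1 * (C * real (Suc n) powr (t - s))"
        using r C by (intro mult_right_mono) auto
      thus ?thesis using N[OF True] by simp
    next
      case False
      have "r ^ N \<le> r ^ n" using False r by (intro power_decreasing) auto
      hence "1 - r ^ n \<le> \<delta>" using r(1) by linarith
      moreover have "real (Suc n) powr (t - s) \<le> real (Suc N) powr \<bar>t - s\<bar>"
      proof -
        have "real (Suc n) powr (t - s) \<le> real (Suc n) powr \<bar>t - s\<bar>" by (intro powr_mono) auto
        also have "\<dots> \<le> real (Suc N) powr \<bar>t - s\<bar>" using False by (intro powr_mono2) auto
        finally show ?thesis .
      qed
      ultimately have "(1 - r ^ n) * (C * real (Suc n) powr (t - s)) \<le> \<delta> * (C * real (Suc N) powr \<bar>t - s\<bar>)"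
        using C \<delta> by (intro mult_mono) auto
      also have "\<dots> = \<epsilon>" using C by (simp add: \<delta>_def)
      finally show ?thesis .
    qed
    finally show ?thesis by (simp add: mult_right_mono)
  qed
  thus ?thesis using that r by blast
qed

lemma eval_fps_disc_bounded_below:
  assumes "abs_conv f" "\<And>z. norm z \<le> 1 \<Longrightarrow> eval_fps f z \<noteq> 0"
  obtains m where "m > 0" "\<And>z. norm z \<le> 1 \<Longrightarrow> m \<le> norm (eval_fps f z)"
proof -
  have "\<exists>x\<in>cball 0 1. \<forall>y\<in>cball 0 1. norm (eval_fps f x) \<le> norm (eval_fps f y)"
    by (intro continuous_attains_inf continuous_on_norm continuous_on_eval_fps_disc assms(1)) auto
  then obtain x where x: "norm x \<le> 1" "\<And>y. norm y \<le> 1 \<Longrightarrow> norm (eval_fps f x) \<le> norm (eval_fps f y)"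
    by auto
  show ?thesis by (rule that[of "norm (eval_fps f x)"]) (use x assms(2) in auto)
qed

text \<open>Cauchy's inequality on the circle of radius \<open>sqrt r\<close> costs
  \<open>sqrt r\<close> to the power -l, while the dilation gains r^l. Half of the gain survives,
  and the base 1 / m does not involve r.\<close>

lemma inverse_power_dilate_bound:
  assumes f: "abs_conv f" and m: "m > 0" "\<And>z. norm z \<le> 1 \<Longrightarrow> m \<le> norm (eval_fps f z)"
    and r: "0 < r" "r < 1"
  shows "norm (fps_nth (inverse (fps_dilate (of_real r) f) ^ n) l) \<le> (1 / m) ^ n * sqrt r ^ l"
proof -
  have rad: "fps_conv_radius f \<ge> 1" by (rule abs_conv_conv_radius[OF f])
  have nz: "eval_fps f z \<noteq> 0" if "ereal (norm z) < 1" for z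
    using m(1) m(2)[of z] that by auto
  have f0: "fps_nth f 0 \<noteq> 0" using nz[of 0] by (simp add: eval_fps_at_0)
  have "fps_conv_radius (inverse f) \<ge> min 1 (fps_conv_radius f)"
    by (rule fps_conv_radius_inverse) (use nz in auto)
  hence radi: "fps_conv_radius (inverse f) \<ge> 1" using rad by simp
  have sr: "0 < sqrt r" "sqrt r < 1" using r by auto
  have lt: "ereal (sqrt r) < 1" using sr by simp
  have bnd: "norm (fps_nth (inverse f ^ n) l) \<le> (1 / m) ^ n / sqrt r ^ l"
  proof (rule cauchy_coeff_bound)
    show "ereal (sqrt r) < fps_conv_radius (inverse f ^ n)"
      using less_le_trans[OF lt radi] fps_conv_radius_power[of "inverse f" n] by (rule less_le_trans)
    fix z :: complex assume z: "norm z = sqrt r"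
    have z1: "ereal (norm z) < fps_conv_radius f" "ereal (norm z) < 1"
         "ereal (norm z) < fps_conv_radius (inverse f)"
      using less_le_trans[OF lt rad] less_le_trans[OF lt radi] lt z by auto
    have "eval_fps (inverse f ^ n) z = eval_fps (inverse f) z ^ n"
      using z1 by (intro eval_fps_power) auto
    also have "eval_fps (inverse f) z = inverse (eval_fps f z)"
      using nz z1 by (intro eval_fps_inverse[where r = 1]) auto
    finally have "norm (eval_fps (inverse f ^ n) z) = (1 / norm (eval_fps f z)) ^ n"
      by (simp add: norm_power norm_inverse norm_divide inverse_eq_divide)
    also have "\<dots> \<le> (1 / m) ^ n"
      using m(1) m(2)[of z] z sr by (intro power_mono frac_le) auto
    finally show "norm (eval_fps (inverse f ^ n) z) \<le> (1 / m) ^ n" .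
  qed (use sr in auto)
  moreover have "inverse (fps_dilate (of_real r) f) ^ n = fps_dilate (of_real r) (inverse f ^ n)"
    by (simp add: fps_dilate_power fps_dilate_inverse f0)
  moreover have "r ^ l = sqrt r ^ l * sqrt r ^ l"
    using r by (simp flip: power_mult_distrib)
  ultimately have "norm (fps_nth (inverse (fps_dilate (of_real r) f) ^ n) l)
      = (sqrt r ^ l * sqrt r ^ l) * norm (fps_nth (inverse f ^ n) l)"
    using r by (simp add: norm_mult norm_power)
  moreover have "\<dots> \<le> (sqrt r ^ l * sqrt r ^ l) * ((1 / m) ^ n / sqrt r ^ l)"
    using sr by (intro mult_left_mono bnd) auto
  ultimately have "norm (fps_nth (inverse (fps_dilate (of_real r) f) ^ n) l)
      \<le> (sqrt r ^ l * sqrt r ^ l) * ((1 / m) ^ n / sqrt r ^ l)"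
    by simp
  thus ?thesis using sr by (simp add: mult.commute)
qed

lemma coeff_decay_inverse_dilate:
  assumes "fps_conv_radius h \<ge> 1" "\<And>z. norm z < 1 \<Longrightarrow> eval_fps h z \<noteq> 0" "0 < r" "r < 1"
  shows "coeff_decay s (inverse (fps_dilate (of_real r) h))"
proof -
  have h0: "fps_nth h 0 \<noteq> 0" using assms(2)[of 0] by (simp add: eval_fps_at_0)
  have "fps_conv_radius (inverse h) \<ge> min 1 (fps_conv_radius h)"
    by (rule fps_conv_radius_inverse) (use assms in auto)
  hence "fps_conv_radius (inverse h) \<ge> 1" using assms(1) by simp
  have sr: "0 < sqrt r" "sqrt r < 1" using assms by auto
  have lt: "ereal (sqrt r) < fps_conv_radius (inverse h)" 
    by (rule less_le_trans[of _ 1]) (use sr \<open>fps_conv_radius (inverse h) \<ge> 1\<close> in auto)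
  have "compact (eval_fps (inverse h) ` cball 0 (sqrt r))"
  proof (rule compact_continuous_image)
    show "continuous_on (cball 0 (sqrt r)) (eval_fps (inverse h))"
      by (rule continuous_on_subset[OF continuous_on_eval_fps])
         (auto intro!: le_less_trans[OF _ lt])
  qed auto
  then obtain B where B: "\<And>z. norm z \<le> sqrt r \<Longrightarrow> norm (eval_fps (inverse h) z) \<le> B"
    using compact_imp_bounded[of "eval_fps (inverse h) ` cball 0 (sqrt r)"] unfolding bounded_iff
    by (metis dist_0_norm image_eqI mem_cball)
  have bnd: "norm (fps_nth (inverse h) n) \<le> B / sqrt r ^ n" for n
    by (rule cauchy_coeff_bound[OF lt]) (use sr B in auto)
  show ?thesis
  proof (rule coeff_decay_geometric[OF sr])
    fix n
    have "fps_nth (inverse (fps_dilate (of_real r) h)) n = of_real r ^ n * fps_nth (inverse h) n"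
      by (simp flip: fps_dilate_inverse[OF h0])
    hence "norm (fps_nth (inverse (fps_dilate (of_real r) h)) n) = r ^ n * norm (fps_nth (inverse h) n)"
      using assms by (simp add: norm_mult norm_power)
    also have "\<dots> \<le> r ^ n * (B / sqrt r ^ n)" using assms by (intro mult_left_mono bnd) auto
    also have "r ^ n = sqrt r ^ n * sqrt r ^ n" using assms by (simp flip: power_mult_distrib)
    also have "sqrt r ^ n * sqrt r ^ n * (B / sqrt r ^ n) = B * sqrt r ^ n" using sr by simp
    finally show "norm (fps_nth (inverse (fps_dilate (of_real r) h)) n) \<le> B * sqrt r ^ n" .
  qed
qed

text \<open>
  Newman's proof of Wiener's lemma: with \<open>f\<^sub>r(z) = f(r z)\<close> and \<open>u = (f - f\<^sub>r) / f\<^sub>r\<close> one has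
  \<open>1 / h = (1 / h\<^sub>r) (1 + u)\<^bsup>-1/2\<^esup>\<close>. For \<open>r\<close> close to 1 the coefficients of \<open>u\<^sup>n\<close> decay geometrically
  in \<open>n\<close>: those of \<open>(f - f\<^sub>r)\<^sup>n\<close> because the norm with the smaller exponent \<open>t\<close> is small, and those of
  \<open>f\<^sub>r\<^bsup>-n\<^esup>\<close> by Cauchy's inequality, with a base independent of \<open>r\<close>.
\<close>

theorem coeff_decay_inverse_sqrt:
  fixes f h :: "complex fps"
  assumes f: "coeff_decay s f" and st: "1 < t" "t < s"
    and nz: "\<And>z. norm z \<le> 1 \<Longrightarrow> eval_fps f z \<noteq> 0"
    and h: "h\<^sup>2 = f" "fps_conv_radius h \<ge> 1"
  shows "coeff_decay t (inverse h)"
proof -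
  have acf: "abs_conv f" using coeff_decay_imp_abs_conv[OF f] st by simp
  obtain m where m: "m > 0" "\<And>z. norm z \<le> 1 \<Longrightarrow> m \<le> norm (eval_fps f z)"
    using eval_fps_disc_bounded_below[OF acf nz] by blast
  obtain K where K: "K \<ge> 1"
    "\<And>n. (\<Sum>k\<le>n. real (Suc k) powr (-t) * real (Suc (n - k)) powr (-t)) \<le> K * real (Suc n) powr (-t)"
    using powr_convolution_bound[OF st(1)] by blast
  obtain C where C: "C > 0" "\<And>n. norm (fps_nth f n) \<le> C * real (Suc n) powr (-s)"
    using coeff_decayE[OF f] by blast
  \<comment> \<open>Chosen so that K * \<open>\<epsilon>\<close> / m, the ratio governing the powers
    of u, becomes 1/2. Neither K nor m depends on r, so r may be picked afterwards.\<close>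
  define \<epsilon> where "\<epsilon> = m / (2 * K)"
  have \<epsilon>: "\<epsilon> > 0" using m K by (simp add: \<epsilon>_def)
  obtain r :: real where r: "0 < r" "r < 1"
    "\<And>n. norm (fps_nth (f - fps_dilate (of_real r) f) n) \<le> \<epsilon> * real (Suc n) powr (-t)"
    using dilate_approx[OF C(2) st(2) \<epsilon> C(1)] by blast
  define fr where "fr = fps_dilate (of_real r) f"
  define hr where "hr = fps_dilate (of_real r) h"
  define u where "u = (f - fr) * inverse fr"
  have f0: "fps_nth f 0 \<noteq> 0" using nz[of 0] by (simp add: eval_fps_at_0)
  have h0: "fps_nth h 0 \<noteq> 0" using f0 h(1) by (auto simp: power2_eq_square)
  have fr0: "fps_nth fr 0 \<noteq> 0" and u0: "fps_nth u 0 = 0" and hr0: "fps_nth hr 0 = fps_nth h 0"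
    using f0 by (simp_all add: fr_def u_def hr_def)
  have hfr: "hr\<^sup>2 = fr" by (simp add: hr_def fr_def flip: h(1) fps_dilate_power)
  have "fr * inverse fr = 1" using fr0 by (rule inverse_mult_eq_1')
  hence fu: "f = fr * (1 + u)" by (simp add: u_def algebra_simps)
  \<comment> \<open>Both sides square to 1 / f. The constant terms agree because dilation fixes them
    and u has none, so no sign ambiguity remains.\<close>
  have eq: "inverse h = inverse hr * (fps_binomial (-1/2) oo u)"
  proof (rule fps_sqrt_unique)
    have "(inverse h)\<^sup>2 = inverse f" by (simp add: fps_inverse_power flip: h(1))
    also have "\<dots> = inverse fr * inverse (1 + u)" by (subst fu) (rule fps_inverse_mult)
    also have "\<dots> = (inverse hr * (fps_binomial (-1/2) oo u))\<^sup>2"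
      unfolding power_mult_distrib fps_binomial_minus_half_square[OF u0]
      by (simp add: fps_inverse_power flip: hfr)
    finally show "(inverse h)\<^sup>2 = (inverse hr * (fps_binomial (-1/2) oo u))\<^sup>2" .
  qed (use h0 hr0 in auto)
  have pow1: "norm (fps_nth ((f - fr) ^ n) l) \<le> (K * \<epsilon>) ^ n * real (Suc l) powr (-t)" for n l
  proof (induction n arbitrary: l)
    case 0
    show ?case by simp
  next
    case (Suc n)
    have "norm (fps_nth ((f - fr) * (f - fr) ^ n) l) \<le> K * \<epsilon> * (K * \<epsilon>) ^ n * real (Suc l) powr (-t)"
      by (rule fps_mult_decay_bound[OF K(2)]) (use r(3) Suc in \<open>auto simp: fr_def\<close>)
    thus ?case by simp
  qed
  \<comment> \<open>D depends on r, but it enters the bound for the n-th power only once instead of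
    n times, so it does not disturb the ratio 1/2.\<close>
  obtain D where D: "D > 0" "\<And>n. sqrt r ^ n \<le> D * real (Suc n) powr (-t)"
    using geometric_powr_bounded[of "sqrt r" t] r by auto
  have pow2: "norm (fps_nth (inverse fr ^ n) l) \<le> ((1 / m) ^ n * D) * real (Suc l) powr (-t)" for n l
  proof -
    have "norm (fps_nth (inverse fr ^ n) l) \<le> (1 / m) ^ n * sqrt r ^ l"
      unfolding fr_def by (rule inverse_power_dilate_bound[OF acf m r(1,2)])
    also have "\<dots> \<le> (1 / m) ^ n * (D * real (Suc l) powr (-t))"
      using m(1) by (intro mult_left_mono D) auto
    finally show ?thesis by simp
  qed
  have powu: "norm (fps_nth (u ^ n) l) \<le> (K * D) * (1 / 2) ^ n * real (Suc l) powr (-t)" for n l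
  proof -
    have "norm (fps_nth (u ^ n) l) \<le> K * (K * \<epsilon>) ^ n * ((1 / m) ^ n * D) * real (Suc l) powr (-t)"
      unfolding u_def power_mult_distrib[of "f - fr"] by (rule fps_mult_decay_bound[OF K(2) pow1 pow2])
    also have "K * (K * \<epsilon>) ^ n * ((1 / m) ^ n * D) = K * D * (K * \<epsilon> * (1 / m)) ^ n"
      by (simp only: power_mult_distrib mult_ac)
    also have "K * \<epsilon> * (1 / m) = 1 / 2" using K m by (simp add: \<epsilon>_def)
    finally show ?thesis .
  qed
  have "coeff_decay t (fps_binomial (-1/2) oo u)"
  proof (rule coeff_decayI)
    fix l
    show "norm (fps_nth (fps_binomial (-1/2) oo u) l) \<le> K * D / (1 - 1/2) * real (Suc l) powr (-t)"
    proof (rule fps_compose_decay[OF _ powu])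
      show "norm (fps_nth (fps_binomial (-1/2 :: complex)) n) \<le> 1" for n
        by (simp, rule norm_gbinomial_le_1[of _ "-1/2"]) auto
    qed (use K D in auto)
  qed
  moreover have "coeff_decay t (inverse hr)"
    unfolding hr_def
  proof (rule coeff_decay_inverse_dilate[OF h(2) _ r(1,2)])
    fix z :: complex assume z: "norm z < 1"
    have "eval_fps (h * h) z = eval_fps h z * eval_fps h z"
      by (intro eval_fps_mult) (use z h(2) in \<open>auto intro: less_le_trans[of _ 1]\<close>)
    thus "eval_fps h z \<noteq> 0" using nz[of z] z h(1) by (auto simp: power2_eq_square)
  qed
  ultimately show ?thesis using st by (simp only: eq coeff_decay_mult)
qed

section \<open>Exact coefficient asymptotics\<close>

definition coeff_lim :: "real \<Rightarrow> complex fps \<Rightarrow> complex \<Rightarrow> bool" where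
  "coeff_lim p f c \<longleftrightarrow> (\<lambda>n. of_real (real n powr p) * fps_nth f n) \<longlonglongrightarrow> c"

lemma coeff_lim_add: "coeff_lim p f c \<Longrightarrow> coeff_lim p g d \<Longrightarrow> coeff_lim p (f + g) (c + d)"
  unfolding coeff_lim_def by (simp add: ring_distribs tendsto_add)

lemma coeff_lim_cmult: "coeff_lim p f c \<Longrightarrow> coeff_lim p (fps_const a * f) (a * c)"
  unfolding coeff_lim_def
  using tendsto_mult_left[of "\<lambda>n. of_real (real n powr p) * fps_nth f n" c sequentially a]
  by (simp add: mult_ac)

lemma coeff_lim_shift_iff:
  "(\<lambda>n. of_real (real n powr p) * a (Suc n)) \<longlonglongrightarrow> c \<longleftrightarrow>
   (\<lambda>n. of_real (real n powr p) * a n) \<longlonglongrightarrow> (c :: complex)"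
proof -
  have ratio: "(\<lambda>n. complex_of_real (real (Suc n) powr p / real n powr p)) \<longlonglongrightarrow> of_real 1"
    by (intro tendsto_of_real) real_asymp
  have ratio': "(\<lambda>n. complex_of_real (real n powr p / real (Suc n) powr p)) \<longlonglongrightarrow> of_real 1"
    by (intro tendsto_of_real) real_asymp
  have "(\<lambda>n. of_real (real n powr p) * a n) \<longlonglongrightarrow> c \<longleftrightarrow>
        (\<lambda>n. of_real (real (Suc n) powr p) * a (Suc n)) \<longlonglongrightarrow> c"
    by (rule filterlim_sequentially_Suc[symmetric])
  also have "\<dots> \<longleftrightarrow> (\<lambda>n. of_real (real n powr p) * a (Suc n)) \<longlonglongrightarrow> c"
  proof
    assume "(\<lambda>n. of_real (real (Suc n) powr p) * a (Suc n)) \<longlonglongrightarrow> c"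
    from tendsto_mult[OF this ratio'] show "(\<lambda>n. of_real (real n powr p) * a (Suc n)) \<longlonglongrightarrow> c"
      by (simp add: mult_ac)
  next
    assume "(\<lambda>n. of_real (real n powr p) * a (Suc n)) \<longlonglongrightarrow> c"
    from tendsto_mult[OF this ratio]
    have "(\<lambda>n. of_real (real n powr p) * a (Suc n) * of_real (real (Suc n) powr p / real n powr p)) \<longlonglongrightarrow> c"
      by simp
    moreover have "eventually (\<lambda>n. of_real (real n powr p) * a (Suc n) * of_real (real (Suc n) powr p / real n powr p)
        = of_real (real (Suc n) powr p) * a (Suc n)) sequentially"
      using eventually_gt_at_top[of 0] by eventually_elim simp
    ultimately show "(\<lambda>n. of_real (real (Suc n) powr p) * a (Suc n)) \<longlonglongrightarrow> c"
      by (rule Lim_transform_eventually)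
  qed
  finally show ?thesis by simp
qed

lemma coeff_lim_X_mult: "coeff_lim p (fps_X * f) c \<longleftrightarrow> coeff_lim p f c"
  unfolding coeff_lim_def
  using coeff_lim_shift_iff[of p "\<lambda>n. fps_nth (fps_X * f) n" c] by simp

lemma coeff_lim_imp_decay:
  assumes "coeff_lim p f c" "p \<ge> 0"
  shows "coeff_decay p f"
proof -
  have "Bseq (\<lambda>n. of_real (real n powr p) * fps_nth f n)"
    using assms(1) unfolding coeff_lim_def by (intro convergent_imp_Bseq convergentI)
  then obtain B where B: "B > 0" "\<And>n. norm (of_real (real n powr p) * fps_nth f n) \<le> B"
    unfolding Bseq_def by blast
  show ?thesis
  proof (rule coeff_decayI)
    fix n
    \<comment> \<open>The weight \<open>real n powr p\<close> is 0 at n = 0, so the limit says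
      nothing about coefficient 0; it gets a summand of its own in the constant.\<close>
    have B0: "norm (fps_nth f 0) \<le> norm (fps_nth f 0) + B * 2 powr p" using B by simp
    show "norm (fps_nth f n) \<le> (norm (fps_nth f 0) + B * 2 powr p) * real (Suc n) powr (-p)"
    proof (cases "n = 0")
      case False
      have le: "norm (fps_nth f n) * real n powr p \<le> B"
        using B(2)[of n] by (simp add: norm_mult mult.commute)
      have "real (Suc n) powr p \<le> (2 * real n) powr p"
        using False assms(2) by (intro powr_mono2) auto
      hence "real (Suc n) powr p \<le> 2 powr p * real n powr p" by (simp add: powr_mult)
      hence "norm (fps_nth f n) * real (Suc n) powr p \<le> norm (fps_nth f n) * (2 powr p * real n powr p)"
        by (rule mult_left_mono) auto
      also have "norm (fps_nth f n) * (2 powr p * real n powr p) = 2 powr p * (norm (fps_nth f n) * real n powr p)"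
        by simp
      also have "\<dots> \<le> 2 powr p * B" by (intro mult_left_mono le) auto
      also have "\<dots> \<le> norm (fps_nth f 0) + B * 2 powr p" by simp
      finally show ?thesis by (simp add: powr_minus field_simps)
    qed (use B0 in simp)
  qed
qed

lemma coeff_decay_imp_lim_0:
  assumes "coeff_decay s f" "p < s"
  shows "coeff_lim p f 0"
  unfolding coeff_lim_def
proof -
  obtain C where C: "C > 0" "\<And>n. norm (fps_nth f n) \<le> C * real (Suc n) powr (-s)"
    using coeff_decayE[OF assms(1)] by blast
  show "(\<lambda>n. of_real (real n powr p) * fps_nth f n) \<longlonglongrightarrow> 0"
  proof (rule Lim_null_comparison)
  show "eventually (\<lambda>n. norm (of_real (real n powr p) * fps_nth f n)
          \<le> real n powr p * (C * real (Suc n) powr (-s))) sequentially"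
    by (intro always_eventually allI) (simp add: norm_mult mult_left_mono C del: of_nat_Suc)
  show "(\<lambda>n. real n powr p * (C * real (Suc n) powr (-s))) \<longlonglongrightarrow> 0"
    using assms(2) by real_asymp
  qed
qed

text \<open>For p \<le> 1 the sums diverge; comparison with a summable exponent t > 1 limits their
  growth for all p at once, at a loss that is small when t is close to 1.\<close>

lemma sum_powr_le:
  fixes p t :: real
  assumes "t > 1"
  obtains Z where "Z > 0"
    "\<And>n. (\<Sum>j\<le>n. real (Suc j) powr (-p)) \<le> Z * real (Suc n) powr (max 0 (t - p))"
proof -
  define Z where "Z = (\<Sum>n. real (Suc n) powr (-t))"
  have sm: "summable (\<lambda>n. real (Suc n) powr (-t))" by (rule summable_powr_Suc[OF assms])
  have part: "(\<Sum>k\<le>n. real (Suc k) powr (-t)) \<le> Z" for n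
    unfolding Z_def by (rule sum_le_suminf[OF sm]) auto
  have Z1: "Z \<ge> 1" using part[of 0] by simp
  show ?thesis
  proof (rule that[of Z])
    fix n
    have "(\<Sum>j\<le>n. real (Suc j) powr (-p)) \<le> (\<Sum>j\<le>n. real (Suc n) powr (max 0 (t - p)) * real (Suc j) powr (-t))"
    proof (rule sum_mono)
      fix j assume j: "j \<in> {..n}"
      have "real (Suc j) powr (-p) = real (Suc j) powr (t - p) * real (Suc j) powr (-t)"
        by (simp flip: powr_add)
      also have "real (Suc j) powr (t - p) \<le> real (Suc j) powr (max 0 (t - p))"
        by (intro powr_mono) auto
      also have "\<dots> \<le> real (Suc n) powr (max 0 (t - p))"
        using j by (intro powr_mono2) auto
      finally show "real (Suc j) powr (-p) \<le> real (Suc n) powr (max 0 (t - p)) * real (Suc j) powr (-t)"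
        by (simp add: mult_right_mono)
    qed
    also have "\<dots> = (\<Sum>j\<le>n. real (Suc j) powr (-t)) * real (Suc n) powr (max 0 (t - p))"
      by (simp add: sum_distrib_left mult_ac)
    also have "\<dots> \<le> Z * real (Suc n) powr (max 0 (t - p))"
      by (intro mult_right_mono part) auto
    finally show "(\<Sum>j\<le>n. real (Suc j) powr (-p)) \<le> Z * real (Suc n) powr (max 0 (t - p))" .
  qed (use Z1 in auto)
qed

text \<open>The Cauchy product is cut at k = n/2. For small k, Tannery's theorem lets n tend to
  infinity under the sum and produces c times the value of b at 1. For large k the factor from b is
  O(n^(-s)), which beats the partial sums of a. The case p \<le> 1 is included, as it arises for
  derivatives.\<close>

lemma coeff_lim_mult:
  assumes a: "coeff_lim p a c" and b: "coeff_decay s b" and ps: "s > 1" "s > p" "p \<ge> 0"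
  shows "coeff_lim p (a * b) (c * eval_fps b 1)"
proof -
  obtain A where A: "A > 0" "\<And>n. norm (fps_nth a n) \<le> A * real (Suc n) powr (-p)"
    using coeff_decayE[OF coeff_lim_imp_decay[OF a ps(3)]] by blast
  obtain B where B: "B > 0" "\<And>n. norm (fps_nth b n) \<le> B * real (Suc n) powr (-s)"
    using coeff_decayE[OF b] by blast
  have acb: "abs_conv b" by (rule coeff_decay_imp_abs_conv[OF b ps(1)])
  define U where "U = (\<lambda>k n. if 2 * k \<le> n then
      fps_nth b k * (of_real (real n powr p) * fps_nth a (n - k)) else 0)"
  define V where "V = (\<lambda>n. of_real (real n powr p) * (\<Sum>k\<in>{k. k \<le> n \<and> n < 2 * k}. fps_nth b k * fps_nth a (n - k)))"
  have split: "of_real (real n powr p) * fps_nth (a * b) n = (\<Sum>k. U k n) + V n" for n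
  proof -
    have "(\<Sum>k. U k n) = (\<Sum>k\<in>{k. k \<le> n \<and> 2 * k \<le> n}. U k n)"
      by (rule suminf_finite) (auto simp: U_def)
    also have "\<dots> = of_real (real n powr p) * (\<Sum>k\<in>{k. k \<le> n \<and> 2 * k \<le> n}. fps_nth b k * fps_nth a (n - k))"
      unfolding sum_distrib_left by (rule sum.cong) (auto simp: U_def)
    finally have "(\<Sum>k. U k n) + V n = of_real (real n powr p) *
      ((\<Sum>k\<in>{k. k \<le> n \<and> 2 * k \<le> n}. fps_nth b k * fps_nth a (n - k)) +
       (\<Sum>k\<in>{k. k \<le> n \<and> n < 2 * k}. fps_nth b k * fps_nth a (n - k)))"
      by (simp add: V_def ring_distribs)
    also have "(\<Sum>k\<in>{k. k \<le> n \<and> 2 * k \<le> n}. fps_nth b k * fps_nth a (n - k)) +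
       (\<Sum>k\<in>{k. k \<le> n \<and> n < 2 * k}. fps_nth b k * fps_nth a (n - k))
       = (\<Sum>k\<in>{k. k \<le> n \<and> 2 * k \<le> n} \<union> {k. k \<le> n \<and> n < 2 * k}. fps_nth b k * fps_nth a (n - k))"
      by (rule sum.union_disjoint[symmetric]) auto
    also have "{k. k \<le> n \<and> 2 * k \<le> n} \<union> {k. k \<le> n \<and> n < 2 * k} = {0..n}" by auto
    also have "(\<Sum>k=0..n. fps_nth b k * fps_nth a (n - k)) = fps_nth (a * b) n"
      by (subst mult.commute) (simp add: fps_mult_nth)
    finally show ?thesis ..
  qed
  have limU: "(\<lambda>n. \<Sum>k. U k n) \<longlonglongrightarrow> (\<Sum>k. fps_nth b k * c)"
  proof -
    have "(\<lambda>n. U k n) \<longlonglongrightarrow> fps_nth b k * c" for k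
    proof -
      have "(\<lambda>n. of_real (real n powr p) * fps_nth a n) \<longlonglongrightarrow> c" using a by (simp add: coeff_lim_def)
      hence l1: "(\<lambda>n. of_real (real (n - k) powr p) * fps_nth a (n - k)) \<longlonglongrightarrow> c"
        by (rule filterlim_compose) (rule filterlim_minus_const_nat_at_top)
      have l2: "(\<lambda>n. of_real (real n powr p / (real n - real k) powr p)) \<longlonglongrightarrow> complex_of_real 1"
        by (intro tendsto_of_real) real_asymp
      have "(\<lambda>n. fps_nth b k * (of_real (real n powr p / (real n - real k) powr p) *
              (of_real (real (n - k) powr p) * fps_nth a (n - k)))) \<longlonglongrightarrow> fps_nth b k * (of_real 1 * c)"
        by (intro tendsto_intros l1 l2)
      moreover have "eventually (\<lambda>n. fps_nth b k * (of_real (real n powr p / (real n - real k) powr p) *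
              (of_real (real (n - k) powr p) * fps_nth a (n - k))) = U k n) sequentially"
        using eventually_gt_at_top[of "2 * k"]
      proof eventually_elim
        case (elim n)
        hence "(real n - real k) powr p \<noteq> 0" "real (n - k) = real n - real k" by auto
        thus ?case using elim by (simp add: U_def)
      qed
      ultimately show ?thesis by (auto intro: Lim_transform_eventually)
    qed
    moreover have "norm (U k n) \<le> norm (fps_nth b k) * (A * 2 powr p)" for k n
    proof (cases "2 * k \<le> n")
      case True
      have "norm (U k n) = norm (fps_nth b k) * (real n powr p * norm (fps_nth a (n - k)))"
        using True by (simp add: U_def norm_mult)
      also have "real n powr p * norm (fps_nth a (n - k)) \<le> (2 * real (Suc (n - k))) powr p * (A * real (Suc (n - k)) powr (-p))"
        using True ps A(1) by (intro mult_mono powr_mono2 A(2)) auto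
      also have "\<dots> = A * 2 powr p"
      proof -
        have "(2 * real (Suc (n - k))) powr p = 2 powr p * real (Suc (n - k)) powr p"
          by (rule powr_mult)
        moreover have "real (Suc (n - k)) powr p * real (Suc (n - k)) powr (-p) = 1"
          by (simp flip: powr_add)
        ultimately show ?thesis by (simp add: mult_ac del: of_nat_Suc)
      qed
      finally show ?thesis by (simp add: mult_left_mono)
    qed (use A in \<open>simp add: U_def\<close>)
    moreover have "summable (\<lambda>k. norm (fps_nth b k) * (A * 2 powr p))"
      using acb unfolding abs_conv_def by (rule summable_mult2)
    ultimately show ?thesis
      using tannerys_theorem[of U "\<lambda>k. fps_nth b k * c" sequentially "\<lambda>k. norm (fps_nth b k) * (A * 2 powr p)"]
      by (auto intro: always_eventually)
  qed
  \<comment> \<open>Any t strictly between 1 and s works: the exponent p - s + max 0 (t - p) equals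
    max (p - s) (t - s), which is negative.\<close>
  define t where "t = (1 + s) / 2"
  have t: "t > 1" "t < s" using ps by (auto simp: t_def)
  obtain Z where Z: "Z > 0" "\<And>n. (\<Sum>j\<le>n. real (Suc j) powr (-p)) \<le> Z * real (Suc n) powr (max 0 (t - p))"
    using sum_powr_le[OF t(1)] by blast
  have limV: "V \<longlonglongrightarrow> 0"
  proof (rule Lim_null_comparison)
    define D where "D = A * B * 2 powr s * Z"
    show "(\<lambda>n. D * real (Suc n) powr (p - s + max 0 (t - p))) \<longlonglongrightarrow> 0"
    proof -
      have neg: "p - s + max 0 (t - p) < 0" using t ps by auto
      have "((\<lambda>n. real (Suc n) powr (p - s + max 0 (t - p))) \<longlongrightarrow> 0) sequentially"
        by (rule tendsto_neg_powr[OF neg])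
           (intro filterlim_compose[OF filterlim_real_sequentially filterlim_Suc])
      thus ?thesis by (rule tendsto_mult_right_zero)
    qed
    show "eventually (\<lambda>n. norm (V n) \<le> D * real (Suc n) powr (p - s + max 0 (t - p))) sequentially"
    proof (intro always_eventually allI)
      fix n :: nat
      let ?S = "{k. k \<le> n \<and> n < 2 * k}"
      have "norm (\<Sum>k\<in>?S. fps_nth b k * fps_nth a (n - k)) \<le>
         (\<Sum>k\<in>?S. (B * (2 powr s * real (Suc n) powr (-s))) * (A * real (Suc (n - k)) powr (-p)))"
      proof (rule order_trans[OF norm_sum], rule sum_mono)
        fix k assume k: "k \<in> ?S"
        have "norm (fps_nth b k) \<le> B * real (Suc k) powr (-s)" by (rule B)
        also have "real (Suc k) powr (-s) \<le> (real (Suc n) / 2) powr (-s)"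
          using k ps by (intro powr_mono2') auto
        also have "(real (Suc n) / 2) powr (-s) = 2 powr s * real (Suc n) powr (-s)"
          by (simp add: powr_divide powr_minus field_simps)
        finally have "norm (fps_nth b k) \<le> B * (2 powr s * real (Suc n) powr (-s))"
          using B by (simp add: mult_left_mono)
        thus "norm (fps_nth b k * fps_nth a (n - k)) \<le>
           (B * (2 powr s * real (Suc n) powr (-s))) * (A * real (Suc (n - k)) powr (-p))"
          unfolding norm_mult using B(1) by (intro mult_mono A(2)) auto
      qed
      also have "\<dots> \<le> (\<Sum>k\<le>n. (B * (2 powr s * real (Suc n) powr (-s))) * (A * real (Suc (n - k)) powr (-p)))"
        using A(1) B(1) by (intro sum_mono2) auto
      also have "\<dots> = (B * (2 powr s * real (Suc n) powr (-s))) * A * (\<Sum>k\<le>n. real (Suc (n - k)) powr (-p))"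
        by (simp only: sum_distrib_left mult.assoc)
      also have "(\<Sum>k\<le>n. real (Suc (n - k)) powr (-p)) = (\<Sum>j\<le>n. real (Suc j) powr (-p))"
        by (rule sum.reindex_bij_witness[of _ "\<lambda>k. n - k" "\<lambda>k. n - k"]) auto
      also have "(B * (2 powr s * real (Suc n) powr (-s))) * A * \<dots> \<le>
         (B * (2 powr s * real (Suc n) powr (-s))) * A * (Z * real (Suc n) powr (max 0 (t - p)))"
        using A(1) B(1) by (intro mult_left_mono Z) auto
      finally have "norm (V n) \<le> real n powr p *
          ((B * (2 powr s * real (Suc n) powr (-s))) * A * (Z * real (Suc n) powr (max 0 (t - p))))"
        unfolding V_def by (simp add: norm_mult mult_left_mono)
      also have "\<dots> \<le> real (Suc n) powr p *
          ((B * (2 powr s * real (Suc n) powr (-s))) * A * (Z * real (Suc n) powr (max 0 (t - p))))"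
        using A(1) B(1) Z(1) ps by (intro mult_right_mono powr_mono2) auto
      also have "\<dots> = D * (real (Suc n) powr p * real (Suc n) powr (-s) * real (Suc n) powr (max 0 (t - p)))"
        by (simp add: D_def mult_ac del: of_nat_Suc)
      also have "real (Suc n) powr p * real (Suc n) powr (-s) * real (Suc n) powr (max 0 (t - p))
          = real (Suc n) powr (p - s + max 0 (t - p))"
        by (simp flip: powr_add del: of_nat_Suc)
      finally show "norm (V n) \<le> D * real (Suc n) powr (p - s + max 0 (t - p))" .
    qed
  qed
  have "(\<Sum>k. fps_nth b k * c) = c * eval_fps b 1"
    using suminf_mult[OF abs_conv_summable(2)[OF acb, of 1], of c] by (simp add: eval_fps_def mult.commute)
  thus ?thesis
    using tendsto_add[OF limU limV] by (simp add: coeff_lim_def split)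
qed

section \<open>Powers of 1 - z and square roots of series\<close>

definition one_minus_pow :: "real \<Rightarrow> complex fps" where
  "one_minus_pow a = fps_dilate (-1) (fps_binomial (of_real a))"

lemma one_minus_pow_add: "one_minus_pow (a + b) = one_minus_pow a * one_minus_pow b"
  by (simp add: one_minus_pow_def fps_binomial_add_mult fps_dilate_mult)

lemma one_minus_pow_0: "one_minus_pow 0 = 1"
  by (simp add: one_minus_pow_def)

lemma one_minus_pow_1: "one_minus_pow 1 = 1 - fps_X"
  unfolding one_minus_pow_def of_real_1 fps_binomial_1
  by (rule fps_ext) auto

lemma one_minus_pow_nth_0 [simp]: "fps_nth (one_minus_pow a) 0 = 1"
  by (simp add: one_minus_pow_def)

lemma one_minus_pow_minus_1: "fps_nth (one_minus_pow (-1)) n = 1"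
proof -
  have "(-1 :: complex) gchoose n = (-1) ^ n * (of_nat n gchoose n)"
    using gbinomial_minus[of "1::complex" n] by simp
  moreover have "(of_nat n gchoose n :: complex) = 1" using binomial_gbinomial[of n n, where ?'a = complex] by simp
  moreover have "(-1 :: complex) ^ n * (-1) ^ n = 1" by (simp only: power_mult_distrib[symmetric]) simp
  ultimately show ?thesis by (simp add: one_minus_pow_def)
qed

lemma one_minus_pow_bounded:
  assumes "-1 \<le> a" "a \<le> 1"
  shows "norm (fps_nth (one_minus_pow a) n) \<le> 1"
  using norm_gbinomial_le_1[OF refl assms]
  by (simp add: one_minus_pow_def norm_mult norm_power)

text \<open>Stated with the entire function \<open>rGamma\<close>, so that nonnegative integers a,
  where the series is a polynomial, fit in with limit 0.\<close>

lemma coeff_lim_one_minus_pow: "coeff_lim (a + 1) (one_minus_pow a) (of_real (rGamma (-a)))"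
proof -
  have lim: "(\<lambda>n. (complex_of_real a gchoose n) / ((-1)^n / exp ((of_real a + 1) * of_real (ln (real n)))))
     \<longlonglongrightarrow> inverse (Gamma (- complex_of_real a))"
    by (rule gbinomial_asymptotic)
  have ev: "eventually (\<lambda>n. (complex_of_real a gchoose n) / ((-1)^n / exp ((of_real a + 1) * of_real (ln (real n))))
      = of_real (real n powr (a + 1)) * fps_nth (one_minus_pow a) n) sequentially"
    using eventually_gt_at_top[of 0]
  proof eventually_elim
    case (elim n)
    have "exp ((complex_of_real a + 1) * of_real (ln (real n))) = of_real (exp ((a + 1) * ln (real n)))"
      by (simp flip: exp_of_real)
    also have "\<dots> = of_real (real n powr (a + 1))" using elim by (simp add: powr_def)
    finally show ?case
      by (cases "even n") (simp_all add: one_minus_pow_def)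
  qed
  have "inverse (Gamma (- complex_of_real a)) = of_real (rGamma (-a))"
    unfolding rGamma_inverse_Gamma[symmetric] by (simp flip: rGamma_complex_of_real)
  with Lim_transform_eventually[OF lim ev] show ?thesis
    unfolding coeff_lim_def by simp
qed

lemma coeff_decay_one_minus_pow: "a \<ge> 0 \<Longrightarrow> coeff_decay (a + 1) (one_minus_pow a)"
  by (rule coeff_lim_imp_decay[OF coeff_lim_one_minus_pow]) simp

lemma abs_conv_one_minus_pow: "a > 0 \<Longrightarrow> abs_conv (one_minus_pow a)"
  by (rule coeff_decay_imp_abs_conv[OF coeff_decay_one_minus_pow]) auto

text \<open>After division by (1 - z)^a the remaining root e has the square q, which is free of
  zeros on the closed disc. Wiener's lemma then applies to 1 / e, and e = q / e inherits its decay.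
  The required convergence radius of e comes from bounded coefficients: those of h are absolutely
  summable and those of (1 - z)^(-a) are at most 1.\<close>

lemma critical_sqrt:
  assumes q: "coeff_decay s q" and st: "1 < t" "t < s"
    and h: "h\<^sup>2 = one_minus_pow (2 * a) * q" "abs_conv h" and a: "0 < a" "a \<le> 1"
    and nz: "\<And>z. norm z \<le> 1 \<Longrightarrow> z \<noteq> 1 \<Longrightarrow> eval_fps (h\<^sup>2) z \<noteq> 0" and q1: "eval_fps q 1 \<noteq> 0"
  obtains e where "h = one_minus_pow a * e" "e\<^sup>2 = q" "coeff_decay t e"
proof -
  define e where "e = h * one_minus_pow (-a)"
  have inv: "one_minus_pow a * one_minus_pow (-a) = 1"
    using one_minus_pow_add[of a "-a"] by (simp add: one_minus_pow_0)
  have he: "h = one_minus_pow a * e" using inv by (simp add: e_def mult.left_commute[of "one_minus_pow a"])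
  have "one_minus_pow (2 * a) = (one_minus_pow a)\<^sup>2"
    using one_minus_pow_add[of a a] by (simp add: power2_eq_square)
  hence inv2: "one_minus_pow (2 * a) * (one_minus_pow (-a))\<^sup>2 = 1"
    using inv by (simp flip: power_mult_distrib)
  have "e\<^sup>2 = q * (one_minus_pow (2 * a) * (one_minus_pow (-a))\<^sup>2)"
    by (simp only: e_def power_mult_distrib h(1) mult_ac)
  hence eq: "e\<^sup>2 = q" by (simp add: inv2)
  have acq: "abs_conv q" by (rule coeff_decay_imp_abs_conv[OF q]) (use st in auto)
  have nzq: "eval_fps q z \<noteq> 0" if "norm z \<le> 1" for z
  proof (cases "z = 1")
    case False
    have "eval_fps (h\<^sup>2) z = eval_fps (one_minus_pow (2 * a)) z * eval_fps q z"
      unfolding h(1) by (rule eval_fps_mult_disc[OF abs_conv_one_minus_pow acq that]) (use a in auto)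
    thus ?thesis using nz[OF that False] by auto
  qed (use q1 in simp)
  have "norm (fps_nth e n) \<le> (\<Sum>k. norm (fps_nth h k))" for n
  proof -
    have "norm (fps_nth e n) \<le> (\<Sum>k\<le>n. norm (fps_nth h k * fps_nth (one_minus_pow (-a)) (n - k)))"
      by (simp add: e_def fps_mult_nth atLeast0AtMost norm_sum)
    also have "\<dots> \<le> (\<Sum>k\<le>n. norm (fps_nth h k) * 1)"
      by (intro sum_mono, subst norm_mult, intro mult_left_mono one_minus_pow_bounded) (use a in auto)
    also have "\<dots> \<le> (\<Sum>k. norm (fps_nth h k))"
      using h(2) by (simp add: abs_conv_def sum_le_suminf)
    finally show ?thesis .
  qed
  hence rad: "fps_conv_radius e \<ge> 1" by (rule bounded_coeffs_conv_radius)
  have "coeff_decay t (inverse e)"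
    by (rule coeff_decay_inverse_sqrt[OF q st nzq eq rad])
  hence "coeff_decay t (q * inverse e)"
    by (intro coeff_decay_mult coeff_decay_mono[OF q]) (use st in auto)
  moreover have "fps_nth e 0 \<noteq> 0"
    using nzq[of 0] eq by (auto simp: eval_fps_at_0 power2_eq_square)
  hence "q * inverse e = e"
    by (simp add: eq[symmetric] power2_eq_square mult.assoc inverse_mult_eq_1')
  ultimately have "coeff_decay t e" by simp
  thus ?thesis using that he eq by blast
qed

text \<open>The asymptotics are read off from \<open>h' = f' / (2 h)\<close>; the bound on \<open>1 / h\<close> comes first.\<close>

lemma coeff_lim_sqrt:
  assumes hf: "h\<^sup>2 = f" and lim: "coeff_lim p f c" and p: "p > 1"
    and nz: "\<And>z. norm z \<le> 1 \<Longrightarrow> eval_fps f z \<noteq> 0" and rad: "fps_conv_radius h \<ge> 1"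
  shows "coeff_lim p h (c / (2 * eval_fps h 1))"
proof -
  \<comment> \<open>Wiener's lemma forces t' < p, so the product of f and 1 / h would be too weak to
    transfer the exponent p directly. The derivative of f has exponent p - 1, and t' can exceed
    that.\<close>
  define t' where "t' = (max 1 (p - 1) + p) / 2"
  have t': "1 < t'" "t' < p" "p - 1 < t'" using p by (auto simp: t'_def max_def field_simps)
  have decf: "coeff_decay p f" by (rule coeff_lim_imp_decay[OF lim]) (use p in simp)
  have acf: "abs_conv f" by (rule coeff_decay_imp_abs_conv[OF decf p])
  have dec: "coeff_decay t' (inverse h)"
    by (rule coeff_decay_inverse_sqrt[OF decf t'(1,2) nz hf rad])
  have h0: "fps_nth h 0 \<noteq> 0"
    using nz[of 0] hf by (auto simp: eval_fps_at_0 power2_eq_square)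
  have aci: "abs_conv (inverse h)" by (rule coeff_decay_imp_abs_conv[OF dec t'(1)])
  have hfi: "h = f * inverse h"
    using h0 by (simp add: hf[symmetric] power2_eq_square mult.assoc inverse_mult_eq_1')
  have ach: "abs_conv h" by (subst hfi) (rule abs_conv_mult[OF acf aci])
  have "eval_fps h 1 * eval_fps (inverse h) 1 = eval_fps (h * inverse h) 1"
    by (rule eval_fps_mult_disc[symmetric]) (use ach aci in auto)
  also have "h * inverse h = 1" using h0 by (rule inverse_mult_eq_1')
  finally have ev: "eval_fps (inverse h) 1 = 1 / eval_fps h 1"
    by (metis eval_fps_1 mult_zero_left nonzero_mult_div_cancel_left zero_neq_one)
  have der_lim: "coeff_lim p g d" if "coeff_lim (p - 1) (fps_deriv g) d" for g d
  proof -
    have "(\<lambda>n. of_real (real n powr (p - 1)) * (of_nat (Suc n) * fps_nth g (Suc n))) \<longlonglongrightarrow> d"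
      using that by (simp add: coeff_lim_def)
    hence "(\<lambda>n. of_real (real n powr (p - 1)) * (of_nat n * fps_nth g n)) \<longlonglongrightarrow> d"
      using coeff_lim_shift_iff[of "p - 1" "\<lambda>n. of_nat n * fps_nth g n" d] by simp
    moreover have "eventually (\<lambda>n. of_real (real n powr (p - 1)) * (of_nat n * fps_nth g n)
        = of_real (real n powr p) * fps_nth g n) sequentially"
      using eventually_gt_at_top[of 0]
    proof eventually_elim
      case (elim n)
      have "real n powr p = real n powr (p - 1) * real n"
        using elim powr_add[of "real n" "p - 1" 1] by simp
      thus ?case by simp
    qed
    ultimately show ?thesis unfolding coeff_lim_def by (rule Lim_transform_eventually)
  qed
  have lim_der: "coeff_lim (p - 1) (fps_deriv g) d" if "coeff_lim p g d" for g d
  proof -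
    have "eventually (\<lambda>n. of_real (real n powr p) * fps_nth g n
       = of_real (real n powr (p - 1)) * (of_nat n * fps_nth g n)) sequentially"
      using eventually_gt_at_top[of 0]
    proof eventually_elim
      case (elim n)
      have "real n powr p = real n powr (p - 1) * real n"
        using elim powr_add[of "real n" "p - 1" 1] by simp
      thus ?case by simp
    qed
    with that have "(\<lambda>n. of_real (real n powr (p - 1)) * (of_nat n * fps_nth g n)) \<longlonglongrightarrow> d"
      unfolding coeff_lim_def by (rule Lim_transform_eventually)
    thus ?thesis
      using coeff_lim_shift_iff[of "p - 1" "\<lambda>n. of_nat n * fps_nth g n" d] by (simp add: coeff_lim_def)
  qed
  have "fps_deriv f = fps_const 2 * (fps_deriv h * h)"
    by (simp add: hf[symmetric] power2_eq_square mult.commute flip: fps_numeral_fps_const)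
  hence "fps_const (1/2) * (fps_deriv f * inverse h)
      = fps_const (1/2) * fps_const 2 * (fps_deriv h * (h * inverse h))"
    by (simp only: mult_ac)
  hence "fps_deriv h = fps_const (1/2) * (fps_deriv f * inverse h)"
    using inverse_mult_eq_1'[OF h0] by (simp only: fps_const_mult) simp
  moreover have "coeff_lim (p - 1) (fps_const (1/2) * (fps_deriv f * inverse h)) (1/2 * (c * eval_fps (inverse h) 1))"
    by (intro coeff_lim_cmult coeff_lim_mult[OF lim_der[OF lim] dec]) (use t' p in auto)
  ultimately show ?thesis using der_lim[of h] by (simp add: ev)
qed

text \<open>The equality case of the triangle inequality: the terms x_n (1 - Re z^n) are nonnegative
  and their sum is \<open>suminf x - 1\<close>, which is at most 0. So every one of them
  vanishes.\<close>

lemma eval_nonneg_eq_1_imp: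
  fixes w :: "complex fps"
  assumes w: "\<And>n. fps_nth w n = of_real (x n)" "\<And>n. x n \<ge> 0" "summable x" "suminf x \<le> 1"
    and z: "norm z \<le> 1" "eval_fps w z = 1" and n: "x n > 0"
  shows "z ^ n = 1 \<and> suminf x = 1"
proof -
  have Re_le: "Re (z ^ n) \<le> 1" for n
    using complex_Re_le_cmod[of "z ^ n"] power_le_one[of "norm z" n] z by (simp add: norm_power)
  have acw: "abs_conv w" using w by (simp add: abs_conv_def)
  have sz: "summable (\<lambda>n. fps_nth w n * z ^ n)" by (rule abs_conv_summable[OF acw z(1)])
  have "(\<lambda>n. fps_nth w n * z ^ n) sums 1" using sz z(2) by (simp add: eval_fps_def sums_iff)
  hence "(\<lambda>n. Re (fps_nth w n * z ^ n)) sums Re 1" by (rule sums_Re)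
  hence "(\<lambda>n. x n * Re (z ^ n)) sums 1" by (simp add: w)
  from sums_diff[OF summable_sums[OF w(3)] this]
  have sms: "(\<lambda>n. x n * (1 - Re (z ^ n))) sums (suminf x - 1)" by (simp add: algebra_simps)
  have nn: "x n * (1 - Re (z ^ n)) \<ge> 0" for n using w(2) Re_le by simp
  have "suminf x - 1 \<ge> 0" using suminf_nonneg[OF sums_summable[OF sms] nn] sums_unique[OF sms] by simp
  hence s0: "suminf x = 1" using w(4) by simp
  hence "(\<Sum>n. x n * (1 - Re (z ^ n))) = 0" using sms by (simp add: sums_iff)
  hence "x n * (1 - Re (z ^ n)) = 0"
    using suminf_eq_zero_iff[OF sums_summable[OF sms] nn] by simp
  hence re: "Re (z ^ n) = 1" using n by simp
  moreover have "norm (z ^ n) \<le> 1" using z by (simp add: norm_power power_le_one)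
  hence "(Re (z ^ n))\<^sup>2 + (Im (z ^ n))\<^sup>2 \<le> 1"
    by (simp add: cmod_def)
  hence "Im (z ^ n) = 0" using re by simp
  ultimately show ?thesis using s0 by (simp add: complex_eq_iff)
qed

section \<open>Counting terms\<close>

lemma finite_nodes [simp]: "finite (nodes t)"
  by (induction t) auto

lemma nodes_nonempty [simp]: "nodes t \<noteq> {}"
  by (cases t) auto

lemma tree_size_simps [simp]:
  "tree_size Leaf = 1"
  "tree_size (Unary t) = Suc (tree_size t)"
  "tree_size (Binary l r) = Suc (tree_size l + tree_size r)"
proof -
  show "tree_size Leaf = 1" by (simp add: tree_size_def)
  show "tree_size (Unary t) = Suc (tree_size t)"
    unfolding tree_size_def by (simp, subst card_insert_disjoint) (auto simp: card_image)
  have "card ((#) 0 ` nodes l \<union> (#) 1 ` nodes r) = card (nodes l) + card (nodes r)"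
    by (subst card_Un_disjoint) (auto simp: card_image)
  thus "tree_size (Binary l r) = Suc (tree_size l + tree_size r)"
    unfolding tree_size_def by (simp, subst card_insert_disjoint) auto
qed

lemma finite_unary_nodes [simp]: "finite (unary_nodes t)"
  by (induction t) auto

lemma unary_on_path_simps:
  "unary_on_path Leaf v = {}"
  "unary_on_path (Unary t) [] = {[]}"
  "unary_on_path (Unary t) (0 # v) = insert [] ((#) 0 ` unary_on_path t v)"
  "unary_on_path (Binary l r) [] = {}"
  "unary_on_path (Binary l r) (0 # v) = (#) 0 ` unary_on_path l v"
  "unary_on_path (Binary l r) (Suc 0 # v) = (#) 1 ` unary_on_path r v"
  by (auto simp: unary_on_path_def)

lemma finite_unary_on_path [simp]: "finite (unary_on_path t v)"
  by (simp add: unary_on_path_def)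

lemma card_unary_on_path:
  "card (unary_on_path Leaf v) = 0"
  "card (unary_on_path (Unary t) []) = 1"
  "card (unary_on_path (Unary t) (0 # v)) = Suc (card (unary_on_path t v))"
  "card (unary_on_path (Binary l r) []) = 0"
  "card (unary_on_path (Binary l r) (0 # v)) = card (unary_on_path l v)"
  "card (unary_on_path (Binary l r) (Suc 0 # v)) = card (unary_on_path r v)"
  by (auto simp: unary_on_path_simps card_image card_insert_if)

lemma unary_height_le_iff:
  "unary_height t \<le> d \<longleftrightarrow> (\<forall>v\<in>nodes t. card (unary_on_path t v) \<le> d)"
  by (simp add: unary_height_def)

lemma unary_height_simps [simp]:
  "unary_height Leaf = 0"
  "unary_height (Unary t) = Suc (unary_height t)"
  "unary_height (Binary l r) = max (unary_height l) (unary_height r)"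
proof -
  have eqI: "x = y" if "\<And>d. x \<le> d \<longleftrightarrow> y \<le> d" for x y :: nat
    using that by (meson order.antisym order.refl)
  show "unary_height Leaf = 0"
    by (rule eqI) (simp add: unary_height_le_iff card_unary_on_path)
  show "unary_height (Unary t) = Suc (unary_height t)"
  proof (rule eqI)
    fix d
    have "unary_height (Unary t) \<le> d \<longleftrightarrow> d > 0 \<and> (\<forall>v\<in>nodes t. Suc (card (unary_on_path t v)) \<le> d)"
      unfolding unary_height_le_iff by (auto simp: card_unary_on_path)
    also have "\<dots> \<longleftrightarrow> d > 0 \<and> unary_height t \<le> d - 1"
      unfolding unary_height_le_iff by (cases d) auto
    finally show "unary_height (Unary t) \<le> d \<longleftrightarrow> Suc (unary_height t) \<le> d" by (cases d) auto
  qed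
  show "unary_height (Binary l r) = max (unary_height l) (unary_height r)"
    by (rule eqI) (simp add: unary_height_le_iff card_unary_on_path ball_Un)
qed

text \<open>The parameter m is the number of unary nodes above the root, all of them available as
  binders. It lets subterms with variables bound outside be counted by the same recursion.\<close>

primrec bindings :: "nat \<Rightarrow> motzkin \<Rightarrow> nat" where
  "bindings m Leaf = m"
| "bindings m (Unary t) = bindings (Suc m) t"
| "bindings m (Binary l r) = bindings m l * bindings m r"

lemma finite_leaf_nodes [simp]: "finite (leaf_nodes t)"
  by (induction t) auto

lemma prod_unary_on_path: "(\<Prod>v\<in>leaf_nodes t. m + card (unary_on_path t v)) = bindings m t"
proof (induction t arbitrary: m)
  case Leaf
  show ?case by (simp add: card_unary_on_path)
next
  case (Unary t)
  show ?case using Unary[of "Suc m"] by (simp add: prod.reindex card_unary_on_path)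
next
  case (Binary l r)
  have "(\<Prod>v\<in>leaf_nodes (Binary l r). m + card (unary_on_path (Binary l r) v)) =
    (\<Prod>v\<in>(#) 0 ` leaf_nodes l. m + card (unary_on_path (Binary l r) v)) *
    (\<Prod>v\<in>(#) 1 ` leaf_nodes r. m + card (unary_on_path (Binary l r) v))"
    unfolding leaf_nodes.simps by (rule prod.union_disjoint) auto
  thus ?case using Binary by (simp add: prod.reindex card_unary_on_path)
qed

lemma card_binding_maps: "card (\<Pi>\<^sub>E v\<in>leaf_nodes t. unary_on_path t v) = bindings 0 t"
  using prod_unary_on_path[where m = 0 and t = t] by (simp add: card_PiE)

lemma finite_tree_size_le: "finite {t. tree_size t \<le> n}"
proof (induction n)
  case 0
  have "tree_size t > 0" for t by (cases t) auto
  hence no_tree: "{t. tree_size t \<le> 0} = {}" by (auto simp: not_le)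
  show ?case unfolding no_tree by simp
next
  case (Suc n)
  let ?A = "{t. tree_size t \<le> n}"
  have "{t. tree_size t \<le> Suc n} \<subseteq> {Leaf} \<union> Unary ` ?A \<union> case_prod Binary ` (?A \<times> ?A)"
  proof
    fix t assume "t \<in> {t. tree_size t \<le> Suc n}"
    thus "t \<in> {Leaf} \<union> Unary ` ?A \<union> case_prod Binary ` (?A \<times> ?A)"
      by (cases t) (auto simp: image_iff)
  qed
  thus ?case by (rule finite_subset) (use Suc in auto)
qed

definition trees :: "nat \<Rightarrow> nat \<Rightarrow> motzkin set" where
  "trees d n = {t. tree_size t = n \<and> unary_height t \<le> d}"

lemma finite_trees [simp]: "finite (trees d n)"
  by (rule finite_subset[OF _ finite_tree_size_le[of n]]) (auto simp: trees_def)

definition open_count :: "nat \<Rightarrow> nat \<Rightarrow> nat \<Rightarrow> nat" where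
  "open_count m d n = (\<Sum>t\<in>trees d n. bindings m t)"

lemma H_le_nth: "fps_nth (H_le k) n = of_nat (open_count 0 k n)"
proof -
  have "{(t, b) \<in> closed_terms. tree_size t = n \<and> unary_height t \<le> k} =
      (SIGMA t:trees k n. \<Pi>\<^sub>E v\<in>leaf_nodes t. unary_on_path t v)"
    by (auto simp: closed_terms_def trees_def)
  thus ?thesis
    by (simp add: H_le_def open_count_def card_binding_maps finite_PiE)
qed

lemma trees_0 [simp]: "trees d 0 = {}"
proof -
  have "tree_size t \<noteq> 0" for t by (cases t) auto
  thus ?thesis by (auto simp: trees_def)
qed

lemma trees_Suc:
  "trees d (Suc n) = (if n = 0 then {Leaf} else {}) \<union>
     (if d = 0 then {} else Unary ` trees (d - 1) n) \<union>
     case_prod Binary ` (\<Union>i\<le>n. trees d i \<times> trees d (n - i))" (is "?L = ?R")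
proof (intro set_eqI iffI)
  fix t assume "t \<in> ?L"
  thus "t \<in> ?R" by (cases t) (auto simp: trees_def image_iff)
next
  fix t assume "t \<in> ?R"
  thus "t \<in> ?L" by (auto simp: trees_def split: if_splits)
qed

lemma open_count_Suc:
  "open_count m d (Suc n) = (if n = 0 then m else 0) +
     (if d = 0 then 0 else open_count (Suc m) (d - 1) n) +
     (\<Sum>i\<le>n. open_count m d i * open_count m d (n - i))"
proof -
  let ?P = "\<Union>i\<le>n. trees d i \<times> trees d (n - i)"
  have fin: "finite ?P" by auto
  have inj: "inj_on (case_prod Binary) ?P" by (auto simp: inj_on_def)
  have "open_count m d (Suc n) =
     (\<Sum>t\<in>(if n = 0 then {Leaf} else {}) \<union> (if d = 0 then {} else Unary ` trees (d - 1) n). bindings m t)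
     + (\<Sum>t\<in>case_prod Binary ` ?P. bindings m t)"
    unfolding open_count_def trees_Suc by (rule sum.union_disjoint) (use fin in auto)
  also have "(\<Sum>t\<in>(if n = 0 then {Leaf} else {}) \<union> (if d = 0 then {} else Unary ` trees (d - 1) n). bindings m t)
    = (\<Sum>t\<in>(if n = 0 then {Leaf} else {}). bindings m t) +
      (\<Sum>t\<in>(if d = 0 then {} else Unary ` trees (d - 1) n). bindings m t)"
    by (rule sum.union_disjoint) auto
  also have "(\<Sum>t\<in>(if n = 0 then {Leaf} else {}). bindings m t) = (if n = 0 then m else 0)" by simp
  also have "(\<Sum>t\<in>(if d = 0 then {} else Unary ` trees (d - 1) n). bindings m t) =
      (if d = 0 then 0 else open_count (Suc m) (d - 1) n)"
    by (simp add: open_count_def sum.reindex inj_on_def)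
  also have "(\<Sum>t\<in>case_prod Binary ` ?P. bindings m t) = (\<Sum>(l, r)\<in>?P. bindings m l * bindings m r)"
    by (subst sum.reindex[OF inj]) (auto intro!: sum.cong)
  \<comment> \<open>The union is disjoint because the size of the left subtree determines i.\<close>
  also have "\<dots> = (\<Sum>i\<le>n. \<Sum>(l, r)\<in>trees d i \<times> trees d (n - i). bindings m l * bindings m r)"
    by (rule sum.UNION_disjoint) (auto, auto simp: trees_def)
  also have "\<dots> = (\<Sum>i\<le>n. open_count m d i * open_count m d (n - i))"
    by (simp add: open_count_def sum_product sum.cartesian_product)
  finally show ?thesis .
qed

text \<open>\<open>open_coeff k i\<close> counts the subterms that may still contain \<open>i - 1\<close> nested unary nodes
  and sit below the \<open>k - i + 1\<close> outer ones, so \<open>R\<^bsub>i,k\<^esub>(z) = (1 - 2 z L(z))\<^sup>2\<close> for their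
  generating function \<open>L\<close>.\<close>

definition open_coeff :: "nat \<Rightarrow> nat \<Rightarrow> nat \<Rightarrow> real" where
  "open_coeff k i n = (if i = 0 then 0 else real (open_count (Suc k - i) (i - 1) n))"

lemma open_coeff_nonneg: "open_coeff k i n \<ge> 0"
  by (simp add: open_coeff_def)

lemma open_coeff_0 [simp]: "open_coeff k 0 n = 0"
  by (simp add: open_coeff_def)

lemma open_coeff_nth_0 [simp]: "open_coeff k i 0 = 0"
  by (simp add: open_coeff_def open_count_def)

lemma H_le_open_coeff: "fps_nth (H_le k) n = open_coeff k (Suc k) n"
  by (simp add: open_coeff_def H_le_nth)

lemma open_coeff_Suc:
  assumes "i \<le> k"
  shows "open_coeff k (Suc i) (Suc n) = (if n = 0 then real k - real i else 0) +
     (\<Sum>j\<le>n. open_coeff k (Suc i) j * open_coeff k (Suc i) (n - j)) + open_coeff k i n"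
proof -
  have "i > 0 \<Longrightarrow> Suc (k - i) = Suc k - i" using assms by simp
  thus ?thesis using assms
    by (cases "i = 0") (auto simp: open_coeff_def open_count_Suc of_nat_diff)
qed

section \<open>Signs and roots of the radicands\<close>

text \<open>The value 1 at index 0 makes -2 z and 2 z cancel, so index 1 obeys the same recursion as
  the others.\<close>

lemma R_Suc: "R (Suc i) k z = 1 - 4 * (real k - real i) * z\<^sup>2 - 2 * z + 2 * z * sqrt (R i k z)"
  by (cases i) simp_all

text \<open>This is x^2 times R at z = 1 / (2 x). The rescaling removes the factor z in front of the
  nested root and leaves x only through x^2 - x, which increases from 1/2 on.\<close>

primrec radicand :: "nat \<Rightarrow> nat \<Rightarrow> real \<Rightarrow> real" where
  "radicand 0 k x = x\<^sup>2"
| "radicand (Suc i) k x = x\<^sup>2 - x - (real k - real i) + sqrt (radicand i k x)"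

lemma R_eq_radicand:
  assumes "x > 0"
  shows "R i k (1 / (2 * x)) = radicand i k x / x\<^sup>2"
proof (induction i)
  case 0
  show ?case using assms by simp
next
  case (Suc i)
  have "sqrt (R i k (1 / (2 * x))) = sqrt (radicand i k x) / x"
    using assms by (simp add: Suc real_sqrt_divide)
  thus ?case using assms by (simp only: R_Suc radicand.simps) (simp add: field_simps power2_eq_square)
qed

text \<open>The odd extension of \<open>sqrt\<close> is strictly increasing on all reals, which
  carries monotonicity through the nesting whatever the signs of the inner radicands are.\<close>

lemma radicand_strict_mono:
  assumes "1 / 2 \<le> x" "x < y"
  shows "radicand i k x < radicand i k y"
proof -
  have *: "0 < (y - x) * (y + x - 1)" using assms by (intro mult_pos_pos) auto
  show ?thesis
  proof (induction i)
    case 0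
    show ?case using assms by (simp add: power_strict_mono)
  next
    case (Suc i)
    hence "sqrt (radicand i k x) < sqrt (radicand i k y)" by simp
    moreover have "x\<^sup>2 - x < y\<^sup>2 - y" using * by (simp add: power2_eq_square algebra_simps)
    ultimately show ?case unfolding radicand.simps by linarith
  qed
qed

lemma continuous_on_radicand: "continuous_on A (radicand i k)"
proof (induction i)
  case (Suc i)
  show ?case unfolding radicand.simps by (intro continuous_intros Suc[unfolded eta_contract_eq])
qed (auto intro!: continuous_intros)

text \<open>The least root in z is the greatest in x, and strict monotonicity from 1/2 on leaves no
  root beyond x.\<close>

lemma sigma_root_eq:
  assumes x: "1 / 2 \<le> x" and root: "radicand i k x = 0"
    and nonneg: "\<And>l. l < i \<Longrightarrow> radicand l k x \<ge> 0"
  shows "sigma_root i k = 1 / (2 * x)"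
  unfolding sigma_root_def
proof (rule Least_equality)
  show "0 < 1 / (2 * x) \<and> (\<forall>l\<in>{1..<i}. 0 \<le> R l k (1 / (2 * x))) \<and> R i k (1 / (2 * x)) = 0"
    using x root nonneg by (auto simp: R_eq_radicand)
next
  fix z assume z: "0 < z \<and> (\<forall>l\<in>{1..<i}. 0 \<le> R l k z) \<and> R i k z = 0"
  define y where "y = 1 / (2 * z)"
  have y: "y > 0" "z = 1 / (2 * y)" using z by (auto simp: y_def)
  have "radicand i k y = 0" using z y(1) by (auto simp: y(2) R_eq_radicand)
  hence "y \<le> x" using radicand_strict_mono[OF x, of y i k] root by fastforce
  thus "1 / (2 * x) \<le> z" using y by (simp add: frac_le)
qed

section \<open>Locating the vanishing radicands\<close>

lemma of_nat_N_seq: "real (N_seq i) = (real (u_seq i))\<^sup>2 - real (u_seq i) + real i"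
proof -
  have "u_seq i \<le> (u_seq i)\<^sup>2" by (simp add: power2_eq_square)
  thus ?thesis by (simp add: N_seq_def of_nat_diff)
qed

lemma u_seq_pos: "i > 0 \<Longrightarrow> u_seq i > 0"
  by (cases i) auto

lemma u_seq_Suc_real: "(real (u_seq i))\<^sup>2 = real (u_seq (Suc i)) - real (Suc i)"
  by simp

lemma mono_u_seq: "mono u_seq"
proof (rule incseq_SucI)
  fix i
  have "u_seq i \<le> (u_seq i)\<^sup>2" by (simp add: power2_eq_square)
  thus "u_seq i \<le> u_seq (Suc i)" by simp
qed

lemma square_diff_less_iff:
  fixes a b :: real
  assumes "a \<ge> 1" "b \<ge> 1"
  shows "a\<^sup>2 - a < b\<^sup>2 - b \<longleftrightarrow> a < b"
proof -
  have "a\<^sup>2 - a < b\<^sup>2 - b \<longleftrightarrow> 0 < (b - a) * (a + b - 1)"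
    by (simp add: power2_eq_square algebra_simps)
  also have "\<dots> \<longleftrightarrow> a < b" using assms by (auto simp: zero_less_mult_iff)
  finally show ?thesis .
qed

lemma mono_N_seq: "mono N_seq"
proof (rule incseq_SucI)
  fix i
  show "N_seq i \<le> N_seq (Suc i)"
  proof (cases "i = 0")
    case True
    thus ?thesis by (simp add: N_seq_def)
  next
    case False
    have "u_seq i \<ge> 1" "u_seq (Suc i) \<ge> 1" using False u_seq_pos[of i] u_seq_pos[of "Suc i"] by linarith+
    hence "real (u_seq i) \<ge> 1" "real (u_seq (Suc i)) \<ge> 1" by linarith+
    moreover have "real (u_seq i) \<le> real (u_seq (Suc i))"
      unfolding of_nat_le_iff using monoD[OF mono_u_seq, of i "Suc i"] by simp
    ultimately have "(real (u_seq i))\<^sup>2 - real (u_seq i) \<le> (real (u_seq (Suc i)))\<^sup>2 - real (u_seq (Suc i))"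
      using square_diff_less_iff[of "real (u_seq (Suc i))" "real (u_seq i)"] by linarith
    thus ?thesis
      using of_nat_N_seq[of i] of_nat_N_seq[of "Suc i"] by linarith
  qed
qed

lemma le_N_seq: "i \<le> N_seq i"
  by (simp add: N_seq_def)

text \<open>The definition of \<open>N_seq\<close> makes x^2 - x = k - j at x =
  \<open>u_seq j\<close>. The radicands descend through the squares of u_j, u_(j-1), ..., u_0 = 0,
  so the one with index j vanishes.\<close>

lemma radicand_at_N_seq:
  assumes "i \<le> j"
  shows "radicand i (N_seq j) (real (u_seq j)) = (real (u_seq (j - i)))\<^sup>2"
  using assms
proof (induction i)
  case (Suc i)
  hence e: "j - i = Suc (j - Suc i)" "real j - real i = real (Suc (j - Suc i))" by auto
  have "radicand (Suc i) (N_seq j) (real (u_seq j)) = real (u_seq (j - i)) - (real j - real i)"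
    using Suc by (simp add: of_nat_N_seq)
  also have "\<dots> = (real (u_seq (j - Suc i)))\<^sup>2"
    unfolding e(2) by (subst e(1)) (rule u_seq_Suc_real[symmetric])
  finally show ?case .
qed simp

text \<open>Index j + 1 vanishes too, as x^2 - x = k - j and the inner root is 0. From there on the
  linear part is 1, 2, 3, ..., which is the recursion of \<open>lambda_seq\<close>.\<close>

lemma radicand_N_seq_lambda:
  "radicand (Suc j + l) (N_seq j) (real (u_seq j)) = lambda_seq l"
proof (induction l)
  case 0
  show ?case using radicand_at_N_seq[of j j] by (simp add: of_nat_N_seq)
next
  case (Suc l)
  have "radicand (Suc j + Suc l) (N_seq j) (real (u_seq j)) =
     (real (u_seq j))\<^sup>2 - real (u_seq j) - (real (N_seq j) - real (Suc j + l)) + sqrt (lambda_seq l)"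
    using Suc by simp
  thus ?case by (simp add: of_nat_N_seq)
qed

lemma lambda_seq_nonneg: "lambda_seq l \<ge> 0"
  by (induction l) auto

lemma lambda_seq_pos: "l > 0 \<Longrightarrow> lambda_seq l > 0"
  using lambda_seq_nonneg[of "l - 1"] by (cases l) (auto intro: add_pos_nonneg)

text \<open>At a point with \<open>y\<^sup>2 - y = k - i\<close> the square roots of the radicands obey the recursion of
  \<^const>\<open>u_seq\<close> read backwards, so comparing them reduces to comparing \<open>y\<close> with \<open>u\<^sub>i\<close>.\<close>

lemma radicand_compare:
  assumes y: "y \<ge> 0" "y\<^sup>2 - y = real k - real i" and l: "l \<le> i"
  shows "real (u_seq i) < y \<Longrightarrow> (real (u_seq (i - l)))\<^sup>2 < radicand l k y"
    and "y < real (u_seq i) \<Longrightarrow> radicand l k y < (real (u_seq (i - l)))\<^sup>2"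
proof -
  have step: "radicand (Suc l) k y = sqrt (radicand l k y) - (real i - real l)" for l
    using y(2) by simp
  have ustep: "(real (u_seq (i - Suc l)))\<^sup>2 = sqrt ((real (u_seq (i - l)))\<^sup>2) - (real i - real l)"
    if "Suc l \<le> i" for l
  proof -
    have e: "i - l = Suc (i - Suc l)" "real i - real l = real (Suc (i - Suc l))" using that by auto
    show ?thesis unfolding e(2) real_sqrt_abs by (subst e(1)) simp
  qed
  show "(real (u_seq (i - l)))\<^sup>2 < radicand l k y" if "real (u_seq i) < y"
    using l
  proof (induction l)
    case 0
    show ?case using that by (simp add: power_strict_mono)
  next
    case (Suc l)
    hence "real (u_seq (i - l)) < sqrt (radicand l k y)" by (intro real_less_rsqrt) auto
    thus ?case unfolding step ustep[OF Suc.prems] by simp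
  qed
  show "radicand l k y < (real (u_seq (i - l)))\<^sup>2" if "y < real (u_seq i)"
    using l
  proof (induction l)
    case 0
    show ?case using that y by (simp add: power_strict_mono)
  next
    case (Suc l)
    hence "sqrt (radicand l k y) < sqrt ((real (u_seq (i - l)))\<^sup>2)" by (intro real_sqrt_less_mono) auto
    thus ?case unfolding step ustep[OF Suc.prems] by simp
  qed
qed

lemma ex_square_diff:
  fixes c :: real
  assumes "c \<ge> 0"
  obtains y where "y \<ge> 1" "y\<^sup>2 - y = c"
proof -
  define y where "y = (1 + sqrt (1 + 4 * c)) / 2"
  have "sqrt (1 + 4 * c) \<ge> 1" using assms by simp
  moreover have "(sqrt (1 + 4 * c))\<^sup>2 = 1 + 4 * c" using assms by simp
  ultimately have "y \<ge> 1" "y\<^sup>2 - y = c"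
    by (simp_all add: y_def power2_eq_square field_simps)
  thus ?thesis using that by blast
qed

text \<open>Let x be the root for index i + 1 and y^2 - y = k - (i + 1). From N_(i+1) < k follows y
  > u_(i+1), so radicand i + 1 is positive at y and x < y. The next radicand is negative at x, where
  its inner root is 0, and positive at y. Its root is therefore larger than x, and there all earlier
  radicands are positive.\<close>

lemma radicand_root_exists:
  assumes "i \<le> j" "N_seq j < k"
  shows "\<exists>x\<ge>1. radicand (Suc i) k x = 0 \<and> (\<forall>l\<le>i. radicand l k x > 0)"
  using assms(1)
proof (induction i)
  case 0
  have "real k \<ge> 1" using assms(2) by linarith
  thus ?case by (intro exI[of _ "sqrt (real k)"]) auto
next
  case (Suc i)
  then obtain x where x: "x \<ge> 1" "radicand (Suc i) k x = 0" "\<And>l. l \<le> i \<Longrightarrow> radicand l k x > 0"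
    by auto
  have ij: "Suc i \<le> j" using Suc.prems by simp
  have Nk: "N_seq (Suc i) < k" using monoD[OF mono_N_seq ij] assms(2) by simp
  hence ik: "Suc i \<le> k" using le_N_seq[of "Suc i"] by simp
  obtain y where y: "y \<ge> 1" "y\<^sup>2 - y = real k - real (Suc i)"
    using ex_square_diff[of "real k - real (Suc i)"] ik by auto
  have u1: "real (u_seq (Suc i)) \<ge> 1" using u_seq_pos[of "Suc i"] by linarith
  have "(real (u_seq (Suc i)))\<^sup>2 - real (u_seq (Suc i)) = real (N_seq (Suc i)) - real (Suc i)"
    by (simp only: of_nat_N_seq)
  also have "\<dots> < y\<^sup>2 - y" using Nk y(2) by simp
  finally have "real (u_seq (Suc i)) < y" using square_diff_less_iff[OF u1 y(1)] by simp
  from radicand_compare(1)[of y k "Suc i" "Suc i", OF _ y(2) _ this] y(1)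
  have ry: "radicand (Suc i) k y > 0" by simp
  have xy: "x < y"
  proof (rule ccontr)
    assume "\<not> x < y"
    hence "y = x \<or> y < x" by auto
    thus False using radicand_strict_mono[of y x "Suc i" k] y(1) x(2) ry by (auto simp del: radicand.simps)
  qed
  have neg: "radicand (Suc (Suc i)) k x < 0"
    using square_diff_less_iff[OF x(1) y(1)] xy y(2) x(2) by (simp only: radicand.simps(2)[of "Suc i"]) simp
  have pos: "radicand (Suc (Suc i)) k y > 0"
    using y(2) ry by (simp only: radicand.simps(2)[of "Suc i"]) simp
  have "\<exists>w\<ge>x. w \<le> y \<and> radicand (Suc (Suc i)) k w = 0"
    by (rule IVT') (use neg pos xy in \<open>auto intro!: continuous_on_radicand simp del: radicand.simps\<close>)
  then obtain w where w: "x \<le> w" "w \<le> y" "radicand (Suc (Suc i)) k w = 0" by blast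
  have "w \<noteq> x" using w(3) neg by auto
  hence "x < w" using w(1) by simp
  hence lt: "radicand l k x < radicand l k w" for l
    using radicand_strict_mono[of x w l k] x(1) by simp
  have "radicand l k w > 0" if "l \<le> Suc i" for l
  proof (cases "l = Suc i")
    case True
    thus ?thesis using lt[of l] x(2) by simp
  next
    case False
    thus ?thesis using lt[of l] x(3)[of l] that by simp
  qed
  thus ?case using w x(1) by (intro exI[of _ w]) (auto simp del: radicand.simps)
qed

text \<open>The upper bound on k reverses the previous comparison: now y < x, so x^2 - x exceeds k -
  (j + 1). All later radicands have a positive polynomial part at x, and the chain of vanishing
  stops.\<close>

lemma radicand_root_between:
  assumes "N_seq j < k" "k < N_seq (Suc j)"
  obtains x where "x \<ge> 1" "radicand (Suc j) k x = 0" "\<And>l. l \<le> j \<Longrightarrow> radicand l k x > 0"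
    "\<And>l. Suc j < l \<Longrightarrow> radicand l k x > 0"
proof -
  obtain x where x: "x \<ge> 1" "radicand (Suc j) k x = 0" "\<And>l. l \<le> j \<Longrightarrow> radicand l k x > 0"
    using radicand_root_exists[of j j k] assms(1) by auto
  have jk: "Suc j \<le> k" using le_N_seq[of j] assms(1) by simp
  obtain y where y: "y \<ge> 1" "y\<^sup>2 - y = real k - real (Suc j)"
    using ex_square_diff[of "real k - real (Suc j)"] jk by auto
  have u1: "real (u_seq (Suc j)) \<ge> 1" using u_seq_pos[of "Suc j"] by linarith
  have "y\<^sup>2 - y < real (N_seq (Suc j)) - real (Suc j)" using assms(2) y(2) by simp
  also have "\<dots> = (real (u_seq (Suc j)))\<^sup>2 - real (u_seq (Suc j))"
    by (simp only: of_nat_N_seq)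
  finally have "y < real (u_seq (Suc j))" using square_diff_less_iff[OF y(1) u1] by simp
  from radicand_compare(2)[of y k "Suc j" "Suc j", OF _ y(2) _ this] y(1)
  have ry: "radicand (Suc j) k y < 0" by simp
  have yx: "y < x"
  proof (rule ccontr)
    assume "\<not> y < x"
    hence "x = y \<or> x < y" by auto
    thus False using radicand_strict_mono[of x y "Suc j" k] x(1,2) ry by (auto simp del: radicand.simps)
  qed
  have d: "x\<^sup>2 - x > real k - real (Suc j)" using square_diff_less_iff[OF y(1) x(1)] yx y(2) by simp
  have "radicand (Suc (Suc j + l)) k x > 0" for l
  proof (induction l)
    case 0
    show ?case using d x(2) by (simp only: radicand.simps(2)[of "Suc j + 0"]) simp
  next
    case (Suc l)
    hence "sqrt (radicand (Suc (Suc j + l)) k x) > 0" by (simp del: radicand.simps)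
    moreover have "real (Suc (Suc j + l)) \<ge> real (Suc j)" by simp
    ultimately have "radicand (Suc (Suc (Suc j + l))) k x > 0"
      using d unfolding radicand.simps(2)[of "Suc (Suc j + l)"] by linarith
    thus ?case by (simp only: add_Suc_right)
  qed
  hence later: "radicand l k x > 0" if "Suc j < l" for l
    using that less_imp_Suc_add[of "Suc j" l] by auto
  show ?thesis by (rule that[OF x later])
qed

text \<open>A smaller x is a larger z: the earlier square roots remain real a little beyond the
  singularity, so their series converge there.\<close>

lemma radicand_pos_nearby:
  assumes "x \<ge> 1" "\<And>l. l < i \<Longrightarrow> radicand l k x > 0"
  obtains y where "0 < y" "y < x" "\<And>l. l < i \<Longrightarrow> radicand l k y > 0"
proof -
  have "eventually (\<lambda>y. \<forall>l\<in>{..<i}. radicand l k y > 0) (at_left x)"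
  proof (rule eventually_ball_finite)
    show "\<forall>l\<in>{..<i}. eventually (\<lambda>y. radicand l k y > 0) (at_left x)"
    proof
      fix l assume l: "l \<in> {..<i}"
      have "isCont (radicand l k) x"
        using continuous_on_radicand[of UNIV l k] by (simp add: continuous_on_eq_continuous_at)
      hence "(radicand l k \<longlongrightarrow> radicand l k x) (at_left x)"
        unfolding isCont_def by (rule tendsto_within_subset) auto
      thus "eventually (\<lambda>y. radicand l k y > 0) (at_left x)"
        using assms(2)[of l] l by (auto dest: order_tendstoD)
    qed
  qed simp
  moreover have "eventually (\<lambda>y. 0 < y \<and> y < x) (at_left x)"
    using eventually_at_left_real[of 0 x] assms(1) by (auto elim: eventually_mono)
  ultimately have "eventually (\<lambda>y. (\<forall>l\<in>{..<i}. radicand l k y > 0) \<and> 0 < y \<and> y < x) (at_left x)"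
    by (rule eventually_conj)
  then obtain y where "(\<forall>l\<in>{..<i}. radicand l k y > 0) \<and> 0 < y \<and> y < x"
    using eventually_happens'[OF trivial_limit_at_left_real] by blast
  thus ?thesis using that by blast
qed

text \<open>Existence is all that is asked here; the value at a root is identified later from a
  one-sided difference quotient.\<close>

lemma R_differentiable:
  assumes "\<And>l. l < i \<Longrightarrow> R l k z > 0"
  shows "\<exists>D. (R i k has_real_derivative D) (at z)"
  using assms
proof (induction i)
  case 0
  have "R 0 k = (\<lambda>_. 1)" by auto
  thus ?case by (auto intro!: exI derivative_eq_intros)
next
  case (Suc i)
  then obtain D where D: "(R i k has_real_derivative D) (at z)" by auto
  have "R (Suc i) k = (\<lambda>z. 1 - 4 * (real k - real i) * z\<^sup>2 - 2 * z + 2 * z * sqrt (R i k z))"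
    by (rule ext) (rule R_Suc)
  moreover have "\<exists>D. ((\<lambda>z. 1 - 4 * (real k - real i) * z\<^sup>2 - 2 * z + 2 * z * sqrt (R i k z)) has_real_derivative D) (at z)"
    using Suc.prems[of i] by (intro exI) (rule derivative_eq_intros D refl | simp)+
  ultimately show ?case by simp
qed

section \<open>The generating functions at the dominant singularity\<close>

lemma triangle_sum_le_square:
  fixes a :: "nat \<Rightarrow> real"
  assumes "\<And>n. a n \<ge> 0"
  shows "(\<Sum>n<N. \<Sum>j\<le>n. a j * a (n - j)) \<le> (\<Sum>n<N. a n)\<^sup>2"
proof -
  have "(\<Sum>n<N. \<Sum>j\<le>n. a j * a (n - j)) = (\<Sum>(i,j)\<in>{(i,j). i + j < N}. a i * a j)"
    by (rule sum.triangle_reindex[symmetric])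
  also have "\<dots> \<le> (\<Sum>(i,j)\<in>{..<N} \<times> {..<N}. a i * a j)"
    using assms by (intro sum_mono2) auto
  also have "\<dots> = (\<Sum>n<N. a n)\<^sup>2"
    by (simp add: power2_eq_square sum_product sum.cartesian_product)
  finally show ?thesis .
qed

text \<open>Positivity replaces analytic arguments and covers the critical point as well. By the
  recursion, partial sums bounded by y have a successor bounded by X + \<open>\<rho>\<close> y^2 =
  y. So the series converges to some T \<le> y solving the same quadratic equation, and y is its
  smaller root.\<close>

lemma open_coeff_sums:
  assumes \<rho>: "\<rho> > 0" and "i \<le> Suc k" "\<And>l. l \<le> i \<Longrightarrow> R l k \<rho> \<ge> 0"
  shows "(\<lambda>n. open_coeff k i n * \<rho> ^ n) sums ((1 - sqrt (R i k \<rho>)) / (2 * \<rho>))"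
  using assms(2,3)
proof (induction i)
  case 0
  show ?case by simp
next
  case (Suc i)
  define S where "S = (1 - sqrt (R i k \<rho>)) / (2 * \<rho>)"
  define a where "a = (\<lambda>n. open_coeff k (Suc i) n * \<rho> ^ n)"
  define b where "b = (\<lambda>n. open_coeff k i n * \<rho> ^ n)"
  have b: "b sums S" using Suc unfolding b_def S_def by simp
  have a_nn: "a n \<ge> 0" and b_nn: "b n \<ge> 0" for n
    using \<rho> by (simp_all add: a_def b_def open_coeff_nonneg)
  have ik: "i \<le> k" using Suc.prems by simp
  have a0: "a 0 = 0" by (simp add: a_def)
  have a_Suc: "a (Suc n) = \<rho> * (if n = 0 then real k - real i else 0) + \<rho> * (\<Sum>j\<le>n. a j * a (n - j)) + \<rho> * b n" for n
  proof -
    have "(\<Sum>j\<le>n. a j * a (n - j)) = (\<Sum>j\<le>n. open_coeff k (Suc i) j * open_coeff k (Suc i) (n - j)) * \<rho> ^ n"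
      unfolding sum_distrib_right
    proof (rule sum.cong)
      fix j assume "j \<in> {..n}"
      hence "\<rho> ^ n = \<rho> ^ j * \<rho> ^ (n - j)" by (simp flip: power_add)
      thus "a j * a (n - j) = open_coeff k (Suc i) j * open_coeff k (Suc i) (n - j) * \<rho> ^ n"
        by (simp add: a_def)
    qed simp
    thus ?thesis by (simp add: a_def b_def open_coeff_Suc[OF ik] algebra_simps)
  qed
  define X where "X = \<rho> * (real k - real i) + \<rho> * S"
  have S_nn: "S \<ge> 0" using b b_nn by (metis sums_le sums_zero)
  have X_nn: "X \<ge> 0" using S_nn \<rho> ik by (simp add: X_def)
  define s where "s = sqrt (R (Suc i) k \<rho>)"
  have R_X: "R (Suc i) k \<rho> = 1 - 4 * \<rho> * X"
  proof -
    have "4 * \<rho> * (\<rho> * S) = 2 * \<rho> - 2 * \<rho> * sqrt (R i k \<rho>)" using \<rho> by (simp add: S_def field_simps)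
    thus ?thesis unfolding R_Suc X_def by (simp add: algebra_simps power2_eq_square)
  qed
  have s2: "s\<^sup>2 = 1 - 4 * \<rho> * X" using Suc.prems by (simp add: s_def R_X[symmetric])
  have s_nn: "s \<ge> 0" using Suc.prems by (simp add: s_def)
  have "s\<^sup>2 \<le> 1\<^sup>2" using s2 X_nn \<rho> by simp
  hence s1: "s \<le> 1" by (rule power2_le_imp_le) simp
  \<comment> \<open>The smaller root of y = X + \<open>\<rho>\<close> y^2; the discriminant of this
    equation is \<open>R (Suc i) k \<rho>\<close>.\<close>
  define y where "y = (1 - s) / (2 * \<rho>)"
  have y_nn: "y \<ge> 0" using s1 \<rho> by (simp add: y_def)
  have y_eq: "y = X + \<rho> * y\<^sup>2"
  proof -
    have "\<rho> * y\<^sup>2 = (1 - 2 * s + s\<^sup>2) / (4 * \<rho>)" using \<rho> by (simp add: y_def power2_eq_square field_simps)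
    also have "\<dots> = y - X" using \<rho> unfolding s2 y_def by (simp add: field_simps)
    finally show ?thesis by simp
  qed
  have partial: "(\<Sum>n<Suc N. a n) \<le> y" for N
  proof (induction N)
    case 0
    show ?case using a0 y_nn by simp
  next
    case (Suc N)
    have "(\<Sum>n<Suc (Suc N). a n) = (\<Sum>n<Suc N. a (Suc n))"
      using a0 by (subst sum.lessThan_Suc_shift) simp
    also have "\<dots> = \<rho> * (\<Sum>n<Suc N. if n = 0 then real k - real i else 0) +
        \<rho> * (\<Sum>n<Suc N. \<Sum>j\<le>n. a j * a (n - j)) + \<rho> * (\<Sum>n<Suc N. b n)"
      unfolding a_Suc sum.distrib sum_distrib_left ..
    also have "(\<Sum>n<Suc N. if n = 0 then real k - real i else 0) = real k - real i"
      by (subst sum.delta) auto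
    also have "(\<Sum>n<Suc N. \<Sum>j\<le>n. a j * a (n - j)) \<le> (\<Sum>n<Suc N. a n)\<^sup>2"
      by (rule triangle_sum_le_square[OF a_nn])
    also have "\<dots> \<le> y\<^sup>2" using Suc a_nn by (intro power_mono sum_nonneg) auto
    also have "(\<Sum>n<Suc N. b n) \<le> S"
      using sum_le_suminf[of b "{..<Suc N}"] b b_nn by (auto simp: sums_iff)
    finally have "(\<Sum>n<Suc (Suc N). a n) \<le> \<rho> * (real k - real i) + \<rho> * y\<^sup>2 + \<rho> * S"
      using \<rho> by simp
    thus ?case using y_eq by (simp add: X_def)
  qed
  have "summable a"
  proof (rule summableI_nonneg_bounded[OF a_nn])
    fix n show "(\<Sum>i<n. a i) \<le> y" using partial[of n] a_nn[of n] by simp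
  qed
  define T where "T = suminf a"
  have a_sums: "a sums T" using \<open>summable a\<close> by (simp add: T_def sums_iff)
  have T_le: "T \<le> y"
    unfolding T_def
  proof (rule suminf_le_const[OF \<open>summable a\<close>])
    fix n show "(\<Sum>i<n. a i) \<le> y" using partial[of n] a_nn[of n] by simp
  qed
  have "(\<lambda>n. a (Suc n)) sums T" using a_sums a0 by (subst sums_Suc_iff) simp
  moreover have "(\<lambda>n. a (Suc n)) sums (\<rho> * (real k - real i) + \<rho> * (T * T) + \<rho> * S)"
    unfolding a_Suc
  proof (intro sums_add sums_mult b)
    show "(\<lambda>n. if n = 0 then real k - real i else 0) sums (real k - real i)"
      using sums_single[of 0 "\<lambda>_. real k - real i"] by simp
    have "summable (\<lambda>n. norm (a n))" using \<open>summable a\<close> a_nn by simp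
    from Cauchy_product_sums[OF this this] show "(\<lambda>n. \<Sum>j\<le>n. a j * a (n - j)) sums (T * T)"
      by (simp add: T_def)
  qed
  ultimately have T_eq: "T = X + \<rho> * T\<^sup>2"
    using sums_unique2[of "\<lambda>n. a (Suc n)" T "\<rho> * (real k - real i) + \<rho> * (T * T) + \<rho> * S"]
    by (simp add: X_def power2_eq_square)
  have "T = y"
  proof (rule ccontr)
    assume "T \<noteq> y"
    hence "T < y" using T_le by simp
    \<comment> \<open>Two distinct roots have sum 1 / \<open>\<rho>\<close>, but T < y and 2
      \<open>\<rho>\<close> y = 1 - s \<le> 1.\<close>
    have "(y - T) * (1 - \<rho> * (T + y)) = 0" using T_eq y_eq by (simp add: power2_eq_square algebra_simps)
    hence "\<rho> * (T + y) = 1" using \<open>T \<noteq> y\<close> by simp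
    moreover have "\<rho> * (T + y) < \<rho> * (y + y)" using \<open>T < y\<close> \<rho> by simp
    moreover have "\<rho> * (y + y) = 1 - s" using \<rho> by (simp add: y_def field_simps)
    ultimately show False using s_nn by simp
  qed
  thus ?case using a_sums by (simp add: a_def y_def s_def)
qed

definition open_gf :: "nat \<Rightarrow> nat \<Rightarrow> complex fps" where
  "open_gf k i = Abs_fps (\<lambda>n. of_real (open_coeff k i n))"

lemma open_gf_rec:
  assumes "i \<le> k"
  shows "open_gf k (Suc i) =
     of_nat (k - i) * fps_X + fps_X * (open_gf k (Suc i))\<^sup>2 + fps_X * open_gf k i"
proof (rule fps_ext)
  fix n
  have nth: "fps_nth (open_gf k i) n = of_real (open_coeff k i n)" for i n
    by (simp add: open_gf_def)
  have sq: "fps_nth ((open_gf k (Suc i))\<^sup>2) l =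
      (\<Sum>j\<le>l. of_real (open_coeff k (Suc i) j) * of_real (open_coeff k (Suc i) (l - j)))" for l
    by (simp add: power2_eq_square fps_mult_nth atLeast0AtMost nth)
  show "fps_nth (open_gf k (Suc i)) n =
    fps_nth (of_nat (k - i) * fps_X + fps_X * (open_gf k (Suc i))\<^sup>2 + fps_X * open_gf k i) n"
    using assms
    by (cases n) (simp_all add: nth sq open_coeff_Suc fps_of_nat[symmetric] of_nat_diff)
qed

text \<open>The dilated series \<open>1 - 2 \<rho> z L(\<rho> z)\<close>, a square root of \<open>R\<^bsub>i,k\<^esub>(\<rho> z)\<close>.\<close>

definition sqrt_gf :: "nat \<Rightarrow> real \<Rightarrow> nat \<Rightarrow> complex fps" where
  "sqrt_gf k \<rho> i = fps_dilate (of_real \<rho>) (1 - fps_const 2 * fps_X * open_gf k i)"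

lemma sqrt_gf_nth_0 [simp]: "fps_nth (sqrt_gf k \<rho> i) 0 = 1"
  by (simp add: sqrt_gf_def mult.assoc)

lemma sqrt_gf_nth_Suc: "fps_nth (sqrt_gf k \<rho> i) (Suc n) = of_real (- 2 * \<rho> * (open_coeff k i n * \<rho> ^ n))"
  by (simp add: sqrt_gf_def open_gf_def mult.assoc)

lemma sqrt_gf_square:
  assumes "i \<le> k"
  shows "(sqrt_gf k \<rho> (Suc i))\<^sup>2 = 1 - fps_const (of_real (4 * (real k - real i) * \<rho>\<^sup>2)) * fps_X ^ 2
     - fps_const (of_real (2 * \<rho>)) * fps_X + fps_const (of_real (2 * \<rho>)) * (fps_X * sqrt_gf k \<rho> i)"
proof -
  define X :: "complex fps" where "X = fps_X"
  define m where "m = real k - real i"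
  have m: "of_nat (k - i) = fps_const (complex_of_real m)"
    using assms by (simp add: m_def fps_of_nat[symmetric] of_nat_diff)
  define G where "G = open_gf k (Suc i)"
  have rec: "G = fps_const (of_real m) * X + X * G\<^sup>2 + X * open_gf k i"
    using open_gf_rec[OF assms] by (simp only: m G_def X_def)
  have "(1 - fps_const 2 * X * G)\<^sup>2 = 1 - fps_const 4 * X * (G - X * G\<^sup>2)"
    by (simp add: power2_eq_square algebra_simps flip: fps_numeral_fps_const)
  also have "G - X * G\<^sup>2 = fps_const (of_real m) * X + X * open_gf k i" using rec by (simp add: algebra_simps)
  also have "1 - fps_const 4 * X * (fps_const (of_real m) * X + X * open_gf k i) =
    1 - fps_const (of_real (4 * m)) * X\<^sup>2 - fps_const 2 * X + fps_const 2 * (X * (1 - fps_const 2 * X * open_gf k i))"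
    by (simp add: power2_eq_square algebra_simps flip: fps_numeral_fps_const fps_const_mult)
  finally have *: "(1 - fps_const 2 * X * G)\<^sup>2 = \<dots>" .
  have dX: "fps_dilate (of_real \<rho>) X = fps_const (of_real \<rho>) * X"
    unfolding X_def by (rule fps_ext) (auto simp: le_Suc_eq)
  have dC: "fps_dilate (of_real \<rho>) (fps_const c) = fps_const c" for c
    by (rule fps_ext) simp
  have dm: "fps_dilate (of_real \<rho>) (f - g) = fps_dilate (of_real \<rho>) f - fps_dilate (of_real \<rho>) g" for f g
    by (rule fps_ext) (simp add: algebra_simps)
  have "(sqrt_gf k \<rho> (Suc i))\<^sup>2 = fps_dilate (of_real \<rho>) ((1 - fps_const 2 * X * G)\<^sup>2)"
    by (simp add: sqrt_gf_def X_def G_def fps_dilate_power)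
  also have "\<dots> = 1 - fps_const (of_real (4 * m)) * (fps_const (of_real \<rho>) * X)\<^sup>2 - fps_const 2 * (fps_const (of_real \<rho>) * X)
    + fps_const 2 * (fps_const (of_real \<rho>) * X * sqrt_gf k \<rho> i)"
    unfolding * sqrt_gf_def
    by (simp only: dX[unfolded X_def] dC dm fps_dilate_add fps_dilate_mult fps_dilate_power fps_dilate_1 X_def)
  also have "\<dots> = 1 - fps_const (of_real (4 * m * \<rho>\<^sup>2)) * X ^ 2
     - fps_const (of_real (2 * \<rho>)) * X + fps_const (of_real (2 * \<rho>)) * (X * sqrt_gf k \<rho> i)"
    by (simp add: power2_eq_square mult_ac flip: fps_const_mult)
  finally show ?thesis by (simp only: m_def X_def)
qed

lemma sqrt_gf_sums:
  assumes "\<rho> > 0" "i \<le> Suc k" "\<And>l. l \<le> i \<Longrightarrow> R l k \<rho> \<ge> 0"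
  shows "abs_conv (sqrt_gf k \<rho> i)" "eval_fps (sqrt_gf k \<rho> i) 1 = of_real (sqrt (R i k \<rho>))"
proof -
  have s: "(\<lambda>n. open_coeff k i n * \<rho> ^ n) sums ((1 - sqrt (R i k \<rho>)) / (2 * \<rho>))"
    by (rule open_coeff_sums[OF assms])
  hence "summable (\<lambda>n. 2 * \<rho> * (open_coeff k i n * \<rho> ^ n))"
    by (intro summable_mult) (rule sums_summable)
  moreover have "norm (fps_nth (sqrt_gf k \<rho> i) (Suc n)) = 2 * \<rho> * (open_coeff k i n * \<rho> ^ n)" for n
    unfolding sqrt_gf_nth_Suc norm_of_real using assms(1) open_coeff_nonneg[of k i n] by (simp add: abs_mult)
  ultimately show "abs_conv (sqrt_gf k \<rho> i)"
    unfolding abs_conv_def by (subst summable_Suc_iff[symmetric]) simp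
  have "(\<lambda>n. fps_nth (sqrt_gf k \<rho> i) (Suc n)) sums of_real (- 2 * \<rho> * ((1 - sqrt (R i k \<rho>)) / (2 * \<rho>)))"
    unfolding sqrt_gf_nth_Suc by (intro sums_of_real sums_mult s)
  hence "(\<lambda>n. fps_nth (sqrt_gf k \<rho> i) n) sums (of_real (- 2 * \<rho> * ((1 - sqrt (R i k \<rho>)) / (2 * \<rho>))) + 1)"
    by (subst (asm) sums_Suc_iff) simp
  also have "- 2 * \<rho> * ((1 - sqrt (R i k \<rho>)) / (2 * \<rho>)) = sqrt (R i k \<rho>) - 1"
    using assms(1) by (simp add: field_simps)
  finally show "eval_fps (sqrt_gf k \<rho> i) 1 = of_real (sqrt (R i k \<rho>))"
    by (simp add: eval_fps_def sums_iff)
qed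

lemma sqrt_gf_eval_dilate:
  "eval_fps (sqrt_gf k \<rho> i) (of_real t) = eval_fps (sqrt_gf k (\<rho> * t) i) 1"
  unfolding eval_fps_def sqrt_gf_def
  by (rule suminf_cong) (simp add: power_mult_distrib)

text \<open>The coefficients of 1 - R_(i+1)(\<open>\<rho>\<close> z). The linear terms cancel
  because \<open>sqrt_gf\<close> has constant term 1, and the minus sign in front of its other
  coefficients makes everything nonnegative. The shift by 2 combines the factor z before the root
  with the one inside it.\<close>

definition radicand_tail :: "nat \<Rightarrow> real \<Rightarrow> nat \<Rightarrow> nat \<Rightarrow> real" where
  "radicand_tail k \<rho> i n = (if n = 2 then 4 * (real k - real i) * \<rho>\<^sup>2 else 0) +
     (if n \<ge> 2 then 4 * \<rho> ^ n * open_coeff k i (n - 2) else 0)"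

lemma sqrt_gf_square_nth:
  assumes "i \<le> k"
  shows "fps_nth (1 - (sqrt_gf k \<rho> (Suc i))\<^sup>2) n = of_real (radicand_tail k \<rho> i n)"
proof -
  have "n = 0 \<or> n = 1 \<or> (\<exists>m. n = Suc (Suc m))" by presburger
  then consider "n = 0" | "n = 1" | m where "n = Suc (Suc m)" by blast
  thus ?thesis
  proof cases
    case 3
    thus ?thesis
      unfolding sqrt_gf_square[OF assms]
      by (auto simp: radicand_tail_def sqrt_gf_nth_Suc fps_X_power_iff)
  qed (auto simp: sqrt_gf_square[OF assms] radicand_tail_def)
qed

lemma radicand_tail_nonneg: "i \<le> k \<Longrightarrow> \<rho> > 0 \<Longrightarrow> radicand_tail k \<rho> i n \<ge> 0"
  by (auto simp: radicand_tail_def open_coeff_nonneg intro!: add_nonneg_nonneg)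

text \<open>The exponents 3 and 5 are coprime, which makes \<open>z = 1\<close> the only zero of a vanishing radicand on
  the closed unit disc.\<close>

lemma radicand_tail_pos:
  assumes "1 \<le> i" "i \<le> k" "\<rho> > 0"
  shows "radicand_tail k \<rho> i 3 > 0" "radicand_tail k \<rho> i 5 > 0"
proof -
  obtain j where j: "i = Suc j" using assms(1) by (cases i) auto
  \<comment> \<open>A single leaf yields exponent 3, and a binary node with two leaves yields
    exponent 5.\<close>
  have c1: "open_coeff k i 1 = real k - real j"
    using open_coeff_Suc[of j k 0] assms j by simp
  hence c1p: "open_coeff k i 1 > 0" using assms j by simp
  have "open_coeff k i 3 = (\<Sum>m\<le>2. open_coeff k i m * open_coeff k i (2 - m)) + open_coeff k j 2"
    using open_coeff_Suc[of j k 2] assms j by (simp add: numeral_3_eq_3 numeral_2_eq_2)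
  also have "\<dots> \<ge> open_coeff k i 1 * open_coeff k i 1"
    by (simp add: numeral_2_eq_2 open_coeff_nonneg)
  finally have "open_coeff k i 1 * open_coeff k i 1 \<le> open_coeff k i 3" .
  moreover have "open_coeff k i 1 * open_coeff k i 1 > 0" using c1p by (rule mult_pos_pos) fact
  ultimately have "open_coeff k i 3 > 0" by linarith
  thus "radicand_tail k \<rho> i 3 > 0" "radicand_tail k \<rho> i 5 > 0"
    using c1p assms(3) by (simp_all add: radicand_tail_def)
qed

lemma sqrt_gf_square_eval:
  assumes "\<rho> > 0" "i \<le> Suc k" "\<And>l. l \<le> i \<Longrightarrow> R l k \<rho> \<ge> 0"
  shows "abs_conv ((sqrt_gf k \<rho> i)\<^sup>2)" "eval_fps ((sqrt_gf k \<rho> i)\<^sup>2) 1 = of_real (R i k \<rho>)"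
proof -
  show "abs_conv ((sqrt_gf k \<rho> i)\<^sup>2)"
    unfolding power2_eq_square by (intro abs_conv_mult sqrt_gf_sums(1)[OF assms])
  have "eval_fps ((sqrt_gf k \<rho> i)\<^sup>2) 1 = eval_fps (sqrt_gf k \<rho> i) 1 * eval_fps (sqrt_gf k \<rho> i) 1"
    unfolding power2_eq_square by (rule eval_fps_mult_disc) (use sqrt_gf_sums(1)[OF assms] in auto)
  also have "\<dots> = of_real (sqrt (R i k \<rho>) * sqrt (R i k \<rho>))"
    by (simp only: sqrt_gf_sums(2)[OF assms] of_real_mult)
  also have "sqrt (R i k \<rho>) * sqrt (R i k \<rho>) = R i k \<rho>" using assms by simp
  finally show "eval_fps ((sqrt_gf k \<rho> i)\<^sup>2) 1 = of_real (R i k \<rho>)" .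
qed

lemma radicand_tail_sums:
  assumes \<rho>: "\<rho> > 0" and ik: "i \<le> k" and nn: "\<And>l. l \<le> Suc i \<Longrightarrow> R l k \<rho> \<ge> 0"
  shows "radicand_tail k \<rho> i sums (1 - R (Suc i) k \<rho>)"
proof -
  let ?f = "(sqrt_gf k \<rho> (Suc i))\<^sup>2"
  have f: "abs_conv ?f" "eval_fps ?f 1 = of_real (R (Suc i) k \<rho>)"
    by (rule sqrt_gf_square_eval; use \<rho> ik nn in simp)+
  have nth: "fps_nth ?f n = fps_nth 1 n - of_real (radicand_tail k \<rho> i n)" for n
    using sqrt_gf_square_nth[OF ik, of \<rho> n] by (simp add: algebra_simps)
  have "(\<lambda>n. fps_nth ?f n) sums of_real (R (Suc i) k \<rho>)"
    using abs_conv_summable(2)[OF f(1), of 1] f(2) by (simp add: eval_fps_def sums_iff)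
  moreover have "(\<lambda>n. fps_nth (1 :: complex fps) n) sums 1"
    using sums_single[of 0 "\<lambda>_. 1::complex"] by simp
  ultimately have "(\<lambda>n. fps_nth 1 n - fps_nth ?f n) sums (1 - of_real (R (Suc i) k \<rho>))"
    by (intro sums_diff)
  hence "(\<lambda>n. complex_of_real (radicand_tail k \<rho> i n)) sums of_real (1 - R (Suc i) k \<rho>)"
    by (simp add: nth)
  thus ?thesis by (simp only: sums_of_real_iff)
qed

text \<open>A zero means that a series with nonnegative coefficients of sum 1 -
  R(\<open>\<rho>\<close>) \<le> 1 takes the value 1 in the disc. This forces
  R(\<open>\<rho>\<close>) = 0 and z^n = 1 for all occurring exponents. For i = 0 only the exponent
  2 can occur and -1 may be a second zero, hence \<open>1 \<le> i\<close> in the vanishing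
  case.\<close>

lemma sqrt_gf_square_nonzero:
  assumes \<rho>: "\<rho> > 0" and ik: "i \<le> k" and nn: "\<And>l. l \<le> Suc i \<Longrightarrow> R l k \<rho> \<ge> 0"
    and z: "norm z \<le> 1" and *: "R (Suc i) k \<rho> > 0 \<or> (1 \<le> i \<and> z \<noteq> 1)"
  shows "eval_fps ((sqrt_gf k \<rho> (Suc i))\<^sup>2) z \<noteq> 0"
proof
  let ?f = "(sqrt_gf k \<rho> (Suc i))\<^sup>2"
  let ?w = "1 - ?f"
  assume 0: "eval_fps ?f z = 0"
  have f: "abs_conv ?f"
    by (rule sqrt_gf_square_eval) (use \<rho> ik nn in auto)
  have sums: "radicand_tail k \<rho> i sums (1 - R (Suc i) k \<rho>)"
    by (rule radicand_tail_sums[OF \<rho> ik nn])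
  have nth: "fps_nth ?w n = of_real (radicand_tail k \<rho> i n)" for n
    by (rule sqrt_gf_square_nth[OF ik])
  have x: "radicand_tail k \<rho> i n \<ge> 0" for n by (rule radicand_tail_nonneg[OF ik \<rho>])
  have w: "abs_conv ?w"
    using sums_summable[OF sums] x unfolding abs_conv_def nth norm_of_real by simp
  have "eval_fps ?w z + eval_fps ?f z = eval_fps (?w + ?f) z"
    by (rule eval_fps_add_disc[symmetric, OF w f z])
  hence w1: "eval_fps ?w z = 1" using 0 by simp
  note facts = nth x sums_summable[OF sums]
  have suminf: "suminf (radicand_tail k \<rho> i) = 1 - R (Suc i) k \<rho>" using sums by (simp add: sums_iff)
  have le: "suminf (radicand_tail k \<rho> i) \<le> 1" using suminf nn[of "Suc i"] by simp
  have imp: "z ^ n = 1 \<and> suminf (radicand_tail k \<rho> i) = 1" if "radicand_tail k \<rho> i n > 0" for n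
    by (rule eval_nonneg_eq_1_imp[OF facts le z w1 that])
  show False
  proof (cases "\<exists>n. radicand_tail k \<rho> i n > 0")
    case True
    hence "R (Suc i) k \<rho> = 0" using imp suminf by auto
    hence "1 \<le> i" "z \<noteq> 1" using * by auto
    hence "z ^ 3 = 1" "z ^ 5 = 1" using imp radicand_tail_pos[OF _ ik \<rho>] by blast+
    moreover have "z ^ 5 * z = z ^ 3 * z ^ 3" by (simp flip: power_Suc2 power_add)
    ultimately show False using \<open>z \<noteq> 1\<close> by simp
  next
    case False
    hence "\<not> radicand_tail k \<rho> i n > 0" for n by blast
    hence "radicand_tail k \<rho> i n = 0" for n using x[of n] by (simp add: not_less order_antisym)
    hence "?w = 0" by (intro fps_ext) (simp add: nth del: fps_sub_nth)
    thus False using w1 by simp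
  qed
qed

text \<open>In the new radicand only the nested root contributes to the asymptotics, with factor 2
  \<open>\<rho>\<close>; the square root then divides by twice its own value at the
  singularity.\<close>

lemma sqrt_gf_step:
  assumes \<rho>: "\<rho> > 0" and ik: "i \<le> k" and nn: "\<And>l. l \<le> Suc i \<Longrightarrow> R l k \<rho> \<ge> 0"
    and pos: "R (Suc i) k \<rho> > 0" and lim: "coeff_lim p (sqrt_gf k \<rho> i) c" and p: "p > 1"
  shows "coeff_lim p (sqrt_gf k \<rho> (Suc i)) (of_real (\<rho> / sqrt (R (Suc i) k \<rho>)) * c)"
proof -
  let ?f = "(sqrt_gf k \<rho> (Suc i))\<^sup>2"
  let ?P = "1 - fps_const (complex_of_real (4 * (real k - real i) * \<rho>\<^sup>2)) * fps_X ^ 2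
     - fps_const (of_real (2 * \<rho>)) * fps_X"
  have "coeff_decay (p + 1) ?P"
    by (rule coeff_decay_finite[of 3]) (simp add: fps_X_power_iff)
  hence "coeff_lim p ?P 0" by (rule coeff_decay_imp_lim_0) simp
  moreover have "coeff_lim p (fps_const (of_real (2 * \<rho>)) * (fps_X * sqrt_gf k \<rho> i)) (of_real (2 * \<rho>) * c)"
    by (intro coeff_lim_cmult) (simp add: coeff_lim_X_mult lim)
  ultimately have "coeff_lim p (?P + fps_const (of_real (2 * \<rho>)) * (fps_X * sqrt_gf k \<rho> i)) (0 + of_real (2 * \<rho>) * c)"
    by (rule coeff_lim_add)
  hence "coeff_lim p ?f (of_real (2 * \<rho>) * c)" by (simp add: sqrt_gf_square[OF ik])
  hence "coeff_lim p (sqrt_gf k \<rho> (Suc i)) (of_real (2 * \<rho>) * c / (2 * eval_fps (sqrt_gf k \<rho> (Suc i)) 1))"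
  proof (rule coeff_lim_sqrt[OF refl _ p])
    show "eval_fps ?f z \<noteq> 0" if "norm z \<le> 1" for z
      by (rule sqrt_gf_square_nonzero[OF \<rho> ik nn that]) (use pos in auto)
    show "fps_conv_radius (sqrt_gf k \<rho> (Suc i)) \<ge> 1"
      by (intro abs_conv_conv_radius sqrt_gf_sums(1)) (use \<rho> ik nn in auto)
  qed
  moreover have "eval_fps (sqrt_gf k \<rho> (Suc i)) 1 = of_real (sqrt (R (Suc i) k \<rho>))"
    by (rule sqrt_gf_sums(2)) (use \<rho> ik nn in auto)
  ultimately show ?thesis by (simp add: mult_ac)
qed

text \<open>Division by 1 - z forms partial sums. As the full sum is 0, these are negated tails and
  stay geometrically small.\<close>

lemma divide_one_minus_geometric:
  fixes f :: "complex fps"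
  assumes r: "0 < r" "r < 1" and f: "\<And>n. norm (fps_nth f n) \<le> C * r ^ n" "eval_fps f 1 = 0"
  shows "norm (fps_nth (f * one_minus_pow (-1)) n) \<le> C * r / (1 - r) * r ^ n"
proof -
  have sm: "summable (\<lambda>n. C * r ^ n)" using r by (intro summable_mult summable_geometric) auto
  have smn: "summable (\<lambda>n. norm (fps_nth f n))"
    by (rule summable_comparison_test'[OF sm, of 0]) (use f in auto)
  hence smf: "summable (fps_nth f)" by (rule summable_norm_cancel)
  have "fps_nth (f * one_minus_pow (-1)) n = (\<Sum>k<Suc n. fps_nth f k)"
    by (simp add: fps_mult_nth one_minus_pow_minus_1 atLeast0AtMost lessThan_Suc_atMost)
  also have "\<dots> = - (\<Sum>k. fps_nth f (k + Suc n))"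
    using suminf_split_initial_segment[OF smf, of "Suc n"] f(2) by (simp add: eval_fps_def eq_neg_iff_add_eq_0 add.commute)
  finally have "norm (fps_nth (f * one_minus_pow (-1)) n) = norm (\<Sum>k. fps_nth f (k + Suc n))" by simp
  also have "\<dots> \<le> (\<Sum>k. norm (fps_nth f (k + Suc n)))"
    by (rule summable_norm) (rule summable_ignore_initial_segment[OF smn])
  also have "\<dots> \<le> (\<Sum>k. C * r ^ Suc n * r ^ k)"
  proof (rule suminf_le)
    show "norm (fps_nth f (k + Suc n)) \<le> C * r ^ Suc n * r ^ k" for k
      using f(1)[of "k + Suc n"] by (simp add: power_add mult_ac)
    show "summable (\<lambda>k. C * r ^ Suc n * r ^ k)" using r by (intro summable_mult summable_geometric) auto
  qed (rule summable_ignore_initial_segment[OF smn])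
  also have "\<dots> = C * r ^ Suc n * (1 / (1 - r))"
    using r by (subst suminf_mult) (auto simp: suminf_geometric intro: summable_geometric)
  finally show ?thesis by (simp add: mult_ac)
qed

text \<open>The radicand with index i + 1 involves only the series of index i, which still converges
  at \<open>\<rho>'\<close>; so its coefficients gain the ratio
  \<open>\<rho> / \<rho>'\<close>.\<close>

lemma sqrt_gf_square_geometric:
  assumes \<rho>: "0 < \<rho>" "\<rho> < \<rho>'" and ik: "i \<le> k" and nn: "\<And>l. l \<le> i \<Longrightarrow> R l k \<rho>' \<ge> 0"
  obtains C where "\<And>n. norm (fps_nth ((sqrt_gf k \<rho> (Suc i))\<^sup>2) n) \<le> C * (\<rho> / \<rho>') ^ n"
proof -
  define S where "S = (\<Sum>n. open_coeff k i n * \<rho>' ^ n)"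
  define r where "r = \<rho> / \<rho>'"
  have r: "0 < r" "\<rho> = r * \<rho>'" using \<rho> by (auto simp: r_def)
  have sm: "summable (\<lambda>n. open_coeff k i n * \<rho>' ^ n)"
    using open_coeff_sums[of \<rho>' i k] \<rho> ik nn by (auto simp: sums_iff)
  have le_S: "open_coeff k i n * \<rho>' ^ n \<le> S" for n
    unfolding S_def using sum_le_suminf[OF sm, of "{n}"] \<rho> by (simp add: open_coeff_nonneg)
  have S: "S \<ge> 0" using le_S[of 0] by simp
  have tail: "radicand_tail k \<rho> i n \<le> (4 * (real k - real i) * \<rho>'\<^sup>2 + 4 * S * \<rho>'\<^sup>2) * r ^ n" for n
  proof -
    have "(if n = 2 then 4 * (real k - real i) * \<rho>\<^sup>2 else 0) \<le> 4 * (real k - real i) * \<rho>'\<^sup>2 * r ^ n"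
      using ik r by (auto simp: power_mult_distrib)
    moreover have "(if n \<ge> 2 then 4 * \<rho> ^ n * open_coeff k i (n - 2) else 0) \<le> 4 * S * \<rho>'\<^sup>2 * r ^ n"
    proof (cases "n \<ge> 2")
      case True
      then obtain m where m: "n = m + 2" by (metis le_add_diff_inverse2)
      have "4 * \<rho> ^ n * open_coeff k i (n - 2) = 4 * \<rho>'\<^sup>2 * r ^ n * (open_coeff k i m * \<rho>' ^ m)"
        by (simp add: m r(2) power_mult_distrib power_add power2_eq_square mult_ac)
      also have "\<dots> \<le> 4 * \<rho>'\<^sup>2 * r ^ n * S" using r(1) by (intro mult_left_mono le_S) auto
      finally show ?thesis using True by (simp add: mult_ac)
    qed (use S r in auto)
    ultimately show ?thesis by (simp add: radicand_tail_def algebra_simps)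
  qed
  have "norm (fps_nth ((sqrt_gf k \<rho> (Suc i))\<^sup>2) n) \<le>
     (1 + (4 * (real k - real i) * \<rho>'\<^sup>2 + 4 * S * \<rho>'\<^sup>2)) * r ^ n" for n
  proof -
    have "fps_nth ((sqrt_gf k \<rho> (Suc i))\<^sup>2) n = fps_nth 1 n - of_real (radicand_tail k \<rho> i n)"
      using sqrt_gf_square_nth[OF ik, of \<rho> n] by (simp add: algebra_simps)
    hence "norm (fps_nth ((sqrt_gf k \<rho> (Suc i))\<^sup>2) n) \<le> norm (fps_nth (1 :: complex fps) n) + radicand_tail k \<rho> i n"
      using norm_triangle_ineq4[of "fps_nth (1 :: complex fps) n" "of_real (radicand_tail k \<rho> i n)"]
        radicand_tail_nonneg[OF ik \<rho>(1), of n] by simp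
    also have "norm (fps_nth (1 :: complex fps) n) \<le> r ^ n" using r by simp
    finally show ?thesis using tail[of n] by (simp add: algebra_simps)
  qed
  thus ?thesis unfolding r_def by (rule that)
qed

text \<open>The quotient \<open>q = R / (1 - z)\<close> has geometrically decaying coefficients, since the earlier radicands
  stay nonnegative up to \<open>\<rho>' > \<rho>\<close>.\<close>

lemma sqrt_gf_first_critical:
  assumes \<rho>: "0 < \<rho>" "\<rho> < \<rho>'" and ik: "1 \<le> i" "i \<le> k"
    and nn': "\<And>l. l \<le> i \<Longrightarrow> R l k \<rho>' \<ge> 0" and nn: "\<And>l. l \<le> i \<Longrightarrow> R l k \<rho> \<ge> 0"
    and zero: "R (Suc i) k \<rho> = 0" and t: "1 < t"
  obtains e Q where "sqrt_gf k \<rho> (Suc i) = one_minus_pow (1/2) * e"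
    "coeff_decay t e" "eval_fps (e\<^sup>2) 1 = of_real Q" "Q > 0"
proof -
  let ?h = "sqrt_gf k \<rho> (Suc i)"
  define q where "q = ?h\<^sup>2 * one_minus_pow (-1)"
  have nn2: "R l k \<rho> \<ge> 0" if "l \<le> Suc i" for l using nn[of l] zero that by (cases "l = Suc i") auto
  obtain C where C: "\<And>n. norm (fps_nth (?h\<^sup>2) n) \<le> C * (\<rho> / \<rho>') ^ n"
    using sqrt_gf_square_geometric[OF \<rho> ik(2) nn'] by blast
  have r: "0 < \<rho> / \<rho>'" "\<rho> / \<rho>' < 1" using \<rho> by auto
  have h1: "eval_fps (?h\<^sup>2) 1 = 0"
    using sqrt_gf_square_eval(2)[of \<rho> "Suc i" k] \<rho> ik nn2 zero by simp
  have decq: "coeff_decay (t + 1) q"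
    unfolding q_def by (rule coeff_decay_geometric[OF r divide_one_minus_geometric[OF r C h1]])
  have acq: "abs_conv q" by (rule coeff_decay_imp_abs_conv[OF decq]) (use t in simp)
  have sums: "radicand_tail k \<rho> i sums 1"
    using radicand_tail_sums[OF \<rho>(1) ik(2) nn2] zero by simp
  \<comment> \<open>These coefficients are tails of a nonnegative series with sum 1, hence
    nonnegative, and the first one is 1. This gives Q > 0 without computing a derivative.\<close>
  have q_nth: "fps_nth q n = of_real (1 - (\<Sum>m\<le>n. radicand_tail k \<rho> i m))" for n
  proof -
    have "fps_nth q n = (\<Sum>m\<le>n. fps_nth (?h\<^sup>2) m)"
      by (simp add: q_def fps_mult_nth one_minus_pow_minus_1 atLeast0AtMost)
    also have "\<dots> = (\<Sum>m\<le>n. fps_nth 1 m - of_real (radicand_tail k \<rho> i m))"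
      using sqrt_gf_square_nth[OF ik(2), of \<rho>] by (intro sum.cong) (auto simp: algebra_simps)
    also have "\<dots> = of_real (1 - (\<Sum>m\<le>n. radicand_tail k \<rho> i m))"
      by (simp add: sum_subtractf)
    finally show ?thesis .
  qed
  have q_nn: "1 - (\<Sum>m\<le>n. radicand_tail k \<rho> i m) \<ge> 0" for n
    using sum_le_suminf[OF sums_summable[OF sums], of "{..n}"] sums radicand_tail_nonneg[OF ik(2) \<rho>(1)]
    by (simp add: sums_iff)
  define Q where "Q = (\<Sum>n. 1 - (\<Sum>m\<le>n. radicand_tail k \<rho> i m))"
  have smq: "summable (\<lambda>n. 1 - (\<Sum>m\<le>n. radicand_tail k \<rho> i m))"
    using acq q_nn unfolding abs_conv_def q_nth norm_of_real by simp
  have "1 - (\<Sum>m\<le>0. radicand_tail k \<rho> i m) \<le> Q"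
    unfolding Q_def using sum_le_suminf[OF smq, of "{0}"] q_nn by simp
  hence Q: "Q > 0" by (simp add: radicand_tail_def)
  have q1: "eval_fps q 1 = of_real Q"
    unfolding eval_fps_def Q_def q_nth by (simp add: suminf_of_real[OF smq])
  have inv: "one_minus_pow 1 * one_minus_pow (-1) = 1"
    using one_minus_pow_add[of 1 "-1"] by (simp add: one_minus_pow_0)
  obtain e where e: "?h = one_minus_pow (1/2) * e" "e\<^sup>2 = q" "coeff_decay t e"
  proof (rule critical_sqrt[OF decq t, of ?h "1/2"])
    show "?h\<^sup>2 = one_minus_pow (2 * (1/2)) * q"
      using inv by (simp add: q_def mult.left_commute)
    show "abs_conv ?h" by (rule sqrt_gf_sums) (use \<rho> ik nn2 in auto)
    show "eval_fps (?h\<^sup>2) z \<noteq> 0" if "norm z \<le> 1" "z \<noteq> 1" for z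
      by (rule sqrt_gf_square_nonzero[OF \<rho>(1) ik(2) nn2 that(1)]) (use ik that in auto)
  qed (use q1 Q in auto)
  show ?thesis by (rule that[OF e(1) e(3) _ Q]) (use e(2) q1 in simp)
qed

text \<open>For 0 < t < 1 the quotient R(\<open>\<rho>\<close> t) / (1 - t) is q(t), which tends to
  q(1) = Q by continuity on the closed disc. Since R is differentiable at \<open>\<rho>\<close>,
  this one-sided limit determines the derivative.\<close>

lemma deriv_R_at_root:
  assumes \<rho>: "0 < \<rho>" and ik: "i \<le> k"
    and nn: "\<And>t l. 0 < t \<Longrightarrow> t < 1 \<Longrightarrow> l \<le> Suc i \<Longrightarrow> R l k (\<rho> * t) \<ge> 0"
    and pos: "\<And>l. l \<le> i \<Longrightarrow> R l k \<rho> > 0" and zero: "R (Suc i) k \<rho> = 0"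
    and q: "(sqrt_gf k \<rho> (Suc i))\<^sup>2 = one_minus_pow 1 * q" "abs_conv q" "eval_fps q 1 = of_real Q"
  shows "deriv (R (Suc i) k) \<rho> = - Q / \<rho>"
proof -
  let ?h = "sqrt_gf k \<rho> (Suc i)"
  obtain D where D: "(R (Suc i) k has_real_derivative D) (at \<rho>)"
    using R_differentiable[of "Suc i" k \<rho>] pos by auto
  have ach: "abs_conv ?h"
    by (rule sqrt_gf_sums(1)) (use \<rho> ik pos zero in \<open>auto simp: le_Suc_eq intro: less_imp_le\<close>)
  have val: "eval_fps q (of_real t) = of_real (- ((R (Suc i) k (\<rho> * t) - R (Suc i) k (\<rho> * 1)) / (t - 1)))"
    if t: "0 < t" "t < 1" for t
  proof -
    have n1: "norm (complex_of_real t) \<le> 1" using t by simp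
    have "eval_fps ?h (of_real t) = of_real (sqrt (R (Suc i) k (\<rho> * t)))"
      unfolding sqrt_gf_eval_dilate
      by (rule sqrt_gf_sums(2)) (use \<rho> t ik nn in auto)
    hence "eval_fps (?h\<^sup>2) (of_real t) = of_real (sqrt (R (Suc i) k (\<rho> * t)) * sqrt (R (Suc i) k (\<rho> * t)))"
      unfolding power2_eq_square eval_fps_mult_disc[OF ach ach n1] by (simp only: of_real_mult)
    also have "sqrt (R (Suc i) k (\<rho> * t)) * sqrt (R (Suc i) k (\<rho> * t)) = R (Suc i) k (\<rho> * t)"
      using nn[OF t, of "Suc i"] by simp
    finally have "of_real (R (Suc i) k (\<rho> * t)) = eval_fps (one_minus_pow 1 * q) (of_real t)"
      by (simp only: q(1))
    also have "\<dots> = eval_fps (one_minus_pow 1) (of_real t) * eval_fps q (of_real t)"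
      by (rule eval_fps_mult_disc[OF abs_conv_one_minus_pow q(2) n1]) simp
    also have "eval_fps (one_minus_pow 1) (of_real t) = 1 - complex_of_real t"
      unfolding one_minus_pow_1 by (subst eval_fps_diff) auto
    finally have "eval_fps q (of_real t) = of_real (R (Suc i) k (\<rho> * t)) / (1 - of_real t)"
      using t by (simp add: field_simps flip: of_real_diff)
    also have "\<dots> = of_real (R (Suc i) k (\<rho> * t) / (1 - t))" by simp
    also have "R (Suc i) k (\<rho> * t) / (1 - t) = - ((R (Suc i) k (\<rho> * t) - R (Suc i) k (\<rho> * 1)) / (t - 1))"
      using t zero by (simp add: field_simps)
    finally show ?thesis .
  qed
  have ev01: "eventually (\<lambda>t::real. 0 < t \<and> t < 1) (at_left 1)"
    using eventually_at_left_real[of 0 "1::real"] by (auto elim: eventually_mono)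
  have "((\<lambda>t. eval_fps q (of_real t)) \<longlongrightarrow> eval_fps q (of_real 1)) (at_left (1::real))"
  proof (rule continuous_on_tendsto_compose[OF continuous_on_eval_fps_disc[OF q(2)]])
    show "((\<lambda>t. complex_of_real t) \<longlongrightarrow> of_real 1) (at_left 1)" by (intro tendsto_intros)
    show "eventually (\<lambda>t. complex_of_real t \<in> cball 0 1) (at_left 1)"
      using ev01 by eventually_elim simp
  qed simp
  hence "((\<lambda>t. eval_fps q (of_real t)) \<longlongrightarrow> of_real Q) (at_left (1::real))" by (simp add: q(3))
  moreover have "eventually (\<lambda>t. eval_fps q (of_real t) =
      of_real (- ((R (Suc i) k (\<rho> * t) - R (Suc i) k (\<rho> * 1)) / (t - 1)))) (at_left 1)"
    using ev01 by eventually_elim (use val in auto)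
  ultimately have l1: "((\<lambda>t. complex_of_real (- ((R (Suc i) k (\<rho> * t) - R (Suc i) k (\<rho> * 1)) / (t - 1)))) \<longlongrightarrow> of_real Q) (at_left 1)"
    by (rule Lim_transform_eventually)
  have "((\<lambda>t. R (Suc i) k (\<rho> * t)) has_real_derivative D * \<rho>) (at 1)"
    by (rule DERIV_chain2[of "R (Suc i) k"]) (use D in \<open>auto intro!: derivative_eq_intros\<close>)
  hence "((\<lambda>t. (R (Suc i) k (\<rho> * t) - R (Suc i) k (\<rho> * 1)) / (t - 1)) \<longlongrightarrow> D * \<rho>) (at 1)"
    by (simp add: has_field_derivative_iff)
  hence "((\<lambda>t. (R (Suc i) k (\<rho> * t) - R (Suc i) k (\<rho> * 1)) / (t - 1)) \<longlongrightarrow> D * \<rho>) (at_left 1)"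
    by (rule tendsto_within_subset) auto
  hence "((\<lambda>t. complex_of_real (- ((R (Suc i) k (\<rho> * t) - R (Suc i) k (\<rho> * 1)) / (t - 1)))) \<longlongrightarrow> of_real (- (D * \<rho>))) (at_left 1)"
    by (intro tendsto_of_real tendsto_minus)
  with l1 have "complex_of_real Q = of_real (- (D * \<rho>))"
    by (intro tendsto_unique[of "at_left (1::real)"]) (auto simp: trivial_limit_at_left_real)
  hence "Q = - (D * \<rho>)" by (simp only: of_real_eq_iff)
  hence "D = - Q / \<rho>" using \<rho> by (simp add: field_simps)
  thus ?thesis using DERIV_imp_deriv[OF D] by simp
qed

lemma sqrt_gf_iterate:
  assumes \<rho>: "\<rho> > 0" and nn: "\<And>l. l \<le> i \<Longrightarrow> R l k \<rho> \<ge> 0" and pos: "\<And>l. i < l \<Longrightarrow> R l k \<rho> > 0"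
    and lim: "coeff_lim p (sqrt_gf k \<rho> i) c" and p: "p > 1" and m: "i + m \<le> Suc k"
  shows "coeff_lim p (sqrt_gf k \<rho> (i + m)) (of_real (\<Prod>l=1..m. \<rho> / sqrt (R (i + l) k \<rho>)) * c)"
  using m
proof (induction m)
  case 0
  show ?case using lim by simp
next
  case (Suc m)
  have nn': "R l k \<rho> \<ge> 0" for l using nn[of l] pos[of l] by (cases "l \<le> i") auto
  have "coeff_lim p (sqrt_gf k \<rho> (Suc (i + m)))
     (of_real (\<rho> / sqrt (R (Suc (i + m)) k \<rho>)) * (of_real (\<Prod>l=1..m. \<rho> / sqrt (R (i + l) k \<rho>)) * c))"
    by (rule sqrt_gf_step[OF \<rho> _ nn' pos Suc.IH p]) (use Suc.prems in auto)
  thus ?case by (simp add: mult_ac)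
qed

text \<open>The outermost root is 1 - 2 \<open>\<rho>\<close> z H(\<open>\<rho>\<close> z), and the
  index shift by z leaves the limit unchanged. Counting makes the limit real and nonnegative, which
  later selects the right fourth root.\<close>

lemma H_le_limit:
  assumes \<rho>: "\<rho> > 0" and lim: "coeff_lim p (sqrt_gf k \<rho> (Suc k)) c"
  obtains L where "(\<lambda>n. real n powr p * (\<rho> ^ n * fps_nth (H_le k) n)) \<longlonglongrightarrow> L"
    "L \<ge> 0" "complex_of_real L = - c / of_real (2 * \<rho>)"
proof -
  define f where "f = (\<lambda>n. real n powr p * (\<rho> ^ n * fps_nth (H_le k) n))"
  have "(\<lambda>n. of_real (real n powr p) * fps_nth (sqrt_gf k \<rho> (Suc k)) (Suc n)) \<longlonglongrightarrow> c"
    using lim unfolding coeff_lim_def by (subst coeff_lim_shift_iff)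
  hence "(\<lambda>n. of_real (real n powr p) * fps_nth (sqrt_gf k \<rho> (Suc k)) (Suc n) / of_real (- 2 * \<rho>)) \<longlonglongrightarrow> c / of_real (- 2 * \<rho>)"
    using \<rho> by (intro tendsto_divide tendsto_const) auto
  moreover have "of_real (real n powr p) * fps_nth (sqrt_gf k \<rho> (Suc k)) (Suc n) / of_real (- 2 * \<rho>) = complex_of_real (f n)" for n
    using \<rho> by (simp add: f_def sqrt_gf_nth_Suc H_le_open_coeff mult_ac)
  ultimately have l: "(\<lambda>n. complex_of_real (f n)) \<longlonglongrightarrow> - c / of_real (2 * \<rho>)" by simp
  define L where "L = Re (- c / of_real (2 * \<rho>))"
  have lR: "f \<longlonglongrightarrow> L" using tendsto_Re[OF l] by (simp add: L_def)
  have "complex_of_real L = - c / of_real (2 * \<rho>)"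
    by (rule LIMSEQ_unique[OF tendsto_of_real[OF lR] l])
  moreover have "L \<ge> 0"
    by (rule LIMSEQ_le_const[OF lR])
       (use \<rho> in \<open>auto simp: f_def H_le_open_coeff open_coeff_nonneg intro!: exI[of _ 0]\<close>)
  ultimately show ?thesis using that lR by (simp add: f_def)
qed

section \<open>The two cases of the theorem\<close>

lemma asymptotic_toI:
  assumes \<rho>: "\<rho> > 0" and L: "L \<noteq> 0" and lim: "(\<lambda>n. real n powr p * (\<rho> ^ n * a n)) \<longlonglongrightarrow> L"
  shows "asymptotic_to a (\<lambda>n. L * real n powr (-p) * \<rho> powi (- int n))"
  unfolding asymptotic_to_def
proof (rule Lim_transform_eventually)
  show "(\<lambda>n. real n powr p * (\<rho> ^ n * a n) / L) \<longlonglongrightarrow> 1"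
    using tendsto_divide[OF lim tendsto_const L] L by simp
  show "eventually (\<lambda>n. real n powr p * (\<rho> ^ n * a n) / L = a n / (L * real n powr (-p) * \<rho> powi (- int n))) sequentially"
    using eventually_gt_at_top[of 0]
    by eventually_elim (use \<rho> L in \<open>simp add: powr_minus power_int_minus field_simps\<close>)
qed

lemma sqrt_prod: "sqrt (\<Prod>x\<in>A. f x) = (\<Prod>x\<in>A. sqrt (f x))"
  by (induction A rule: infinite_finite_induct) (auto simp: real_sqrt_mult)

lemma rGamma_minus_half: "rGamma (-1/2 :: real) \<noteq> 0"
  using rGamma_plus1[of "-1/2 :: real"] Gamma_one_half_real by (auto simp: rGamma_inverse_Gamma)

lemma rGamma_minus_quarter: "rGamma (-1/4 :: real) = - 1 / (4 * Gamma (3/4))"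
  using rGamma_plus1[of "-1/4 :: real"] by (simp add: rGamma_inverse_Gamma field_simps)

lemma asymptotic_non_critical:
  assumes "N_seq j < k" "k < N_seq (Suc j)"
  shows "\<exists>h::real. asymptotic_to (fps_nth (H_le k))
         (\<lambda>n. h * real n powr (-3/2) * sigma_root (Suc j) k powi (- int n))"
proof -
  \<comment> \<open>For j = 0 there is no such k, since N_0 = 0 and N_1 = 1.\<close>
  have j1: "1 \<le> j" using assms by (cases j) (auto simp: N_seq_def)
  have jk: "j \<le> k" using le_N_seq[of j] assms(1) by simp
  obtain x where x: "x \<ge> 1" "radicand (Suc j) k x = 0" "\<And>l. l \<le> j \<Longrightarrow> radicand l k x > 0"
    "\<And>l. Suc j < l \<Longrightarrow> radicand l k x > 0"
    using radicand_root_between[OF assms] by blast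
  obtain y where y: "0 < y" "y < x" "\<And>l. l < Suc j \<Longrightarrow> radicand l k y > 0"
    using radicand_pos_nearby[of x "Suc j" k] x by (auto simp del: radicand.simps)
  define \<rho> where "\<rho> = 1 / (2 * x)"
  define \<rho>' where "\<rho>' = 1 / (2 * y)"
  have \<rho>: "0 < \<rho>" "\<rho> < \<rho>'" using x(1) y by (auto simp: \<rho>_def \<rho>'_def field_simps)
  have R1: "R l k \<rho> = radicand l k x / x\<^sup>2" for l
    unfolding \<rho>_def by (rule R_eq_radicand) (use x in simp)
  have R2: "R l k \<rho>' = radicand l k y / y\<^sup>2" for l
    unfolding \<rho>'_def by (rule R_eq_radicand[OF y(1)])
  have pos: "R l k \<rho> > 0" if "l \<noteq> Suc j" for l
    unfolding R1 using x(1) x(3)[of l] x(4)[of l] that by (cases "l \<le> j") auto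
  have zero: "R (Suc j) k \<rho> = 0" unfolding R1 x(2) by simp
  have nn: "R l k \<rho> \<ge> 0" for l using pos[of l] zero by (cases "l = Suc j") auto
  have nn': "R l k \<rho>' \<ge> 0" if "l \<le> j" for l
    unfolding R2 using y(3)[of l] that by simp
  have \<sigma>: "sigma_root (Suc j) k = \<rho>"
    unfolding \<rho>_def by (rule sigma_root_eq[OF _ x(2)]) (use x in \<open>auto intro: less_imp_le\<close>)
  obtain e Q where e: "sqrt_gf k \<rho> (Suc j) = one_minus_pow (1/2) * e" "coeff_decay 2 e"
    "eval_fps (e\<^sup>2) 1 = of_real Q" "Q > 0"
    using sqrt_gf_first_critical[OF \<rho> j1 jk nn' nn zero, of 2] by auto
  have ace: "abs_conv e" by (rule coeff_decay_imp_abs_conv[OF e(2)]) simp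
  have "eval_fps e 1 * eval_fps e 1 = of_real Q"
    using eval_fps_mult_disc[OF ace ace, of 1] e(3) by (simp add: power2_eq_square)
  hence e1: "eval_fps e 1 \<noteq> 0" using e(4) by auto
  have "coeff_lim (3/2) (one_minus_pow (1/2)) (of_real (rGamma (-1/2)))"
    using coeff_lim_one_minus_pow[of "1/2"] by simp
  hence "coeff_lim (3/2) (one_minus_pow (1/2) * e) (of_real (rGamma (-1/2)) * eval_fps e 1)"
    by (rule coeff_lim_mult[OF _ e(2)]) auto
  hence l0: "coeff_lim (3/2) (sqrt_gf k \<rho> (Suc j)) (of_real (rGamma (-1/2)) * eval_fps e 1)"
    by (simp only: e(1))
  define P where "P = (\<Prod>l=1..k - j. \<rho> / sqrt (R (Suc j + l) k \<rho>))"
  have "R (Suc (j + l)) k \<rho> > 0" if "l \<ge> 1" for l using pos[of "Suc (j + l)"] that by simp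
  hence P: "P \<noteq> 0" unfolding P_def using \<rho> by (auto simp: less_imp_neq[symmetric] simp del: R.simps)
  have "coeff_lim (3/2) (sqrt_gf k \<rho> (Suc j + (k - j))) (of_real P * (of_real (rGamma (-1/2)) * eval_fps e 1))"
    unfolding P_def by (rule sqrt_gf_iterate[OF \<rho>(1) nn pos l0]) (use jk in auto)
  hence lim: "coeff_lim (3/2) (sqrt_gf k \<rho> (Suc k)) (of_real P * (of_real (rGamma (-1/2)) * eval_fps e 1))"
    using jk by simp
  obtain L where L: "(\<lambda>n. real n powr (3/2) * (\<rho> ^ n * fps_nth (H_le k) n)) \<longlonglongrightarrow> L"
    "complex_of_real L = - (of_real P * (of_real (rGamma (-1/2)) * eval_fps e 1)) / of_real (2 * \<rho>)"
    using H_le_limit[OF \<rho>(1) lim] by blast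
  have "L \<noteq> 0"
  proof
    assume "L = 0"
    thus False using L(2) P e1 rGamma_minus_half \<rho> by simp
  qed
  from asymptotic_toI[OF \<rho>(1) this L(1)] show ?thesis
    unfolding \<sigma> by (intro exI[of _ L]) simp
qed

text \<open>The exponent 3/2 is dictated by j = 1, where e is (1 + z)^(1/2). It leaves room above
  the 5/4 required for the second vanishing root.\<close>

lemma critical_first_factor:
  assumes j: "j \<ge> 1" and \<rho>: "\<rho> = 1 / (2 * real (u_seq j))"
  obtains e Q where "sqrt_gf (N_seq j) \<rho> j = one_minus_pow (1/2) * e"
    "coeff_decay (3/2) e" "eval_fps (e\<^sup>2) 1 = of_real Q" "Q > 0"
proof (cases "j = 1")
  case True
  \<comment> \<open>Here the radicand is \<open>1 - z\<^sup>2\<close>, with a second zero at \<open>-1\<close>.\<close>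
  have N1: "N_seq j = 1" and \<rho>1: "\<rho> = 1 / 2" by (simp_all add: True N_seq_def \<rho>)
  define e where "e = fps_binomial (1/2 :: complex)"
  have e2: "e\<^sup>2 = 1 + fps_X" by (simp add: e_def fps_binomial_power fps_binomial_1)
  have g0: "sqrt_gf (Suc 0) (1/2) 0 = 1"
    by (rule fps_ext) (simp add: sqrt_gf_def open_gf_def mult.assoc)
  have "(sqrt_gf (Suc 0) (1/2) (Suc 0))\<^sup>2 = (1 - fps_X) * (1 + fps_X)"
    by (subst sqrt_gf_square) (simp_all add: g0 power2_eq_square algebra_simps)
  also have "1 - fps_X = (one_minus_pow (1/2))\<^sup>2"
    using one_minus_pow_add[of "1/2" "1/2"] by (simp add: one_minus_pow_1 power2_eq_square)
  finally have "(sqrt_gf (Suc 0) (1/2) (Suc 0))\<^sup>2 = (one_minus_pow (1/2) * e)\<^sup>2"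
    by (simp add: power_mult_distrib e2)
  hence eq: "sqrt_gf (Suc 0) (1/2) (Suc 0) = one_minus_pow (1/2) * e"
    by (rule fps_sqrt_unique) (simp_all add: e_def)
  have dec: "coeff_decay (3/2) e"
    using coeff_decay_one_minus_pow[of "1/2"]
    by (simp add: coeff_decay_def one_minus_pow_def e_def norm_mult norm_power)
  have "eval_fps (1 + fps_X) 1 = (2 :: complex)"
    by (subst eval_fps_add) auto
  hence ev: "eval_fps (e\<^sup>2) 1 = of_real 2" by (simp add: e2)
  have "sqrt_gf (N_seq j) \<rho> j = one_minus_pow (1/2) * e"
    unfolding N1 \<rho>1 using eq True by simp
  thus ?thesis by (rule that[OF _ dec ev]) simp
next
  case False
  define k where "k = N_seq j"
  define i where "i = j - 1"
  have ij: "j = Suc i" "1 \<le> i" using j False by (auto simp: i_def)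
  have ik: "i \<le> k" using le_N_seq[of j] ij by (simp add: k_def)
  define x where "x = real (u_seq j)"
  have x: "x \<ge> 1" using u_seq_pos[of j] j by (simp add: x_def)
  have val: "radicand l k x = (real (u_seq (j - l)))\<^sup>2" if "l \<le> j" for l
    unfolding k_def x_def by (rule radicand_at_N_seq[OF that])
  have zero: "radicand j k x = 0" using val[of j] by simp
  have pos: "radicand l k x > 0" if "l < j" for l
    using val[of l] u_seq_pos[of "j - l"] that by simp
  obtain y where y: "0 < y" "y < x" "\<And>l. l < j \<Longrightarrow> radicand l k y > 0"
    using radicand_pos_nearby[of x j k] x pos by blast
  define \<rho>' where "\<rho>' = 1 / (2 * y)"
  have \<rho>x: "\<rho> = 1 / (2 * x)" by (simp add: \<rho> x_def)
  have \<rho>\<rho>': "0 < \<rho>" "\<rho> < \<rho>'" using x y by (auto simp: \<rho>x \<rho>'_def field_simps)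
  have R1: "R l k \<rho> = radicand l k x / x\<^sup>2" for l
    unfolding \<rho>x by (rule R_eq_radicand) (use x in simp)
  have R2: "R l k \<rho>' = radicand l k y / y\<^sup>2" for l
    unfolding \<rho>'_def by (rule R_eq_radicand[OF y(1)])
  have nn: "R l k \<rho> \<ge> 0" if "l \<le> i" for l unfolding R1 using pos[of l] that ij by simp
  have nn': "R l k \<rho>' \<ge> 0" if "l \<le> i" for l unfolding R2 using y(3)[of l] that ij by simp
  have z: "R (Suc i) k \<rho> = 0" unfolding R1 using zero ij by simp
  obtain e Q where e: "sqrt_gf k \<rho> (Suc i) = one_minus_pow (1/2) * e" "coeff_decay (3/2) e"
    "eval_fps (e\<^sup>2) 1 = of_real Q" "Q > 0"
    using sqrt_gf_first_critical[OF \<rho>\<rho>' ij(2) ik nn' nn z, of "3/2"] by auto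
  show ?thesis by (rule that[of e Q]) (use e in \<open>simp_all add: k_def ij\<close>)
qed

text \<open>At \<open>k = N\<^sub>j\<close> the radicand with index \<open>j + 1\<close> vanishes as well: it equals \<open>(1 - z)\<^bsup>1/2\<^esup> g(z)\<close>.\<close>

lemma critical_second_factor:
  assumes j: "j \<ge> 1" and \<rho>: "\<rho> = 1 / (2 * real (u_seq j))"
    and e: "sqrt_gf (N_seq j) \<rho> j = one_minus_pow (1/2) * e"
    "coeff_decay (3/2) e" "eval_fps (e\<^sup>2) 1 = of_real Q" "Q > 0"
  obtains v where "coeff_lim (5/4) (sqrt_gf (N_seq j) \<rho> (Suc j)) (of_real (rGamma (-1/4)) * v)"
    "v ^ 4 = of_real (4 * \<rho>\<^sup>2 * Q)"
proof -
  define k where "k = N_seq j"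
  have jk: "j \<le> k" by (simp add: k_def le_N_seq)
  define x where "x = real (u_seq j)"
  have x: "x \<ge> 1" using u_seq_pos[of j] j by (simp add: x_def)
  have \<rho>x: "\<rho> = 1 / (2 * x)" by (simp add: \<rho> x_def)
  have \<rho>0: "\<rho> > 0" using x by (simp add: \<rho>x)
  have R1: "R l k \<rho> = radicand l k x / x\<^sup>2" for l
    unfolding \<rho>x by (rule R_eq_radicand) (use x in simp)
  have nn: "R l k \<rho> \<ge> 0" if "l \<le> Suc j" for l
  proof (cases "l \<le> j")
    case True
    thus ?thesis unfolding R1 unfolding k_def x_def radicand_at_N_seq[OF True] by simp
  next
    case False
    hence "l = Suc j" using that by simp
    thus ?thesis unfolding R1 unfolding k_def x_def
      using radicand_N_seq_lambda[of j 0] by (simp del: radicand.simps)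
  qed
  \<comment> \<open>With this a, the polynomial 1 - a z^2 - 2 \<open>\<rho>\<close> z has the root 1
    and factors as (1 - z) (1 + a z), because k - j = x^2 - x gives a = 1 - 2
    \<open>\<rho>\<close>.\<close>
  define a where "a = 4 * (real k - real j) * \<rho>\<^sup>2"
  have a: "2 * \<rho> = 1 - a"
  proof -
    have "real k - real j = x\<^sup>2 - x" by (simp add: k_def x_def of_nat_N_seq)
    thus ?thesis using x by (simp add: a_def \<rho>x field_simps power2_eq_square)
  qed
  have half: "one_minus_pow (1/2) * one_minus_pow (1/2) = 1 - fps_X"
    using one_minus_pow_add[of "1/2" "1/2"] by (simp add: one_minus_pow_1)
  define b where "b = one_minus_pow (1/2)"
  \<comment> \<open>The polynomial part contains b^2 and the nested root contains b once, so b = (1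
    - z)^(1/2) can be taken out of the radicand. At 1 only the second summand of g survives.\<close>
  define g where "g = b * (1 + fps_const (of_real a) * fps_X) + fps_const (of_real (2 * \<rho>)) * (fps_X * e)"
  let ?h = "sqrt_gf k \<rho> (Suc j)"
  have hsq: "?h\<^sup>2 = one_minus_pow (2 * (1/4)) * g"
  proof -
    have "?h\<^sup>2 = 1 - fps_const (of_real a) * fps_X ^ 2 - fps_const (of_real (2 * \<rho>)) * fps_X
         + fps_const (of_real (2 * \<rho>)) * (fps_X * (b * e))"
      using sqrt_gf_square[OF jk, of \<rho>] e(1) by (simp add: k_def a_def b_def)
    also have "1 - fps_const (of_real a) * fps_X ^ 2 - fps_const (of_real (2 * \<rho>)) * fps_X
       = (1 - fps_X) * (1 + fps_const (complex_of_real a) * fps_X)"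
      unfolding a by (simp add: power2_eq_square algebra_simps flip: fps_const_sub)
    also have "1 - fps_X = b * b" using half by (simp add: b_def)
    finally show ?thesis by (simp add: g_def b_def algebra_simps)
  qed
  have decb: "coeff_decay (3/2) b" using coeff_decay_one_minus_pow[of "1/2"] by (simp add: b_def)
  have const: "coeff_decay (3/2) (fps_const c)" for c
    by (rule coeff_decay_finite[of 1]) simp
  have dp: "coeff_decay (3/2) (1 + fps_const (complex_of_real a) * fps_X)" "coeff_decay (3/2) (fps_const (complex_of_real (2 * \<rho>)))"
      "coeff_decay (3/2) (fps_X :: complex fps)"
    by (rule const | rule coeff_decay_finite[of 2], simp)+
  have decg: "coeff_decay (3/2) g" unfolding g_def
    by (intro coeff_decay_add coeff_decay_mult decb dp e(2)) auto
  have ac: "abs_conv f" if "coeff_decay (3/2) f" for f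
    by (rule coeff_decay_imp_abs_conv[OF that]) simp
  have ev_mult: "eval_fps (f * h) 1 = eval_fps f 1 * eval_fps h 1" if "coeff_decay (3/2) f" "coeff_decay (3/2) h" for f h
    by (rule eval_fps_mult_disc) (use ac that in auto)
  have "eval_fps b 1 * eval_fps b 1 = eval_fps (1 - fps_X) (1::complex)"
    using half ev_mult[OF decb decb] by (simp add: b_def)
  also have "\<dots> = 0" by (subst eval_fps_diff) auto
  finally have b1: "eval_fps b 1 = 0" by simp
  have g1: "eval_fps g 1 = of_real (2 * \<rho>) * eval_fps e 1"
  proof -
    have "eval_fps g 1 = eval_fps (b * (1 + fps_const (of_real a) * fps_X)) 1 + eval_fps (fps_const (of_real (2 * \<rho>)) * (fps_X * e)) 1"
      unfolding g_def
      by (rule eval_fps_add_disc) (auto intro!: ac coeff_decay_mult decb dp(1,3) const e(2))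
    also have "eval_fps (b * (1 + fps_const (of_real a) * fps_X)) 1 = 0"
      by (simp add: ev_mult[OF decb dp(1)] b1)
    also have "eval_fps (fps_const (of_real (2 * \<rho>)) * (fps_X * e)) 1 = of_real (2 * \<rho>) * eval_fps e 1"
      using ev_mult[OF dp(2) coeff_decay_mult[OF dp(3) e(2)]] ev_mult[OF dp(3) e(2)]
      by (simp only: eval_fps_const eval_fps_X mult_1)
    finally show ?thesis by simp
  qed
  have e1: "(eval_fps e 1)\<^sup>2 = of_real Q"
    using ev_mult[OF e(2) e(2)] e(3) by (simp add: power2_eq_square)
  hence e1nz: "eval_fps e 1 \<noteq> 0" using e(4) by auto
  \<comment> \<open>11/8 lies between 5/4, to be exceeded in the final product, and 3/2, the decay
    of g, of which the square root loses a little.\<close>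
  obtain v where v: "?h = one_minus_pow (1/4) * v" "v\<^sup>2 = g" "coeff_decay (11/8) v"
  proof (rule critical_sqrt[OF decg, of "11/8" ?h "1/4"])
    show "?h\<^sup>2 = one_minus_pow (2 * (1/4)) * g" by (rule hsq)
    show "abs_conv ?h" by (rule sqrt_gf_sums) (use \<rho>0 jk nn in auto)
    show "eval_fps (?h\<^sup>2) z \<noteq> 0" if "norm z \<le> 1" "z \<noteq> 1" for z
      by (rule sqrt_gf_square_nonzero[OF \<rho>0 jk nn that(1)]) (use j that in auto)
    show "eval_fps g 1 \<noteq> 0" using g1 e1nz \<rho>0 by simp
  qed auto
  have acv: "abs_conv v" by (rule coeff_decay_imp_abs_conv[OF v(3)]) simp
  have v2: "(eval_fps v 1)\<^sup>2 = of_real (2 * \<rho>) * eval_fps e 1"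
    using eval_fps_mult_disc[OF acv acv, of 1] v(2) g1 by (simp add: power2_eq_square)
  \<comment> \<open>Only the square of the value of e at 1 is known, so the value of v is determined
    up to a fourth root of unity.\<close>
  have "(eval_fps v 1) ^ 4 = ((eval_fps v 1)\<^sup>2)\<^sup>2" by simp
  also have "\<dots> = of_real (4 * \<rho>\<^sup>2 * Q)" unfolding v2 power_mult_distrib e1 by simp
  finally have v4: "(eval_fps v 1) ^ 4 = of_real (4 * \<rho>\<^sup>2 * Q)" .
  have "coeff_lim (5/4) (one_minus_pow (1/4)) (of_real (rGamma (-1/4)))"
    using coeff_lim_one_minus_pow[of "1/4"] by simp
  hence "coeff_lim (5/4) (one_minus_pow (1/4) * v) (of_real (rGamma (-1/4)) * eval_fps v 1)"
    by (rule coeff_lim_mult[OF _ v(3)]) auto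
  thus ?thesis using that v4 by (simp add: v(1) k_def[symmetric])
qed

text \<open>The constant is assembled from Q = \<open>\<rho>\<close> times
  \<open>gamma_const j\<close>, v^4 = 4 \<open>\<rho>\<close>^2 Q, rGamma (-1/4) = -1 / (4 Gamma
  (3/4)) and the factors of the radicands after index j + 1.\<close>

lemma asymptotic_critical:
  assumes j: "j \<ge> 1" and k: "k = N_seq j"
  shows "sigma_root j k = 1 / (2 * real (u_seq j))"
    and "asymptotic_to (fps_nth (H_le k))
         (\<lambda>n. h_const j * real n powr (-5/4) * sigma_root j k powi (- int n))"
proof -
  define x where "x = real (u_seq j)"
  have x: "x \<ge> 1" using u_seq_pos[of j] j by (simp add: x_def)
  define \<rho> where "\<rho> = 1 / (2 * x)"
  have \<rho>0: "\<rho> > 0" using x by (simp add: \<rho>_def)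
  have \<rho>': "\<rho> = 1 / (2 * real (u_seq j))" by (simp add: \<rho>_def x_def)
  have jk: "j \<le> k" by (simp add: k le_N_seq)
  have val: "radicand l k x = (real (u_seq (j - l)))\<^sup>2" if "l \<le> j" for l
    unfolding k x_def by (rule radicand_at_N_seq[OF that])
  have val': "radicand (Suc j + l) k x = lambda_seq l" for l
    unfolding k x_def by (rule radicand_N_seq_lambda)
  have zero: "radicand j k x = 0" using val[of j] by simp
  show \<sigma>: "sigma_root j k = 1 / (2 * real (u_seq j))"
    unfolding x_def[symmetric] by (rule sigma_root_eq[OF _ zero]) (use x val in auto)
  have R1: "R l k (1 / (2 * y)) = radicand l k y / y\<^sup>2" if "y > 0" for l y
    by (rule R_eq_radicand[OF that])
  have R_rho: "R l k \<rho> = radicand l k x / x\<^sup>2" for l unfolding \<rho>_def by (rule R1) (use x in simp)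
  have nn: "R l k \<rho> \<ge> 0" if "l \<le> j" for l using val[OF that] by (simp add: R_rho)
  have R_lambda: "R (Suc j + l) k \<rho> = lambda_seq l / x\<^sup>2" for l by (simp only: R_rho val')
  obtain e Q where e: "sqrt_gf (N_seq j) \<rho> j = one_minus_pow (1/2) * e"
    "coeff_decay (3/2) e" "eval_fps (e\<^sup>2) 1 = of_real Q" "Q > 0"
    using critical_first_factor[OF j \<rho>'] by blast
  have gamma: "gamma_const j = Q / \<rho>"
  proof -
    define i where "i = j - 1"
    have ij: "j = Suc i" using j by (simp add: i_def)
    have "deriv (R (Suc i) k) \<rho> = - Q / \<rho>"
    proof (rule deriv_R_at_root[OF \<rho>0, where q = "e\<^sup>2"])
      show "R l k (\<rho> * t) \<ge> 0" if "0 < t" "t < 1" "l \<le> Suc i" for t l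
      proof -
        \<comment> \<open>Moving from \<open>\<rho>\<close> towards 0 means enlarging x, where the
          radicands are larger.\<close>
        have eq: "\<rho> * t = 1 / (2 * (x / t))" using x by (simp add: \<rho>_def)
        have "x < x / t" using x that by (simp add: field_simps)
        hence "radicand l k x < radicand l k (x / t)" using x by (intro radicand_strict_mono) auto
        hence "radicand l k (x / t) \<ge> 0" using val[of l] that ij by (simp add: order_trans[OF zero_le_power2 less_imp_le])
        thus ?thesis unfolding eq using x that by (subst R1) auto
      qed
      show "R l k \<rho> > 0" if "l \<le> i" for l
        using val[of l] u_seq_pos[of "j - l"] that ij x by (simp add: R_rho)
      show "R (Suc i) k \<rho> = 0" using zero ij by (simp add: R_rho)
      show "(sqrt_gf k \<rho> (Suc i))\<^sup>2 = one_minus_pow 1 * e\<^sup>2"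
        using e(1) one_minus_pow_add[of "1/2" "1/2"] ij k by (simp add: power_mult_distrib power2_eq_square)
      show "abs_conv (e\<^sup>2)"
        unfolding power2_eq_square by (intro abs_conv_mult coeff_decay_imp_abs_conv[OF e(2)]) auto
    qed (use e ij jk in auto)
    thus ?thesis
      unfolding gamma_const_def k[symmetric] \<sigma> \<rho>'[symmetric] ij[symmetric] by simp
  qed
  obtain v where v: "coeff_lim (5/4) (sqrt_gf k \<rho> (Suc j)) (of_real (rGamma (-1/4)) * v)"
    "v ^ 4 = of_real (4 * \<rho>\<^sup>2 * Q)"
    using critical_second_factor[OF j \<rho>' e] k by blast
  have pos: "R l k \<rho> > 0" if "Suc j < l" for l
  proof -
    define m where "m = l - Suc (Suc j)"
    have "l = Suc j + Suc m" using that by (simp add: m_def)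
    hence "R l k \<rho> = lambda_seq (Suc m) / x\<^sup>2" by (simp only: R_lambda)
    thus ?thesis using lambda_seq_pos[of "Suc m"] x by (simp del: lambda_seq.simps)
  qed
  have nn': "R l k \<rho> \<ge> 0" if "l \<le> Suc j" for l
    using nn[of l] R_lambda[of 0] that by (cases "l = Suc j") auto
  define m where "m = k - j"
  define S where "S = sqrt (\<Prod>l=1..m. lambda_seq l)"
  have S: "S > 0" unfolding S_def by (auto intro!: prod_pos lambda_seq_pos)
  have prod: "(\<Prod>l=1..m. \<rho> / sqrt (R (Suc j + l) k \<rho>)) = 1 / (2 ^ m * S)"
  proof -
    \<comment> \<open>Since \<open>\<rho>\<close> = 1 / (2 x), the x inside the root of lambda_l /
      x^2 cancels and each factor becomes 1 / (2 sqrt lambda_l).\<close>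
    have "(\<Prod>l=1..m. \<rho> / sqrt (R (Suc j + l) k \<rho>)) = (\<Prod>l=1..m. 1 / (2 * sqrt (lambda_seq l)))"
      unfolding R_lambda using x by (intro prod.cong refl) (simp add: \<rho>_def real_sqrt_divide)
    also have "\<dots> = 1 / (2 ^ m * S)"
      by (simp add: prod_dividef prod.distrib S_def sqrt_prod)
    finally show ?thesis .
  qed
  have "coeff_lim (5/4) (sqrt_gf k \<rho> (Suc j + m))
      (of_real (\<Prod>l=1..m. \<rho> / sqrt (R (Suc j + l) k \<rho>)) * (of_real (rGamma (-1/4)) * v))"
    by (rule sqrt_gf_iterate[OF \<rho>0 nn' pos v(1)]) (use jk in \<open>auto simp: m_def\<close>)
  hence lim: "coeff_lim (5/4) (sqrt_gf k \<rho> (Suc k)) (of_real (1 / (2 ^ m * S)) * (of_real (rGamma (-1/4)) * v))"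
    unfolding prod using jk by (simp add: m_def)
  obtain L where L: "(\<lambda>n. real n powr (5/4) * (\<rho> ^ n * fps_nth (H_le k) n)) \<longlonglongrightarrow> L"
    "L \<ge> 0" "complex_of_real L = - (of_real (1 / (2 ^ m * S)) * (of_real (rGamma (-1/4)) * v)) / of_real (2 * \<rho>)"
    using H_le_limit[OF \<rho>0 lim] by blast
  define G where "G = Gamma (3/4 :: real)"
  have G: "G > 0" by (simp add: G_def Gamma_real_pos)
  have L': "complex_of_real L = of_real (1 / (2 ^ m * S * (4 * G) * (2 * \<rho>))) * v"
    unfolding L(3) rGamma_minus_quarter G_def[symmetric] using S G \<rho>0 by (simp add: field_simps)
  \<comment> \<open>Only \<open>v ^ 4\<close> is known, but \<open>L \<ge> 0\<close> is determined by its fourth power.\<close>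
  have "complex_of_real (L ^ 4) = of_real ((1 / (2 ^ m * S * (4 * G) * (2 * \<rho>))) ^ 4 * (4 * \<rho>\<^sup>2 * Q))"
    unfolding of_real_power L' power_mult_distrib v(2) by simp
  hence L4: "L ^ 4 = (1 / (2 ^ m * S * (4 * G) * (2 * \<rho>))) ^ 4 * (4 * \<rho>\<^sup>2 * Q)"
    by (simp only: of_real_eq_iff)
  have h: "h_const j = gamma_const j powr (1/4) * (2 * x) powr (1/4) / (2 ^ (m + 2) * sqrt 2 * G * S)"
    by (simp add: h_const_def x_def m_def S_def G_def k)
  have root: "(y powr (1/4)) ^ 4 = y" if "y > 0" for y :: real
    using that by (subst powr_power) auto
  have s24: "sqrt 2 ^ 4 = (4 :: real)"
  proof -
    have "sqrt 2 ^ 4 = ((sqrt 2)\<^sup>2)\<^sup>2" by (simp only: power_mult[symmetric]) simp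
    thus ?thesis by simp
  qed
  have g0: "gamma_const j > 0" using gamma e(4) \<rho>0 by simp
  have "h_const j ^ 4 = gamma_const j * (2 * x) / (2 ^ (m + 2) * sqrt 2 * G * S) ^ 4"
    unfolding h power_divide power_mult_distrib root[OF g0] using root[of "2 * x"] x by (simp add: power_mult_distrib)
  also have "\<dots> = L ^ 4"
  proof -
    define A where "A = (2 ^ m * G * S) ^ 4"
    have A: "A > 0" using G S by (simp add: A_def)
    have "2 ^ (m + 2) * sqrt 2 * G * S = (2 ^ m * G * S) * 4 * sqrt 2"
      by (simp add: power_add)
    hence e1: "(2 ^ (m + 2) * sqrt 2 * G * S) ^ 4 = 1024 * A"
      by (simp only: power_mult_distrib s24 A_def) simp
    have "2 ^ m * S * (4 * G) * (2 * \<rho>) = (2 ^ m * G * S) * 8 * \<rho>" by simp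
    hence e2: "(2 ^ m * S * (4 * G) * (2 * \<rho>)) ^ 4 = 4096 * A * \<rho> ^ 4"
      by (simp only: power_mult_distrib A_def) simp
    have "2 * (\<rho> * x) = 1" using x by (simp add: \<rho>_def)
    thus ?thesis
      unfolding L4 gamma power_divide e1 e2 using A \<rho>0
      by (simp add: divide_simps power2_eq_square power4_eq_xxxx)
  qed
  finally have h4: "h_const j ^ 4 = L ^ 4" .
  have h0: "h_const j > 0" unfolding h using g0 x G S by (intro divide_pos_pos mult_pos_pos) auto
  have hL: "h_const j = L"
    by (rule power_eq_imp_eq_base[OF h4 less_imp_le[OF h0] L(2)]) simp
  hence "L \<noteq> 0" using h0 by simp
  from asymptotic_toI[OF \<rho>0 this L(1)] have "asymptotic_to (fps_nth (H_le k)) (\<lambda>n. L * real n powr (- (5/4)) * \<rho> powi (- int n))" by simp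
  thus "asymptotic_to (fps_nth (H_le k))
         (\<lambda>n. h_const j * real n powr (-5/4) * sigma_root j k powi (- int n))"
    by (simp add: hL \<sigma> \<rho>')
qed

text \<open>For k strictly between N_j and N_(j+1) the vanishing radicand has index j + 1, which is
  why \<open>Suc j\<close> appears in the first part. The constant there cannot be 0, since division
  by 0 yields 0 and the quotient would not tend to 1. In the second part \<open>j \<ge> 1\<close>
  excludes k = 0, for which no closed terms exist.\<close>

theorem theorem3:
  shows "(\<forall>k j. N_seq j < k \<and> k < N_seq (Suc j) \<longrightarrow>
      (\<exists>h::real. asymptotic_to (fps_nth (H_le k))
         (\<lambda>n. h * real n powr (-3/2) * sigma_root (Suc j) k powi (- int n))))
    \<and> (\<forall>k j. j \<ge> 1 \<and> k = N_seq j \<longrightarrow>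
      asymptotic_to (fps_nth (H_le k))
         (\<lambda>n. h_const j * real n powr (-5/4) * sigma_root j k powi (- int n)) \<and>
      (\<forall>n. h_const j * real n powr (-5/4) * sigma_root j k powi (- int n) =
           h_const j * real n powr (-5/4) * (2 * real (u_seq j)) ^ n))"
proof (intro conjI allI impI; elim conjE)
  fix k j assume "N_seq j < k" "k < N_seq (Suc j)"
  thus "\<exists>h::real. asymptotic_to (fps_nth (H_le k))
         (\<lambda>n. h * real n powr (-3/2) * sigma_root (Suc j) k powi (- int n))"
    by (rule asymptotic_non_critical)
next
  fix k j assume "j \<ge> 1" "k = N_seq j"
  thus "asymptotic_to (fps_nth (H_le k))
         (\<lambda>n. h_const j * real n powr (-5/4) * sigma_root j k powi (- int n))"
    by (rule asymptotic_critical)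
next
  fix k j n assume "j \<ge> (1::nat)" "k = N_seq j"
  thus "h_const j * real n powr (-5/4) * sigma_root j k powi (- int n) =
           h_const j * real n powr (-5/4) * (2 * real (u_seq j)) ^ n"
    by (simp add: asymptotic_critical(1) power_int_minus power_divide field_simps)
qed

end
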